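(* Let $p,q$ be positive integers and let $F(x)=\sum_{\pi\in NC^{(B)}(p,q)}x^{\mathrm{rank}(\pi)}$ denote the rank generating function for $NC^{(B)}(p,q)$. Then $$F(x) = \sum_{i,j\ge 0}\binom{p}{i}^2\binom{q}{j}^2x^{i+j} + \sum_{c\ge 1}\ \sum_{e,i\ge 0}2c\binom{p}{e}\binom{p}{e+c}\binom{q}{i}\binom{q}{i+c}x^{p+q-e-i-c}.$$
   Context: Here $\binom{a}{b}=0$ for nonnegative integers $a<b$, so all sums are finite. Let $p,q$ be positive integers and $N = p+q$. The hyperoctahedral group $B_N$ is the group of permutations $\tau$ of $\{\pm 1,\ldots,\pm N\}$ with $\tau(-i) = -\tau(i)$ for $1\le i\le N$. It is generated by the set consisting of the elements $(i,j)(-i,-j)$ and $(i,-j)(-i,j)$ for $1\le i,j\le N$, $i\neq j$, and the elements $(i,-i)$ for $1\le i\le N$. For $\tau\in B_N$, let $\ell_B(\tau)$ be the smallest $k\ge 0$ such that $\tau$ is a product of $k$ of these generators (the empty product being the identity). The partial order on $B_N$ is: $\tau\le\sigma$ if and only if $\ell_B(\sigma)=\ell_B(\tau)+\ell_B(\tau^{-1}\sigma)$. Let $\gamma_{p,q}\in B_N$ be the permutation with two cycles $$\gamma_{p,q} = (1,\ldots,p,-1,\ldots,-p)\,(p+1,\ldots,p+q,-(p+1),\ldots,-(p+q)),$$ and let $\mathcal{S}^{(B)}_{nc}(p,q) = \{\tau\in B_N \mid \tau\le\gamma_{p,q}\}$. For $\tau\in B_N$, let $\Omega(\tau)$ be the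 partition of $\{\pm1,\ldots,\pm N\}$ into orbits of $\tau$, and let $\widetilde{\Omega}(\tau)$ be the partition obtained from $\Omega(\tau)$ by merging all inversion-invariant blocks (blocks $A$ with $A=-A$), if any exist, into one single block. Define $NC^{(B)}(p,q) = \{\widetilde{\Omega}(\tau)\mid \tau\in \mathcal{S}^{(B)}_{nc}(p,q)\}$, partially ordered by $\pi\le\rho$ if and only if every block of $\pi$ is contained in a block of $\rho$. This is a ranked poset with rank function $$\mathrm{rank}(\pi) = (p+q) - \tfrac12\cdot\#\{\text{blocks } A \text{ of } \pi \text{ with } A\ne -A\}.$$ *)

theory Defs
  imports
    "HOL-Combinatorics.Combinatorics"
    "HOL-Computational_Algebra.Polynomial"
    "HOL-Library.Groups_Big_Fun"
begin

definition signed_points :: "nat \<Rightarrow> int set" where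
  "signed_points N = {- int N..int N} - {0}"

text \<open>A signed permutation is a function on all of \<open>int\<close> that fixes every integer outside
  \<open>\<plusminus>1, \<dots>, \<plusminus>N\<close>, so that function equality is equality in the group.\<close>

definition hyperoctahedral :: "nat \<Rightarrow> (int \<Rightarrow> int) set" where
  "hyperoctahedral N =
     {\<tau>. \<tau> permutes signed_points N \<and> (\<forall>i\<in>{1..int N}. \<tau> (- i) = - \<tau> i)}"

definition B_generators :: "nat \<Rightarrow> (int \<Rightarrow> int) set" where
  "B_generators N =
     {transpose i j \<circ> transpose (- i) (- j) | i j. i \<in> {1..int N} \<and> j \<in> {1..int N} \<and> i \<noteq> j}
   \<union> {transpose i (- j) \<circ> transpose (- i) j | i j. i \<in> {1..int N} \<and> j \<in> {1..int N} \<and> i \<noteq> j}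
   \<union> {transpose i (- i) | i. i \<in> {1..int N}}"

definition B_length :: "nat \<Rightarrow> (int \<Rightarrow> int) \<Rightarrow> nat" where
  "B_length N \<tau> =
     (LEAST k. \<exists>gs. length gs = k \<and> set gs \<subseteq> B_generators N \<and> foldr (\<circ>) gs id = \<tau>)"

text \<open>Products are read right to left. Since \<open>B_generators N\<close> is closed under conjugation by
  signed permutations, reading them left to right would give the same relation.\<close>

definition B_le :: "nat \<Rightarrow> (int \<Rightarrow> int) \<Rightarrow> (int \<Rightarrow> int) \<Rightarrow> bool" where
  "B_le N \<tau> \<sigma> \<longleftrightarrow> B_length N \<sigma> = B_length N \<tau> + B_length N (inv \<tau> \<circ> \<sigma>)"

text \<open>The permutation \<open>cycle_of_list [a\<^sub>1, \<dots>, a\<^sub>m]\<close> sends each \<open>a\<^sub>k\<close> to \<open>a\<^sub>k\<^sub>+\<^sub>1\<close> and \<open>a\<^sub>m\<close> to \<open>a\<^sub>1\<close>.\<close>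

definition gamma_B :: "nat \<Rightarrow> nat \<Rightarrow> int \<Rightarrow> int" where
  "gamma_B p q =
     cycle_of_list ([1..int p] @ map uminus [1..int p]) \<circ>
     cycle_of_list ([int p + 1..int (p + q)] @ map uminus [int p + 1..int (p + q)])"

definition S_nc_B :: "nat \<Rightarrow> nat \<Rightarrow> (int \<Rightarrow> int) set" where
  "S_nc_B p q = {\<tau> \<in> hyperoctahedral (p + q). B_le (p + q) \<tau> (gamma_B p q)}"

definition Omega :: "nat \<Rightarrow> (int \<Rightarrow> int) \<Rightarrow> int set set" where
  "Omega N \<tau> = orbit \<tau> ` signed_points N"

definition inversion_invariant :: "int set \<Rightarrow> bool" where
  "inversion_invariant A \<longleftrightarrow> A = uminus ` A"

definition merge_invariant :: "int set set \<Rightarrow> int set set" where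
  "merge_invariant P =
     (let Z = {A \<in> P. inversion_invariant A}
      in if Z = {} then P else insert (\<Union>Z) (P - Z))"

definition Omega_tilde :: "nat \<Rightarrow> (int \<Rightarrow> int) \<Rightarrow> int set set" where
  "Omega_tilde N \<tau> = merge_invariant (Omega N \<tau>)"

definition NC_B :: "nat \<Rightarrow> nat \<Rightarrow> int set set set" where
  "NC_B p q = Omega_tilde (p + q) ` S_nc_B p q"

text \<open>The blocks counted here come in disjoint pairs \<open>A\<close>, \<open>- A\<close> of subsets of
  \<open>\<plusminus>1, \<dots>, \<plusminus>(p + q)\<close>, so for \<open>\<pi> \<in> NC_B p q\<close> the halving is exact
  and the subtraction does not truncate.\<close>

definition rank_B :: "nat \<Rightarrow> nat \<Rightarrow> int set set \<Rightarrow> nat" where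
  "rank_B p q \<pi> = (p + q) - card {A \<in> \<pi>. \<not> inversion_invariant A} div 2"

definition rank_gen_fun :: "nat \<Rightarrow> nat \<Rightarrow> int poly" where
  "rank_gen_fun p q = (\<Sum>\<pi>\<in>NC_B p q. monom 1 (rank_B p q \<pi>))"

end

theory Submission
  imports Defs Complex_Main "HOL-Library.Numeral_Type"
begin

text \<open>
  The proof counts the interval below \<open>\<gamma> = gamma_B p q\<close> by a recursion that removes one point at a
  time; noncrossing pictures in the annulus never enter.

  A signed permutation \<open>\<tau>\<close> acts on odd functions \<open>v\<close> on \<open>\<plusminus>1, \<dots>, \<plusminus>N\<close> by \<open>v \<circ> \<tau>\<close>, and its reflection
  length is the codimension of its space of fixed vectors. This drives everything. First, if
  \<open>\<tau> \<le> \<sigma>\<close> then every vector fixed by \<open>\<sigma>\<close> is fixed by \<open>\<tau>\<close> (\<open>B_le_fixv_subset\<close>). Secondly, the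
  elements of an interval are determined by their fixed spaces, as Brady and Watt observed for the
  orthogonal group (\<open>lower_eqI\<close>). The fixed space of \<open>\<tau>\<close> can be read off the partition
  \<open>Omega_tilde N \<tau>\<close>, so that \<open>Omega_tilde\<close> is injective on the interval below \<open>\<gamma>\<close>
  (\<open>inj_on_Omega_tilde\<close>); and it turns reflection length into rank (\<open>rank_B_Omega_tilde\<close>). Hence
  the rank generating function is the sum of \<open>x ^ B_length N \<tau>\<close> over all \<open>\<tau> \<le> \<gamma>\<close>.

  To compute that sum for a general \<open>\<sigma>\<close>, fix a point \<open>p\<close> and sort the elements \<open>\<tau> \<le> \<sigma>\<close> by the value
  \<open>j = \<tau> p\<close>. Multiplying \<open>\<tau>\<close> by the reflection that exchanges \<open>p\<close> and \<open>j\<close> leads to the elements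
  below \<open>splice_out \<sigma> p j\<close>, a signed permutation that fixes \<open>p\<close> (\<open>interval_gf_splice_out\<close>). On cycles
  this operation is transparent: if \<open>j\<close> lies on the cycle of \<open>p\<close>, the cycle is cut in two; if \<open>p\<close> and
  \<open>j\<close> lie on two different cycles that are invariant under negation, these merge into a pair of
  opposite cycles. Pairs of opposite cycles of length \<open>n\<close> therefore contribute polynomials \<open>a\<^sub>n = narayana x n\<close> with
  \<open>a\<^sub>n\<^sub>+\<^sub>1 = a\<^sub>n + x \<Sum> a\<^sub>k a\<^sub>n\<^sub>-\<^sub>k\<close> (the Narayana polynomials), and two invariant cycles with \<open>n\<close> and \<open>m\<close>
  points up to sign contribute polynomials \<open>h n m = annular x n m\<close> with
  \<open>h (n + 1) m = h n m + x (a\<^sub>n h 0 m + \<Sum> a\<^sub>k h (n - k) m + \<Sum> h k m a\<^sub>n\<^sub>-\<^sub>k + 2 m a\<^sub>n\<^sub>+\<^sub>m)\<close>;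
  this is \<open>interval_gf_cycle_type\<close>. The last summand is the only one that links the two cycles.

  It remains to see that the right-hand side of the theorem solves the recursion for \<open>h\<close>
  (\<open>annular_Suc\<close>). With \<open>T c n = \<Sum>\<^sub>k (n choose k) (n choose (k + c)) x ^ k\<close> that right-hand side is
  \<open>T 0 p T 0 q + 2 \<Sum>\<^sub>c c x ^ c T c p T c q\<close>. Let \<open>u\<close> be the power series with
  \<open>u = z (1 + u) (1 + x u)\<close>, the generating function of the \<open>a\<^sub>n\<close> with \<open>n \<ge> 1\<close>. Multiplication by
  \<open>u ^ d\<close> sends the generating function of \<open>T c\<close> to that of \<open>T (c + d)\<close>, because both families
  satisfy the same three-term recurrence (\<open>convolution_narayana_pow\<close>). This evaluates all
  convolutions, and what is left is one moment identity, \<open>narayana_pow_moment\<close>.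
\<close>

section \<open>Narayana polynomials and the closed form of the recursion\<close>

text \<open>The coefficient of \<open>y ^ c\<close> in \<open>(1 + y) ^ n (1 + x / y) ^ n\<close>; it counts lattice paths with \<open>n\<close>
  steps \<open>+1\<close>, \<open>0\<close>, \<open>-1\<close> of weights \<open>1\<close>, \<open>1 + x\<close>, \<open>x\<close> from \<open>0\<close> to \<open>c\<close>.\<close>

definition binom_conv :: "'a::comm_ring_1 \<Rightarrow> nat \<Rightarrow> nat \<Rightarrow> 'a" where
  "binom_conv x c n = (\<Sum>k\<le>n. of_nat ((n choose k) * (n choose (k + c))) * x ^ k)"

lemma binom_conv_0_right: "binom_conv x c 0 = (if c = 0 then 1 else 0)"
  by (cases c) (simp_all add: binom_conv_def)

lemma binom_conv_eq_0: "n < c \<Longrightarrow> binom_conv x c n = 0"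
  by (simp add: binom_conv_def binomial_eq_0)

lemma binom_conv_upper:
  assumes "n \<le> K"
  shows "binom_conv x c n = (\<Sum>k\<le>K. of_nat ((n choose k) * (n choose (k + c))) * x ^ k)"
  unfolding binom_conv_def
  by (rule sum.mono_neutral_left) (use assms in \<open>auto simp: binomial_eq_0\<close>)

lemma binom_conv_shift:
  "(\<Sum>k\<le>n. of_nat ((n choose k) * (n choose (Suc k + c))) * x ^ Suc k) = x * binom_conv x (Suc c) n"
  unfolding binom_conv_def sum_distrib_left by (rule sum.cong) (auto simp: algebra_simps)

text \<open>This is the last step of the lattice path, or Pascal's rule applied to both factors.\<close>

lemma binom_conv_Suc:
  "binom_conv x (Suc c) (Suc n) =
     binom_conv x c n + (1 + x) * binom_conv x (Suc c) n + x * binom_conv x (Suc (Suc c)) n"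
proof -
  let ?C = "\<lambda>k l. of_nat ((n choose k) * (n choose l)) :: 'a"
  have "binom_conv x (Suc c) (Suc n) =
      (\<Sum>k\<le>Suc n. of_nat ((Suc n choose k) * ((n choose (k + c)) + (n choose (k + Suc c)))) * x ^ k)"
    by (simp add: binom_conv_def)
  also have "\<dots> = of_nat ((n choose c) + (n choose (Suc c)))
      + (\<Sum>k\<le>n. of_nat ((Suc n choose Suc k) * ((n choose (Suc k + c)) + (n choose (Suc k + Suc c)))) * x ^ Suc k)"
    by (subst sum.atMost_Suc_shift) simp
  also have "\<dots> = (\<Sum>k\<le>Suc n. ?C k (k + c) * x ^ k) + (\<Sum>k\<le>Suc n. ?C k (k + Suc c) * x ^ k)
      + (\<Sum>k\<le>n. ?C k (Suc k + c) * x ^ Suc k) + (\<Sum>k\<le>n. ?C k (Suc k + Suc c) * x ^ Suc k)"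
    unfolding sum.atMost_Suc_shift[where n = n]
    by (simp add: sum.distrib algebra_simps)
  also have "(\<Sum>k\<le>Suc n. ?C k (k + c) * x ^ k) = binom_conv x c n"
    by (rule binom_conv_upper[symmetric]) simp
  also have "(\<Sum>k\<le>Suc n. ?C k (k + Suc c) * x ^ k) = binom_conv x (Suc c) n"
    by (rule binom_conv_upper[symmetric]) simp
  finally show ?thesis
    unfolding binom_conv_shift by (simp add: algebra_simps)
qed

text \<open>At \<open>c = 0\<close> the two neighbours \<open>1\<close> and \<open>-1\<close> of the end point contribute equally, since the number of
  weighted paths to \<open>-c\<close> is \<open>x ^ c\<close> times that of the paths to \<open>c\<close>.\<close>

lemma binom_conv_0_Suc:
  "binom_conv x 0 (Suc n) = (1 + x) * binom_conv x 0 n + 2 * x * binom_conv x 1 n"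
proof -
  let ?C = "\<lambda>k l. of_nat ((n choose k) * (n choose l)) :: 'a"
  have "binom_conv x 0 (Suc n) =
      1 + (\<Sum>k\<le>n. of_nat ((Suc n choose Suc k) * (Suc n choose Suc k)) * x ^ Suc k)"
    unfolding binom_conv_def by (subst sum.atMost_Suc_shift) simp
  also have "\<dots> = (\<Sum>k\<le>Suc n. ?C k (k + 0) * x ^ k)
      + (\<Sum>k\<le>n. ?C k k * x ^ Suc k) + 2 * (\<Sum>k\<le>n. ?C k (Suc k + 0) * x ^ Suc k)"
    unfolding sum.atMost_Suc_shift[where n = n]
    by (simp add: sum.distrib algebra_simps sum_distrib_left flip: mult_2)
  also have "(\<Sum>k\<le>Suc n. ?C k (k + 0) * x ^ k) = binom_conv x 0 n"
    by (rule binom_conv_upper[symmetric]) simp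
  also have "(\<Sum>k\<le>n. ?C k k * x ^ Suc k) = x * binom_conv x 0 n"
    by (simp add: binom_conv_def sum_distrib_left algebra_simps)
  finally show ?thesis
    unfolding binom_conv_shift by (simp add: algebra_simps)
qed

text \<open>The coefficient of \<open>z ^ n\<close> in \<open>u ^ c\<close>, where \<open>u = z (1 + u) (1 + x u)\<close>. The recursion is
  \<open>u ^ (c + 1) = z (u ^ c + (1 + x) u ^ (c + 1) + x u ^ (c + 2))\<close>.\<close>

fun narayana_pow :: "'a::comm_ring_1 \<Rightarrow> nat \<Rightarrow> nat \<Rightarrow> 'a" where
  "narayana_pow x c 0 = (if c = 0 then 1 else 0)"
| "narayana_pow x 0 (Suc n) = 0"
| "narayana_pow x (Suc c) (Suc n) =
     narayana_pow x c n + (1 + x) * narayana_pow x (Suc c) n + x * narayana_pow x (Suc (Suc c)) n"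

lemma narayana_pow_0_left: "narayana_pow x 0 n = (if n = 0 then 1 else 0)"
  by (cases n) auto

text \<open>The reflection principle: \<open>narayana_pow x (Suc c) (Suc n)\<close> counts the paths that stay nonnegative,
  and the subtracted term counts those that reach \<open>-1\<close>.\<close>

lemma narayana_pow_reflection:
  "narayana_pow x (Suc c) (Suc n) = binom_conv x c n - x * binom_conv x (Suc (Suc c)) n"
proof (induction n arbitrary: c)
  case 0
  then show ?case by (cases c) (auto simp: binom_conv_0_right)
next
  case (Suc n)
  show ?case
  proof (cases c)
    case 0
    then show ?thesis
      unfolding narayana_pow.simps(3)[of x c "Suc n"] Suc.IH
      by (simp add: binom_conv_0_Suc binom_conv_Suc algebra_simps)
  next
    case (Suc c')
    then show ?thesis
      unfolding narayana_pow.simps(3)[of x c "Suc n"]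
      by (simp del: narayana_pow.simps add: Suc.IH binom_conv_Suc algebra_simps)
  qed
qed

text \<open>Multiplication by \<open>u ^ d\<close> shifts the index \<open>c\<close> by \<open>d\<close> in every family that satisfies the three-term
  recurrence. The induction on \<open>n\<close> applies the recurrence to the factor \<open>u ^ d\<close> alone, which is why
  all \<open>d\<close> are treated at once.\<close>

lemma convolution_narayana_pow:
  assumes rec: "\<And>c n. F (Suc c) (Suc n) = F c n + (1 + x) * F (Suc c) n + x * F (Suc (Suc c)) n"
    and init: "\<And>c. F (Suc c) 0 = 0"
  shows "(\<Sum>m\<le>n. narayana_pow x d (n - m) * F c m) = F (c + d) n"
proof (induction n arbitrary: d)
  case 0
  show ?case by (cases d) (auto simp: init)
next
  case (Suc n)
  show ?case
  proof (cases d)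
    case 0
    have "(\<Sum>m\<le>Suc n. narayana_pow x 0 (Suc n - m) * F c m)
        = (\<Sum>m\<in>{Suc n}. narayana_pow x 0 (Suc n - m) * F c m)"
      by (rule sum.mono_neutral_right) (auto simp: narayana_pow_0_left)
    then show ?thesis using 0 by simp
  next
    case (Suc d')
    have "(\<Sum>m\<le>Suc n. narayana_pow x d (Suc n - m) * F c m)
        = (\<Sum>m\<le>n. narayana_pow x (Suc d') (Suc (n - m)) * F c m)"
      using Suc by (simp add: Suc_diff_le)
    also have "\<dots> = (\<Sum>m\<le>n. narayana_pow x d' (n - m) * F c m)
        + (1 + x) * (\<Sum>m\<le>n. narayana_pow x (Suc d') (n - m) * F c m)
        + x * (\<Sum>m\<le>n. narayana_pow x (Suc (Suc d')) (n - m) * F c m)"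
      by (simp add: sum.distrib sum_distrib_left algebra_simps)
    finally show ?thesis using Suc by (simp add: Suc.IH rec)
  qed
qed

lemma narayana_pow_eq_0: "n < c \<Longrightarrow> narayana_pow x c n = 0"
proof (induction n arbitrary: c)
  case (Suc n)
  then show ?case by (cases c) auto
qed auto

text \<open>Cut a path of \<open>n + m\<close> steps that stays positive after its start into pieces of \<open>n\<close> and of \<open>m\<close> steps,
  and reverse the second piece; \<open>x ^ c\<close> corrects the weights for the reversal. Formally, the transfer operator of the recursion is
  symmetric for the pairing with weights \<open>x ^ c\<close>, so one step can be moved from one factor to the other.\<close>

lemma narayana_pow_pairing:
  assumes "n \<le> K" "n \<ge> 1"
  shows "(\<Sum>c<K. x ^ c * narayana_pow x (Suc c) n * narayana_pow x (Suc c) (Suc m))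
           = narayana_pow x 1 (n + m)"
  using assms
proof (induction n arbitrary: m)
  case (Suc n)
  let ?u = "narayana_pow x"
  show ?case
  proof (cases n)
    case 0
    have "(\<Sum>c<K. x ^ c * ?u (Suc c) (Suc n) * ?u (Suc c) (Suc m))
        = (\<Sum>c\<in>{0}. x ^ c * ?u (Suc c) (Suc n) * ?u (Suc c) (Suc m))"
      using Suc.prems 0 by (intro sum.mono_neutral_right) auto
    then show ?thesis using 0 by simp
  next
    case (Suc n')
    then obtain L where K: "K = Suc L" using Suc.prems by (cases K) auto
    have L: "?u (Suc K) n = 0" "?u (Suc L) n = 0"
      using Suc.prems by (auto intro!: narayana_pow_eq_0 simp: K)
    have up: "(\<Sum>c<K. x ^ c * ?u c n * w (Suc c)) = x * (\<Sum>c<K. x ^ c * ?u (Suc c) n * w (Suc (Suc c)))" for w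
      unfolding K
      by (subst sum.lessThan_Suc_shift)
        (simp add: L[unfolded Suc] Suc sum_distrib_left algebra_simps del: narayana_pow.simps(3))
    have down: "(\<Sum>c<K. x ^ c * (x * ?u (Suc (Suc c)) n) * w (Suc c)) = (\<Sum>c<K. x ^ c * ?u (Suc c) n * w c)"
      if "w 0 = 0" for w
    proof -
      have "(\<Sum>c<K. x ^ c * ?u (Suc c) n * w c) = (\<Sum>c<Suc K. x ^ c * ?u (Suc c) n * w c)"
        by (simp add: L)
      then show ?thesis using that
        unfolding sum.lessThan_Suc_shift[where n = K] by (simp add: algebra_simps)
    qed
    have "(\<Sum>c<K. x ^ c * ?u (Suc c) (Suc n) * ?u (Suc c) (Suc m)) =
       (\<Sum>c<K. x ^ c * ?u c n * ?u (Suc c) (Suc m))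
       + (\<Sum>c<K. x ^ c * (1 + x) * ?u (Suc c) n * ?u (Suc c) (Suc m))
       + (\<Sum>c<K. x ^ c * (x * ?u (Suc (Suc c)) n) * ?u (Suc c) (Suc m))"
      by (simp del: narayana_pow.simps(3)[of x _ m] add: sum.distrib algebra_simps)
    also have "\<dots> = (\<Sum>c<K. x ^ c * ?u (Suc c) n * ?u (Suc c) (Suc (Suc m)))"
      unfolding up[of "\<lambda>c. ?u c (Suc m)"] down[of "\<lambda>c. ?u c (Suc m)", OF narayana_pow.simps(2)]
        narayana_pow.simps(3)[of x _ "Suc m"]
      by (simp del: narayana_pow.simps add: sum.distrib sum_distrib_left algebra_simps)
    also have "\<dots> = ?u 1 (n + Suc m)"
      using Suc.IH[of "Suc m"] Suc Suc.prems by simp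
    finally show ?thesis by simp
  qed
qed auto

text \<open>The identity behind the summand \<open>2 m a\<^sub>n\<^sub>+\<^sub>m\<close> of the recursion. Transferring one step of the path from
  \<open>narayana_pow\<close> to \<open>binom_conv\<close> increases the sum, because of the weight \<open>Suc c\<close>, by exactly one
  pairing sum; by \<open>narayana_pow_pairing\<close> this increment depends on the total number of
  steps only. Starting from the sum for \<open>q = 0\<close>, which is zero, \<open>q\<close> transfers give the result.\<close>

lemma narayana_pow_moment:
  assumes "q + n \<le> K" "n \<ge> 1"
  shows "(\<Sum>c<K. of_nat (Suc c) * x ^ c * binom_conv x (Suc c) q * narayana_pow x (Suc c) n)
           = of_nat q * narayana_pow x 1 (n + q - 1)"
  using assms
proof (induction q arbitrary: n)
  case 0
  then show ?case by (simp add: binom_conv_0_right)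
next
  case (Suc q)
  let ?u = "narayana_pow x" and ?T = "binom_conv x"
  obtain n' where n: "n = Suc n'" using Suc.prems by (cases n) auto
  obtain L where K: "K = Suc L" using Suc.prems by (cases K) auto
  have z: "?T (Suc K) q = 0" "?T K q = 0" "?T (Suc L) q = 0" "?u K n = 0" "?u (Suc K) n = 0" "?u (Suc L) n = 0"
    using Suc.prems by (auto intro!: narayana_pow_eq_0 binom_conv_eq_0 simp: K)
  \<comment> \<open>\<open>D\<close>, \<open>E\<close>, \<open>G\<close> come from the recurrence of \<open>binom_conv\<close>, and \<open>D'\<close>, \<open>E\<close>, \<open>G'\<close> from that of
    \<open>narayana_pow\<close>. After an index shift \<open>x * G'\<close> becomes \<open>D\<close>, and \<open>D'\<close> becomes \<open>x * G\<close>, up to the change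
    of the weight \<open>Suc c\<close>.\<close>
  define D where "D = (\<Sum>c<K. of_nat (Suc c) * x ^ c * ?T c q * ?u (Suc c) n)"
  define E where "E = (\<Sum>c<K. of_nat (Suc c) * x ^ c * ?T (Suc c) q * ?u (Suc c) n)"
  define G where "G = (\<Sum>c<K. of_nat (Suc c) * x ^ c * ?T (Suc (Suc c)) q * ?u (Suc c) n)"
  define D' where "D' = (\<Sum>c<K. of_nat (Suc c) * x ^ c * ?T (Suc c) q * ?u c n)"
  define G' where "G' = (\<Sum>c<K. of_nat (Suc c) * x ^ c * ?T (Suc c) q * ?u (Suc (Suc c)) n)"
  have 1: "(\<Sum>c<K. of_nat (Suc c) * x ^ c * ?T (Suc c) (Suc q) * ?u (Suc c) n) = D + (1 + x) * E + x * G"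
    unfolding D_def E_def G_def binom_conv_Suc
    by (simp only: sum.distrib[symmetric] sum_distrib_left) (rule sum.cong, auto simp: algebra_simps)
  have 2: "(\<Sum>c<K. of_nat (Suc c) * x ^ c * ?T (Suc c) q * ?u (Suc c) (Suc n)) = D' + (1 + x) * E + x * G'"
    unfolding D'_def E_def G'_def narayana_pow.simps(3)
    by (simp only: sum.distrib[symmetric] sum_distrib_left) (rule sum.cong, auto simp: algebra_simps)
  have D': "D' = x * (\<Sum>c<K. of_nat (Suc (Suc c)) * x ^ c * ?T (Suc (Suc c)) q * ?u (Suc c) n)"
    unfolding D'_def K
    by (subst sum.lessThan_Suc_shift)
      (simp add: z[unfolded n] n sum_distrib_left algebra_simps del: narayana_pow.simps(3))
  have D: "D = (\<Sum>c<K. x ^ c * ?T c q * ?u (Suc c) n) + (\<Sum>c<K. of_nat c * x ^ c * ?T c q * ?u (Suc c) n)"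
    unfolding D_def by (simp add: algebra_simps sum.distrib del: narayana_pow.simps)
  have G': "x * G' = (\<Sum>c<K. of_nat c * x ^ c * ?T c q * ?u (Suc c) n)"
  proof -
    have "(\<Sum>c<K. of_nat c * x ^ c * ?T c q * ?u (Suc c) n) = (\<Sum>c<Suc K. of_nat c * x ^ c * ?T c q * ?u (Suc c) n)"
      by (simp add: z)
    then show ?thesis
      unfolding sum.lessThan_Suc_shift[where n = K] G'_def sum_distrib_left by (simp add: algebra_simps)
  qed
  have "D + x * G - (D' + x * G') = (\<Sum>c<K. x ^ c * ?u (Suc c) n * (?T c q - x * ?T (Suc (Suc c)) q))"
    unfolding D D' G' G_def by (simp add: algebra_simps sum_distrib_left sum.distrib sum_subtractf del: narayana_pow.simps)
  also have "\<dots> = (\<Sum>c<K. x ^ c * ?u (Suc c) n * ?u (Suc c) (Suc q))"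
    unfolding narayana_pow_reflection ..
  also have "\<dots> = ?u 1 (n + q)"
    using Suc.prems by (intro narayana_pow_pairing) auto
  finally have DG: "D + x * G = D' + x * G' + ?u 1 (n + q)" by (simp add: algebra_simps)
  have "D + (1 + x) * E + x * G = (D + x * G) + (1 + x) * E" by (simp add: algebra_simps)
  also have "\<dots> = (D' + (1 + x) * E + x * G') + ?u 1 (n + q)" unfolding DG by (simp add: algebra_simps)
  also have "D' + (1 + x) * E + x * G' = of_nat q * ?u 1 (n + q)"
    using Suc.IH[of "Suc n"] Suc.prems unfolding 2 by simp
  finally show ?case unfolding 1 by (simp add: algebra_simps)
qed


text \<open>The rank generating function of the noncrossing partitions of \<open>n\<close> points, with generating function
  \<open>1 + u\<close>.\<close>

definition narayana :: "'a::comm_ring_1 \<Rightarrow> nat \<Rightarrow> 'a" where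
  "narayana x n = narayana_pow x 0 n + narayana_pow x 1 n"

lemma narayana_0: "narayana x 0 = 1"
  by (simp add: narayana_def)

lemma narayana_pos: "n \<ge> 1 \<Longrightarrow> narayana x n = narayana_pow x 1 n"
  by (simp add: narayana_def narayana_pow_0_left)

text \<open>The relation \<open>u = z (1 + u) (1 + x u)\<close> with \<open>u ^ 2\<close> written as a convolution.\<close>

lemma narayana_Suc:
  "narayana x (Suc n) = narayana x n + x * (\<Sum>k<n. narayana x k * narayana x (n - k))"
proof -
  let ?u = "narayana_pow x"
  have sq: "?u 2 n = (\<Sum>k\<le>n. ?u 1 (n - k) * ?u 1 k)"
    by (subst convolution_narayana_pow[where F = ?u]) (auto simp: numeral_2_eq_2)
  have "narayana x (Suc n) = ?u 0 n + (1 + x) * ?u 1 n + x * ?u 2 n"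
    by (simp add: narayana_def numeral_2_eq_2)
  also have "\<dots> = narayana x n + x * (?u 1 n + (\<Sum>k\<le>n. ?u 1 (n - k) * ?u 1 k))"
    unfolding sq by (simp add: narayana_def algebra_simps)
  also have "?u 1 n + (\<Sum>k\<le>n. ?u 1 (n - k) * ?u 1 k) = (\<Sum>k\<le>n. ?u 1 (n - k) * narayana x k)"
    unfolding narayana_def distrib_left sum.distrib
    using convolution_narayana_pow[where F = ?u and c = 0 and d = 1 and x = x and n = n] by simp
  also have "\<dots> = (\<Sum>k<n. narayana x k * narayana x (n - k))"
    by (cases n) (auto simp: lessThan_Suc_atMost[symmetric] narayana_pos intro!: sum.cong)
  finally show ?thesis .
qed

text \<open>The closed form, with the sums over binomial coefficients collected in \<open>binom_conv\<close>. The bound \<open>n + m\<close> is a crude but symmetric one: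
  the summands vanish as soon as \<open>c \<ge> min n m\<close>.\<close>

definition annular :: "'a::comm_ring_1 \<Rightarrow> nat \<Rightarrow> nat \<Rightarrow> 'a" where
  "annular x n m = binom_conv x 0 n * binom_conv x 0 m
     + 2 * (\<Sum>c<n + m. of_nat (Suc c) * x ^ Suc c * binom_conv x (Suc c) n * binom_conv x (Suc c) m)"

lemma annular_commute: "annular x n m = annular x m n"
  by (simp add: annular_def add.commute mult_ac)

lemma annular_0_0: "annular x 0 0 = 1"
  by (simp add: annular_def binom_conv_0_right)

lemma annular_upper:
  assumes "n \<le> K \<or> m \<le> K"
  shows "annular x n m = binom_conv x 0 n * binom_conv x 0 m
     + 2 * (\<Sum>c<K. of_nat (Suc c) * x ^ Suc c * binom_conv x (Suc c) n * binom_conv x (Suc c) m)"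
proof -
  let ?f = "\<lambda>c. of_nat (Suc c) * x ^ Suc c * binom_conv x (Suc c) n * binom_conv x (Suc c) m"
  have "sum ?f {..<n + m} = sum ?f {..<min n m}"
    by (rule sum.mono_neutral_right) (auto simp: not_less min_le_iff_disj binom_conv_eq_0)
  also have "\<dots> = sum ?f {..<K}" using assms
    by (intro sum.mono_neutral_left) (auto simp: not_less min_le_iff_disj binom_conv_eq_0)
  finally show ?thesis by (simp add: annular_def)
qed

lemma convolution_narayana_binom:
  "(\<Sum>k\<le>n. narayana x (n - k) * binom_conv x c k) = binom_conv x c n + binom_conv x (Suc c) n"
  unfolding narayana_def distrib_right sum.distrib
  using convolution_narayana_pow[where F = "binom_conv x" and x = x and n = n and c = c]
  by (simp add: binom_conv_Suc binom_conv_0_right)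

lemma convolution_narayana_annular:
  "(\<Sum>k\<le>n. narayana x (n - k) * annular x k m) = annular x n m + binom_conv x 1 n * binom_conv x 0 m
     + 2 * (\<Sum>c<n + m. of_nat (Suc c) * x ^ Suc c * binom_conv x (Suc (Suc c)) n * binom_conv x (Suc c) m)"
proof -
  let ?t = "binom_conv x"
  have "(\<Sum>k\<le>n. narayana x (n - k) * annular x k m) =
    (\<Sum>k\<le>n. narayana x (n - k) * (?t 0 k * ?t 0 m
      + 2 * (\<Sum>c<n + m. of_nat (Suc c) * x ^ Suc c * ?t (Suc c) k * ?t (Suc c) m)))"
    by (intro sum.cong refl) (subst annular_upper[where K = "n + m"], auto)
  also have "\<dots> = (\<Sum>k\<le>n. narayana x (n - k) * ?t 0 k) * ?t 0 m
      + 2 * (\<Sum>k\<le>n. \<Sum>c<n + m. of_nat (Suc c) * x ^ Suc c * (narayana x (n - k) * ?t (Suc c) k) * ?t (Suc c) m)"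
    by (simp add: distrib_left sum.distrib sum_distrib_left sum_distrib_right mult_ac)
  also have "(\<Sum>k\<le>n. \<Sum>c<n + m. of_nat (Suc c) * x ^ Suc c * (narayana x (n - k) * ?t (Suc c) k) * ?t (Suc c) m)
      = (\<Sum>c<n + m. of_nat (Suc c) * x ^ Suc c * (\<Sum>k\<le>n. narayana x (n - k) * ?t (Suc c) k) * ?t (Suc c) m)"
    by (subst sum.swap) (simp add: sum_distrib_left sum_distrib_right)
  finally show ?thesis
    unfolding convolution_narayana_binom by (simp add: annular_def sum.distrib algebra_simps)
qed

text \<open>After \<open>convolution_narayana_annular\<close> both sides are combinations of the sums \<open>S\<close> below with
  \<open>T c n\<close>, \<open>T (c + 1) n\<close> and \<open>T (c + 2) n\<close> in place of \<open>f\<close>. They differ by the sum with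
  \<open>T c n - x T (c + 2) n\<close>, which is a coefficient of \<open>u ^ (c + 1)\<close> and hence covered by the moment identity.\<close>

lemma annular_Suc:
  "annular x (Suc n) m = annular x n m
     + x * (narayana x n * annular x 0 m
            + (\<Sum>k<n. narayana x k * annular x (n - k) m)
            + (\<Sum>k<n. annular x k m * narayana x (n - k))
            + 2 * of_nat m * narayana x (n + m))"
proof -
  let ?t = "binom_conv x" and ?u = "narayana_pow x"
  define K where "K = m + Suc n"
  define S where "S f = (\<Sum>c<K. of_nat (Suc c) * x ^ Suc c * f c * ?t (Suc c) m)" for f :: "nat \<Rightarrow> 'a"
  have S: "annular x k m = ?t 0 k * ?t 0 m + 2 * S (\<lambda>c. ?t (Suc c) k)" for k
    unfolding S_def by (rule annular_upper) (simp add: K_def)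
  have S_linear: "S (\<lambda>c. f c + x * g c) = S f + x * S g" "S (\<lambda>c. f c - x * g c) = S f - x * S g"
     "S (\<lambda>c. (1 + x) * f c) = (1 + x) * S f" for f g
    unfolding S_def by (simp_all add: algebra_simps sum.distrib sum_subtractf sum_distrib_left)
  have "(\<Sum>c<n + m. of_nat (Suc c) * x ^ Suc c * ?t (Suc (Suc c)) n * ?t (Suc c) m) = S (\<lambda>c. ?t (Suc (Suc c)) n)"
    unfolding S_def by (intro sum.mono_neutral_left) (auto simp: K_def binom_conv_eq_0)
  note conv = convolution_narayana_annular[where n = n and x = x and m = m, unfolded this]
  have fst: "narayana x n * annular x 0 m + (\<Sum>k<n. narayana x k * annular x (n - k) m)
      = (\<Sum>k\<le>n. narayana x (n - k) * annular x k m)"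
  proof -
    have "(\<Sum>k\<le>n. narayana x (n - k) * annular x k m) = (\<Sum>k\<le>n. narayana x k * annular x (n - k) m)"
      by (rule sum.reindex_bij_witness[where i = "\<lambda>k. n - k" and j = "\<lambda>k. n - k"]) auto
    then show ?thesis by (simp add: lessThan_Suc_atMost[symmetric] add.commute)
  qed
  have snd: "(\<Sum>k<n. annular x k m * narayana x (n - k)) + annular x n m
      = (\<Sum>k\<le>n. narayana x (n - k) * annular x k m)"
    by (simp add: lessThan_Suc_atMost[symmetric] mult.commute narayana_0)
  have mom: "S (\<lambda>c. ?u (Suc c) (Suc n)) = x * (of_nat m * narayana x (n + m))"
  proof (cases "m = 0")
    case False
    have "S (\<lambda>c. ?u (Suc c) (Suc n)) = x * (\<Sum>c<K. of_nat (Suc c) * x ^ c * ?t (Suc c) m * ?u (Suc c) (Suc n))"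
      unfolding S_def sum_distrib_left by (simp add: algebra_simps del: narayana_pow.simps(3))
    then show ?thesis using False
      by (subst (asm) narayana_pow_moment) (auto simp: K_def narayana_pos)
  qed (simp add: S_def binom_conv_0_right)
  have "S (\<lambda>c. ?t (Suc c) (Suc n)) = S (\<lambda>c. ?t c n) + (1 + x) * S (\<lambda>c. ?t (Suc c) n) + x * S (\<lambda>c. ?t (Suc (Suc c)) n)"
    unfolding binom_conv_Suc S_def by (simp add: algebra_simps sum.distrib sum_distrib_left)
  also have "S (\<lambda>c. ?t c n) = x * (of_nat m * narayana x (n + m)) + x * S (\<lambda>c. ?t (Suc (Suc c)) n)"
    using mom unfolding narayana_pow_reflection S_linear by (simp add: algebra_simps)
  finally have "annular x (Suc n) m = ((1 + x) * ?t 0 n + 2 * x * ?t 1 n) * ?t 0 m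
      + 2 * (x * (of_nat m * narayana x (n + m)) + (1 + x) * S (\<lambda>c. ?t (Suc c) n) + 2 * x * S (\<lambda>c. ?t (Suc (Suc c)) n))"
    unfolding S[of "Suc n"] by (simp add: binom_conv_0_Suc algebra_simps)
  moreover have "narayana x n * annular x 0 m + (\<Sum>k<n. narayana x k * annular x (n - k) m)
      + (\<Sum>k<n. annular x k m * narayana x (n - k)) =
       annular x n m + 2 * (?t 1 n * ?t 0 m) + 4 * S (\<lambda>c. ?t (Suc (Suc c)) n)"
    using snd unfolding fst conv by (simp add: algebra_simps)
  ultimately show ?thesis unfolding S[of n] by (simp add: algebra_simps)
qed

section \<open>Signed permutations and their fixed vectors\<close>

text \<open>Oddness on all of \<open>int\<close> is more convenient than on \<open>{1..int N}\<close>, as it needs no case distinction on signs.\<close>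

lemma hyperoctahedral_iff:
  "\<tau> \<in> hyperoctahedral N \<longleftrightarrow>
     bij \<tau> \<and> (\<forall>x. \<tau> (- x) = - \<tau> x) \<and> (\<forall>x. int N < \<bar>x\<bar> \<longrightarrow> \<tau> x = x)"
proof
  assume \<tau>: "\<tau> \<in> hyperoctahedral N"
  then have p: "\<tau> permutes signed_points N" and odd: "\<And>i. i \<in> {1..int N} \<Longrightarrow> \<tau> (- i) = - \<tau> i"
    by (auto simp: hyperoctahedral_def)
  have fixed: "\<tau> x = x" if "int N < \<bar>x\<bar> \<or> x = 0" for x
    using that by (intro permutes_not_in[OF p]) (auto simp: signed_points_def)
  moreover have "\<tau> (- x) = - \<tau> x" for x
  proof -
    consider "x \<in> {1..int N}" | "- x \<in> {1..int N}" | "int N < \<bar>x\<bar> \<or> x = 0" by auto linarith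
    then show ?thesis
      by cases (use odd[of x] odd[of "- x"] fixed[of x] fixed[of "- x"] in auto)
  qed
  ultimately show "bij \<tau> \<and> (\<forall>x. \<tau> (- x) = - \<tau> x) \<and> (\<forall>x. int N < \<bar>x\<bar> \<longrightarrow> \<tau> x = x)"
    using permutes_bij[OF p] by auto
next
  assume \<tau>: "bij \<tau> \<and> (\<forall>x. \<tau> (- x) = - \<tau> x) \<and> (\<forall>x. int N < \<bar>x\<bar> \<longrightarrow> \<tau> x = x)"
  have "\<tau> (- 0) = - \<tau> 0" using \<tau> by blast
  then have 0: "\<tau> 0 = 0" by simp
  have "\<tau> x = x" if "x \<notin> signed_points N" for x
    using that \<tau> 0 by (cases "x = 0") (auto simp: signed_points_def)
  then show "\<tau> \<in> hyperoctahedral N"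
    using \<tau> by (auto simp: hyperoctahedral_def permutes_def bij_iff)
qed

lemma hyperoctahedral_permutes: "\<tau> \<in> hyperoctahedral N \<Longrightarrow> \<tau> permutes signed_points N"
  by (simp add: hyperoctahedral_def)

lemma hyperoctahedral_minus: "\<tau> \<in> hyperoctahedral N \<Longrightarrow> \<tau> (- x) = - \<tau> x"
  by (simp add: hyperoctahedral_iff)

lemma hyperoctahedral_bij: "\<tau> \<in> hyperoctahedral N \<Longrightarrow> bij \<tau>"
  by (simp add: hyperoctahedral_iff)

lemma hyperoctahedral_eq_iff: "\<tau> \<in> hyperoctahedral N \<Longrightarrow> \<tau> x = \<tau> y \<longleftrightarrow> x = y"
  by (meson hyperoctahedral_bij bij_is_inj inj_eq)

lemma hyperoctahedral_mem_iff:
  "\<tau> \<in> hyperoctahedral N \<Longrightarrow> \<tau> x \<in> signed_points N \<longleftrightarrow> x \<in> signed_points N"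
  by (rule permutes_in_image[OF hyperoctahedral_permutes])

lemma id_hyperoctahedral: "id \<in> hyperoctahedral N"
  by (simp add: hyperoctahedral_iff)

lemma comp_hyperoctahedral:
  "\<sigma> \<in> hyperoctahedral N \<Longrightarrow> \<tau> \<in> hyperoctahedral N \<Longrightarrow> \<sigma> \<circ> \<tau> \<in> hyperoctahedral N"
  by (auto simp: hyperoctahedral_iff bij_comp)

lemma inv_hyperoctahedral:
  assumes "\<tau> \<in> hyperoctahedral N" shows "inv \<tau> \<in> hyperoctahedral N"
proof -
  have b: "bij \<tau>" using assms by (rule hyperoctahedral_bij)
  then have s: "\<tau> (inv \<tau> x) = x" "inv \<tau> (\<tau> x) = x" for x
    by (simp_all add: bij_is_surj surj_f_inv_f bij_is_inj)
  have "inv \<tau> (- x) = - inv \<tau> x" for x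
    by (metis assms hyperoctahedral_minus s)
  moreover have "inv \<tau> x = x" if "int N < \<bar>x\<bar>" for x
    using assms that by (metis hyperoctahedral_iff s(2))
  ultimately show ?thesis using b by (simp add: hyperoctahedral_iff bij_imp_bij_inv)
qed

lemma hyperoctahedral_inv_simps:
  assumes "\<tau> \<in> hyperoctahedral N"
  shows "\<tau> (inv \<tau> x) = x" "inv \<tau> (\<tau> x) = x" "\<tau> \<circ> inv \<tau> = id" "inv \<tau> \<circ> \<tau> = id"
    "\<tau> \<circ> (inv \<tau> \<circ> \<sigma>) = \<sigma>" "inv \<tau> \<circ> (\<tau> \<circ> \<sigma>) = \<sigma>"
  using hyperoctahedral_bij[OF assms]
  by (simp_all add: bij_is_surj surj_f_inv_f bij_is_inj fun_eq_iff)

lemma finite_signed_points: "finite (signed_points N)"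
  by (simp add: signed_points_def)

lemma signed_points_minus: "- x \<in> signed_points N \<longleftrightarrow> x \<in> signed_points N"
  by (auto simp: signed_points_def)

lemma finite_hyperoctahedral: "finite (hyperoctahedral N)"
  by (rule finite_subset[OF _ finite_permutations[OF finite_signed_points[of N]]])
    (auto simp: hyperoctahedral_def)

lemma hyperoctahedral_permutation: "\<tau> \<in> hyperoctahedral N \<Longrightarrow> permutation \<tau>"
  using hyperoctahedral_permutes finite_signed_points permutation_permutes by blast

text \<open>All three kinds of generators at once: for \<open>j = - i\<close> this is the transposition of \<open>i\<close> and \<open>- i\<close>, and
  for \<open>i = j\<close> it is the identity.\<close>

definition signed_swap :: "int \<Rightarrow> int \<Rightarrow> int \<Rightarrow> int" where
  "signed_swap i j x = (if x = i then j else if x = j then i else if x = - i then - j else if x = - j then - i else x)"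

lemma signed_swap_self [simp]: "signed_swap i i = id"
  by (auto simp: signed_swap_def fun_eq_iff)

lemma signed_swap_left [simp]: "signed_swap i j i = j" by (simp add: signed_swap_def)

lemma signed_swap_right [simp]: "signed_swap i j j = i" by (simp add: signed_swap_def)

lemma signed_swap_invol: "i \<noteq> 0 \<Longrightarrow> j \<noteq> 0 \<Longrightarrow> signed_swap i j (signed_swap i j x) = x"
  by (auto simp: signed_swap_def)

lemma signed_swap_comp_self:
  "i \<in> signed_points N \<Longrightarrow> j \<in> signed_points N \<Longrightarrow> signed_swap i j \<circ> signed_swap i j = id"
  by (auto simp: fun_eq_iff signed_swap_invol signed_points_def)

lemma signed_swap_comp_comp:
  assumes "i \<in> signed_points N" "j \<in> signed_points N"
  shows "(\<sigma> \<circ> signed_swap i j) \<circ> signed_swap i j = \<sigma>" "signed_swap i j \<circ> (signed_swap i j \<circ> \<sigma>) = \<sigma>"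
  using assms by (auto simp: fun_eq_iff signed_swap_invol signed_points_def)

lemma signed_swap_hyperoctahedral:
  assumes "i \<in> signed_points N" "j \<in> signed_points N"
  shows "signed_swap i j \<in> hyperoctahedral N"
proof -
  have "signed_swap i j (signed_swap i j x) = x" for x using assms by (intro signed_swap_invol) (auto simp: signed_points_def)
  then have "bij (signed_swap i j)" by (intro o_bij[of "signed_swap i j"]) (auto simp: fun_eq_iff)
  then show ?thesis using assms
    by (auto simp: hyperoctahedral_iff signed_swap_def signed_points_def)
qed

lemma B_generators_eq:
  "B_generators N = {signed_swap i j | i j. i \<in> signed_points N \<and> j \<in> signed_points N \<and> i \<noteq> j}" (is "_ = ?R")
proof
  have 1: "transpose i j \<circ> transpose (- i) (- j) = signed_swap i j" if "i > 0" "j \<noteq> - i" "j \<noteq> 0" for i j :: int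
    using that by (auto simp: fun_eq_iff signed_swap_def transpose_def)
  have 2: "transpose i (- i) = signed_swap i (- i)" for i :: int
    by (auto simp: fun_eq_iff signed_swap_def transpose_def)
  show "B_generators N \<subseteq> ?R"
  proof
    fix g assume "g \<in> B_generators N"
    then consider (a) i j where "g = transpose i j \<circ> transpose (- i) (- j)" "i \<in> {1..int N}" "j \<in> {1..int N}" "i \<noteq> j"
      | (b) i j where "g = transpose i (- j) \<circ> transpose (- i) j" "i \<in> {1..int N}" "j \<in> {1..int N}" "i \<noteq> j"
      | (c) i where "g = transpose i (- i)" "i \<in> {1..int N}"
      unfolding B_generators_def by blast
    then show "g \<in> ?R"
    proof cases
      case a
      then have "g = signed_swap i j" "i \<in> signed_points N" "j \<in> signed_points N" using 1[of i j] by (auto simp: signed_points_def)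
      then show ?thesis using a by blast
    next
      case b
      then have "g = signed_swap i (- j)" "i \<in> signed_points N" "- j \<in> signed_points N" "i \<noteq> - j"
        using 1[of i "- j"] by (auto simp: signed_points_def)
      then show ?thesis by blast
    next
      case c
      then have "g = signed_swap i (- i)" "i \<in> signed_points N" "- i \<in> signed_points N" "i \<noteq> - i"
        using 2[of i] by (auto simp: signed_points_def)
      then show ?thesis by blast
    qed
  qed
  show "?R \<subseteq> B_generators N"
  proof
    fix g assume "g \<in> ?R"
    then obtain i' j' where g': "g = signed_swap i' j'" "i' \<in> signed_points N" "j' \<in> signed_points N" "i' \<noteq> j'" by blast
    define i where "i = \<bar>i'\<bar>"
    define j where "j = (if i' > 0 then j' else - j')"
    have g: "g = signed_swap i j" "i \<in> {1..int N}" "j \<in> signed_points N" "i \<noteq> j"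
      using g' by (auto simp: i_def j_def signed_points_def signed_swap_def fun_eq_iff)
    consider "j = - i" | "j > 0" | "j < 0" "j \<noteq> - i" using g(3) by (force simp: signed_points_def)
    then show "g \<in> B_generators N"
    proof cases
      case 1
      then have "g = transpose i (- i)" using 2 g by simp
      then show ?thesis using g unfolding B_generators_def by blast
    next
      case 2
      then have "g = transpose i j \<circ> transpose (- i) (- j)" "j \<in> {1..int N}"
        using 1[of i j] g by (auto simp: signed_points_def)
      then show ?thesis using g unfolding B_generators_def by blast
    next
      case 3
      then have "g = transpose i (- (- j)) \<circ> transpose (- i) (- j)" "- j \<in> {1..int N}" "i \<noteq> - j"
        using 1[of i j] g by (auto simp: signed_points_def)
      then show ?thesis using g(2) unfolding B_generators_def by blast
    qed
  qed
qed

lemma B_generators_hyperoctahedral: "B_generators N \<subseteq> hyperoctahedral N"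
  by (auto simp: B_generators_eq signed_swap_hyperoctahedral)

text \<open>Odd functions that vanish outside \<open>\<plusminus>1, \<dots>, \<plusminus>N\<close> and are constant on the orbits of \<open>\<tau>\<close>. The coefficients
  are kept general: real ones are used where positivity or division matters, and those modulo 3 to
  measure the dimension by counting.\<close>

definition fixv :: "nat \<Rightarrow> (int \<Rightarrow> int) \<Rightarrow> (int \<Rightarrow> 'a::comm_ring_1) set" where
  "fixv N \<tau> = {v. (\<forall>x. v (- x) = - v x) \<and> (\<forall>x. x \<notin> signed_points N \<longrightarrow> v x = 0) \<and> (\<forall>x. v (\<tau> x) = v x)}"

lemma fixvI:
  "(\<And>x. v (- x) = - v x) \<Longrightarrow> (\<And>x. x \<notin> signed_points N \<Longrightarrow> v x = 0) \<Longrightarrow> (\<And>x. v (\<tau> x) = v x) \<Longrightarrow> v \<in> fixv N \<tau>"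
  by (simp add: fixv_def)

lemma fixv_minus: "v \<in> fixv N \<tau> \<Longrightarrow> v (- x) = - v x"
  and fixv_outside: "v \<in> fixv N \<tau> \<Longrightarrow> x \<notin> signed_points N \<Longrightarrow> v x = 0"
  and fixv_apply: "v \<in> fixv N \<tau> \<Longrightarrow> v (\<tau> x) = v x"
  by (simp_all add: fixv_def)

lemma fixv_combine:
  "v \<in> fixv N \<tau> \<Longrightarrow> w \<in> fixv N \<tau> \<Longrightarrow> (\<lambda>x. v x + c * w x) \<in> fixv N \<tau>"
  by (simp add: fixv_def)

lemma fixv_inv:
  assumes "\<tau> \<in> hyperoctahedral N" shows "fixv N (inv \<tau>) = fixv N \<tau>"
  unfolding fixv_def by (metis (no_types, lifting) hyperoctahedral_inv_simps(1,2)[OF assms])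

text \<open>A vector is fixed by the reflection in \<open>i\<close> and \<open>j\<close> exactly if it lies in the hyperplane \<open>v i = v j\<close>.\<close>

lemma fixv_comp_signed_swap:
  assumes "v \<in> fixv N \<tau>" "v i = v j"
  shows "v \<in> fixv N (\<tau> \<circ> signed_swap i j)"
  using assms by (auto simp: fixv_def signed_swap_def)

lemma fixv_orbit:
  assumes "v \<in> fixv N \<tau>" "y \<in> orbit \<tau> x" shows "v y = v x"
  using assms(2) by induct (simp_all add: fixv_apply[OF assms(1)])

text \<open>No fixed vector distinguishes \<open>i\<close> from \<open>j\<close>: it has to vanish on orbits that are invariant under
  negation. In geometric terms, the reflecting hyperplane of \<open>signed_swap i j\<close> contains the fixed space of \<open>\<tau>\<close>.\<close>

definition inseparable :: "(int \<Rightarrow> int) \<Rightarrow> int \<Rightarrow> int \<Rightarrow> bool" where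
  "inseparable \<tau> i j \<longleftrightarrow> j \<in> orbit \<tau> i \<or> (- i \<in> orbit \<tau> i \<and> - j \<in> orbit \<tau> j)"

lemma fixv_inseparable:
  fixes v :: "int \<Rightarrow> 'a::comm_ring_1"
  assumes v: "v \<in> fixv N \<tau>" and "inseparable \<tau> i j" and h: "h + h = (1::'a)"
  shows "v i = v j"
proof -
  have "v k = 0" if "- k \<in> orbit \<tau> k" for k
  proof -
    have "v k + v k = 0" using fixv_orbit[OF v that] fixv_minus[OF v, of k] by (simp add: eq_neg_iff_add_eq_0)
    then have "h * v k + h * v k = 0" by (simp flip: distrib_left)
    then show ?thesis using h by (simp flip: distrib_right)
  qed
  then show ?thesis using assms(2) fixv_orbit[OF v] by (auto simp: inseparable_def)
qed

lemma orbit_uminus: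
  assumes "\<tau> \<in> hyperoctahedral N" "y \<in> orbit \<tau> x" shows "- y \<in> orbit \<tau> (- x)"
  using assms(2) by induct (metis assms(1) hyperoctahedral_minus orbit.intros)+

lemma orbit_sym:
  assumes "\<tau> \<in> hyperoctahedral N" "y \<in> orbit \<tau> x" shows "x \<in> orbit \<tau> y"
  using assms by (meson hyperoctahedral_permutation orbit_swap permutation_self_in_orbit)

lemma orbit_self: "\<tau> \<in> hyperoctahedral N \<Longrightarrow> x \<in> orbit \<tau> x"
  by (meson hyperoctahedral_permutation permutation_self_in_orbit)

lemma apply_in_orbit_iff:
  assumes "\<tau> \<in> hyperoctahedral N" shows "\<tau> x \<in> orbit \<tau> y \<longleftrightarrow> x \<in> orbit \<tau> y"
  by (meson assms orbit.base orbit.step orbit_sym orbit_trans)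

lemma orbit_signed_points:
  assumes "\<tau> \<in> hyperoctahedral N" "y \<in> orbit \<tau> x" shows "y \<in> signed_points N \<longleftrightarrow> x \<in> signed_points N"
  using assms(2) by induct (simp_all add: hyperoctahedral_mem_iff[OF assms(1)])

text \<open>The odd part of the indicator of the orbit of \<open>i\<close>, or of \<open>j\<close> if the former vanishes.\<close>

lemma separating_fixv:
  assumes \<tau>: "\<tau> \<in> hyperoctahedral N" and i: "i \<in> signed_points N" and "j \<in> signed_points N"
    and ns: "\<not> inseparable \<tau> i j"
  shows "\<exists>v::int \<Rightarrow> real. v \<in> fixv N \<tau> \<and> v i \<noteq> v j"
proof -
  define v :: "int \<Rightarrow> int \<Rightarrow> real" where "v = (\<lambda>a x. of_bool (x \<in> orbit \<tau> a) - of_bool (- x \<in> orbit \<tau> a))"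
  have v: "v a \<in> fixv N \<tau>" if "a \<in> signed_points N" for a
  proof (rule fixvI)
    fix x assume "x \<notin> signed_points N"
    then show "v a x = 0" using orbit_signed_points[OF \<tau>, of x a] orbit_signed_points[OF \<tau>, of "- x" a] that
      by (auto simp: v_def signed_points_minus)
  next
    fix x show "v a (\<tau> x) = v a x"
      using apply_in_orbit_iff[OF \<tau>, of x a] apply_in_orbit_iff[OF \<tau>, of "- x" a]
      by (auto simp: v_def hyperoctahedral_minus[OF \<tau>])
  qed (auto simp: v_def)
  have self: "a \<in> orbit \<tau> a" for a by (rule orbit_self[OF \<tau>])
  show ?thesis
  proof (cases "- i \<in> orbit \<tau> i")
    case False
    then have "v i i = 1" "v i j \<le> 0" using ns self[of i] by (auto simp: v_def inseparable_def)
    then show ?thesis using v[OF i] by (intro exI[of _ "v i"]) auto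
  next
    case True
    then have "v j j = 1" "v j i \<le> 0" using ns self[of j] orbit_sym[OF \<tau>, of i j] by (auto simp: v_def inseparable_def)
    then show ?thesis using v[OF assms(3)] by (intro exI[of _ "v j"]) auto
  qed
qed

definition unitv :: "int \<Rightarrow> int \<Rightarrow> 'a::comm_ring_1" where
  "unitv a x = of_bool (x = a) - of_bool (x = - a)"

lemma unitv_minus_left: "unitv (- a) x = - unitv a x"
  and unitv_minus_right: "unitv a (- x) = - unitv a x"
  by (auto simp: unitv_def)

lemma unitv_fixv: "a \<in> signed_points N \<Longrightarrow> unitv a \<in> fixv N id"
  by (rule fixvI) (auto simp: unitv_def signed_points_minus)

lemma sum_unitv:
  assumes w: "w \<in> fixv N \<tau>" and "a \<in> signed_points N"
  shows "(\<Sum>x\<in>signed_points N. w x * unitv a x) = 2 * w a"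
proof -
  have "(\<Sum>x\<in>signed_points N. w x * unitv a x) =
     (\<Sum>x\<in>signed_points N. if x = a then w x else 0) - (\<Sum>x\<in>signed_points N. if x = - a then w x else 0)"
    by (auto simp: unitv_def algebra_simps simp flip: sum_subtractf intro!: sum.cong)
  then show ?thesis using assms
    by (simp add: finite_signed_points signed_points_minus fixv_minus[OF w])
qed

lemma sum_apply_hyperoctahedral:
  assumes "\<tau> \<in> hyperoctahedral N"
  shows "(\<Sum>x\<in>signed_points N. f (\<tau> x)) = sum f (signed_points N)"
  by (rule sum.reindex_bij_betw) (simp add: permutes_imp_bij[OF hyperoctahedral_permutes[OF assms]])

text \<open>Walking along the orbit from \<open>i\<close> to \<open>j\<close> writes the difference of the unit vectors as a telescoping sum.\<close>

lemma telescope_orbit: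
  assumes \<tau>: "\<tau> \<in> hyperoctahedral N" and i: "i \<in> signed_points N" and j: "j \<in> orbit \<tau> i"
  shows "\<exists>w \<in> fixv N id. \<forall>x. w x - w (\<tau> x) = unitv i x - (unitv j x :: 'a::comm_ring_1)"
  using j
proof induct
  case base
  have "unitv i x = (unitv (\<tau> i) (\<tau> x) :: 'a)" for x
    by (simp add: unitv_def hyperoctahedral_eq_iff[OF \<tau>] flip: hyperoctahedral_minus[OF \<tau>])
  then show ?case
    by (intro bexI[of _ "\<lambda>x. - unitv (\<tau> i) x"] unitv_fixv)
       (use i in \<open>auto simp: hyperoctahedral_mem_iff[OF \<tau>] fixv_def unitv_def signed_points_minus\<close>)
next
  case (step y)
  then obtain w where w: "w \<in> fixv N id" "\<And>x. w x - w (\<tau> x) = unitv i x - (unitv y x :: 'a)" by blast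
  have y: "y \<in> signed_points N" using step orbit_signed_points[OF \<tau>] i by blast
  have u: "unitv y x = (unitv (\<tau> y) (\<tau> x) :: 'a)" for x
    by (simp add: unitv_def hyperoctahedral_eq_iff[OF \<tau>] flip: hyperoctahedral_minus[OF \<tau>])
  have "(\<lambda>x. w x + (- 1) * unitv (\<tau> y) x) \<in> fixv N id"
    using w(1) y by (intro fixv_combine unitv_fixv) (simp_all add: hyperoctahedral_mem_iff[OF \<tau>])
  then show ?case
    by (rule bexI[rotated]) (use w(2) u in \<open>auto simp: algebra_simps\<close>)
qed

text \<open>If the reflection \<open>t\<close> in the root \<open>r\<close> has the fixed space of \<open>\<tau>\<close> in its hyperplane, then \<open>r\<close>, being orthogonal
  to that space, has the form \<open>w - w \<circ> \<tau>\<close>. Since \<open>w\<close> and \<open>w \<circ> \<tau>\<close> have the same norm and differ by a multiple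
  of \<open>r\<close>, they are mirror images under \<open>t\<close>, and so \<open>w\<close> is fixed by \<open>\<tau> \<circ> t\<close> but not by \<open>t\<close>.
  The argument uses only sums of products and division by 2, and so it also works modulo 3.\<close>

lemma fixv_comp_signed_swap_witness:
  fixes h :: "'a::comm_ring_1"
  assumes \<tau>: "\<tau> \<in> hyperoctahedral N" and i: "i \<in> signed_points N" and j: "j \<in> signed_points N"
    and ij: "i \<noteq> j" and ins: "inseparable \<tau> i j" and h: "h + h = 1"
  shows "\<exists>w :: int \<Rightarrow> 'a. w \<in> fixv N (\<tau> \<circ> signed_swap i j) \<and> w i - w j = 1"
proof -
  have h2: "2 * h = 1" "h * 2 = 1" using h by (simp_all only: mult_2 mult_2_right)
  have half: "\<exists>w \<in> fixv N id. \<forall>x. w x - w (\<tau> x) = (unitv k x :: 'a)"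
    if k: "k \<in> signed_points N" "- k \<in> orbit \<tau> k" for k
  proof -
    obtain w where w: "w \<in> fixv N id" "\<And>x. w x - w (\<tau> x) = unitv k x - (unitv (- k) x :: 'a)"
      using telescope_orbit[OF \<tau> k] by blast
    have "(\<lambda>x. h * w x) \<in> fixv N id" using w(1) by (simp add: fixv_def)
    moreover have "h * w x - h * w (\<tau> x) = unitv k x" for x
    proof -
      have "h * w x - h * w (\<tau> x) = h * (w x - w (\<tau> x))" by (simp only: right_diff_distrib)
      also have "\<dots> = (h + h) * unitv k x"
        unfolding w(2) unitv_minus_left by (simp only: distrib_left distrib_right diff_minus_eq_add)
      finally show ?thesis unfolding h by simp
    qed
    ultimately show ?thesis by (intro bexI[of _ "\<lambda>x. h * w x"]) auto
  qed
  define r :: "int \<Rightarrow> 'a" where "r = (\<lambda>x. unitv i x - unitv j x)"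
  have ex: "\<exists>w \<in> fixv N id. \<forall>x. w x - w (\<tau> x) = r x"
  proof (cases "j \<in> orbit \<tau> i")
    case True
    then show ?thesis unfolding r_def by (rule telescope_orbit[OF \<tau> i])
  next
    case False
    then have "- i \<in> orbit \<tau> i" "- j \<in> orbit \<tau> j" using ins by (auto simp: inseparable_def)
    with half i j obtain u v where uv: "u \<in> fixv N id" "\<And>x. u x - u (\<tau> x) = (unitv i x :: 'a)"
        "v \<in> fixv N id" "\<And>x. v x - v (\<tau> x) = (unitv j x :: 'a)" by meson
    have "u x + (- 1) * v x - (u (\<tau> x) + (- 1) * v (\<tau> x)) = r x" for x
    proof -
      have "u x + (- 1) * v x - (u (\<tau> x) + (- 1) * v (\<tau> x)) = (u x - u (\<tau> x)) - (v x - v (\<tau> x))"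
        by (simp add: algebra_simps)
      then show ?thesis by (simp only: uv r_def)
    qed
    then show ?thesis using fixv_combine[OF uv(1,3), of "- 1"] by (intro bexI[of _ "\<lambda>x. u x + (- 1) * v x"] allI)
  qed
  \<comment> \<open>For \<open>j = - i\<close> the vector \<open>r\<close> is twice the unit vector at \<open>i\<close>, and half of it is the root of the reflection.\<close>
  define c where "c = (if j = - i then h else 1)"
  obtain w0 where w0: "w0 \<in> fixv N id" "\<And>x. w0 x - w0 (\<tau> x) = r x" using ex by blast
  define w where "w = (\<lambda>x. c * w0 x)"
  have w: "w \<in> fixv N id" using w0(1) by (simp add: fixv_def w_def)
  have wd: "w (\<tau> x) = w x - c * r x" for x
    unfolding w_def w0(2)[symmetric] by (simp add: algebra_simps)
  have r: "r \<in> fixv N id" unfolding r_def using fixv_combine[OF unitv_fixv[OF i] unitv_fixv[OF j], of "- 1"] by simp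
  have sr: "(\<Sum>x\<in>signed_points N. v x * r x) = 2 * (v i - v j)" if "v \<in> fixv N id" for v
    using sum_unitv[OF that i] sum_unitv[OF that j]
    by (simp add: r_def right_diff_distrib sum_subtractf)
  have nz: "i \<noteq> 0" "j \<noteq> 0" using i j by (auto simp: signed_points_def)
  have cr: "c * r i = 1" "c * r j = - 1" "c * r (- i) = - 1" "c * r (- j) = 1"
    using ij nz h2 by (cases "j = - i"; simp add: r_def unitv_def c_def)+
  have cr0: "c * r x = 0" if "x \<notin> {i, j, - i, - j}" for x
    using that by (simp add: r_def unitv_def)
  have crij: "c * (r i - r j) = 2" by (simp add: right_diff_distrib cr)
  \<comment> \<open>Comparing the norms of \<open>w\<close> and \<open>w \<circ> \<tau>\<close> gives the inner product of \<open>w\<close> with the root.\<close>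
  have "(\<Sum>x\<in>signed_points N. w x * w x) = (\<Sum>x\<in>signed_points N. w (\<tau> x) * w (\<tau> x))"
    by (rule sum_apply_hyperoctahedral[OF \<tau>, symmetric])
  also have "\<dots> = (\<Sum>x\<in>signed_points N. w x * w x) - 2 * c * (\<Sum>x\<in>signed_points N. w x * r x)
      + c * c * (\<Sum>x\<in>signed_points N. r x * r x)"
    unfolding wd by (simp add: algebra_simps sum.distrib sum_subtractf sum_distrib_left)
  finally have "2 * c * (2 * (w i - w j)) = c * c * (2 * (r i - r j))"
    using sr[OF w] sr[OF r] by simp
  also have "\<dots> = 2 * c * (c * (r i - r j))" by (simp add: algebra_simps)
  finally have eq: "2 * c * (2 * (w i - w j)) = 2 * c * 2" unfolding crij .
  define d where "d = (if j = - i then 1 else h)"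
  have dc: "d * (2 * c) = 1" using h2 by (auto simp: c_def d_def)
  have "2 * (w i - w j) = d * (2 * c) * (2 * (w i - w j))" by (simp only: dc mult_1)
  also have "\<dots> = d * (2 * c * (2 * (w i - w j)))" by (simp only: mult.assoc)
  also have "\<dots> = d * (2 * c) * 2" unfolding eq by (simp only: mult.assoc)
  finally have "2 * (w i - w j) = 2" by (simp only: dc mult_1)
  then have "h * 2 * (w i - w j) = h * 2" by (simp only: mult.assoc)
  then have wij: "w i - w j = 1" by (simp only: h2 mult_1)
  have wm: "w (- y) = - w y" for y by (rule fixv_minus[OF w])
  have wi: "w i = w j + 1" using wij by (simp add: algebra_simps)
  have wr: "w (signed_swap i j x) = w x - c * r x" for x
  proof -
    consider "x = i" | "x = j" | "x = - i" | "x = - j" | "x \<notin> {i, j, - i, - j}" by blast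
    then show ?thesis
    proof cases
      case 3
      then have "signed_swap i j x = - j" using ij nz by (auto simp: signed_swap_def)
      then show ?thesis using 3 by (simp add: cr wi wm)
    next
      case 4
      then have "signed_swap i j x = - i" using ij nz by (auto simp: signed_swap_def)
      then show ?thesis using 4 by (simp add: cr wi wm)
    qed (simp_all add: cr wi, simp add: signed_swap_def cr0)
  qed
  have "w (\<tau> (signed_swap i j x)) = w x" for x
    using wr[of "signed_swap i j x"] wd[of "signed_swap i j x"] signed_swap_invol[OF nz] by simp
  then have "w \<in> fixv N (\<tau> \<circ> signed_swap i j)" using w by (simp add: fixv_def)
  then show ?thesis using wij by blast
qed

text \<open>If \<open>u\<close> is fixed by \<open>\<tau>\<close> and \<open>w\<close> by \<open>\<tau> \<circ> t\<close>, then \<open>\<langle>u, w\<rangle> = \<langle>u, w \<circ> \<tau>\<rangle> = \<langle>u, w \<circ> t\<rangle>\<close>, and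
  \<open>w - w \<circ> t\<close> is a multiple of the root of \<open>t\<close>. So \<open>u\<close> or \<open>w\<close> lies in the hyperplane of \<open>t\<close>.\<close>

lemma fixv_comp_signed_swap_subset:
  fixes u w :: "int \<Rightarrow> real"
  assumes \<tau>: "\<tau> \<in> hyperoctahedral N" and i: "i \<in> signed_points N" and j: "j \<in> signed_points N"
    and u: "u \<in> fixv N \<tau>" "u i \<noteq> u j" and w: "w \<in> fixv N (\<tau> \<circ> signed_swap i j)"
  shows "w i = w j"
proof -
  let ?S = "signed_points N"
  have nz: "i \<noteq> 0" "j \<noteq> 0" using i j by (auto simp: signed_points_def)
  define d where "d = w i - w j"
  define r :: "int \<Rightarrow> real" where "r = (\<lambda>x. unitv i x - unitv j x)"
  define c where "c = (if j = - i then 1 / 2 else 1 :: real)"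
  have wm: "w (- y) = - w y" for y by (rule fixv_minus[OF w])
  have wr: "w (signed_swap i j x) = w x - c * d * r x" for x
    using nz by (auto simp: signed_swap_def r_def unitv_def c_def d_def wm algebra_simps)
  have "w (\<tau> x) = w (signed_swap i j x)" for x
    using fixv_apply[OF w, of "signed_swap i j x"] by (simp add: signed_swap_invol[OF nz])
  then have "(\<Sum>x\<in>?S. u x * w x) = (\<Sum>x\<in>?S. u x * w (signed_swap i j x))"
    using sum_apply_hyperoctahedral[OF \<tau>, of "\<lambda>x. u x * w x"] fixv_apply[OF u(1)] by simp
  also have "\<dots> = (\<Sum>x\<in>?S. u x * w x) - c * d * (\<Sum>x\<in>?S. u x * r x)"
    unfolding wr by (simp add: algebra_simps sum_subtractf sum_distrib_left)
  finally have "c * d * (\<Sum>x\<in>?S. u x * r x) = 0" by simp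
  moreover have "(\<Sum>x\<in>?S. u x * r x) = 2 * (u i - u j)"
    using sum_unitv[OF u(1) i] sum_unitv[OF u(1) j]
    by (simp add: r_def right_diff_distrib sum_subtractf)
  ultimately show ?thesis using u(2) by (auto simp: c_def d_def split: if_splits)
qed

text \<open>Multiplication by a reflection always changes the dimension of the fixed space by one, up or down.\<close>

lemma inseparable_comp_signed_swap:
  assumes \<tau>: "\<tau> \<in> hyperoctahedral N" and i: "i \<in> signed_points N" and j: "j \<in> signed_points N" and "i \<noteq> j"
  shows "inseparable (\<tau> \<circ> signed_swap i j) i j \<longleftrightarrow> \<not> inseparable \<tau> i j"
proof
  have t: "\<tau> \<circ> signed_swap i j \<in> hyperoctahedral N" by (intro comp_hyperoctahedral signed_swap_hyperoctahedral assms)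
  show "\<not> inseparable \<tau> i j" if "inseparable (\<tau> \<circ> signed_swap i j) i j"
  proof
    assume "inseparable \<tau> i j"
    then obtain w :: "int \<Rightarrow> real" where "w \<in> fixv N (\<tau> \<circ> signed_swap i j)" "w i - w j = 1"
      using fixv_comp_signed_swap_witness[OF assms, of "1 / 2 :: real"] by auto
    then show False using fixv_inseparable[OF _ that, of w N "1 / 2 :: real"] by auto
  qed
  show "inseparable (\<tau> \<circ> signed_swap i j) i j" if ns: "\<not> inseparable \<tau> i j"
  proof (rule ccontr)
    assume "\<not> inseparable (\<tau> \<circ> signed_swap i j) i j"
    then obtain w :: "int \<Rightarrow> real" where "w \<in> fixv N (\<tau> \<circ> signed_swap i j)" "w i \<noteq> w j"
      using separating_fixv[OF t i j] by blast
    moreover obtain u :: "int \<Rightarrow> real" where "u \<in> fixv N \<tau>" "u i \<noteq> u j"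
      using separating_fixv[OF \<tau> i j ns] by blast
    ultimately show False using fixv_comp_signed_swap_subset[OF \<tau> i j, of u w] by blast
  qed
qed

section \<open>Reflection length as a codimension\<close>

lemma finite_fixv3: "finite (fixv N \<tau> :: (int \<Rightarrow> 3) set)"
proof (rule finite_subset)
  show "fixv N \<tau> \<subseteq> {f. \<forall>x. (x \<in> signed_points N \<longrightarrow> f x \<in> (UNIV :: 3 set)) \<and> (x \<notin> signed_points N \<longrightarrow> f x = 0)}"
    by (auto simp: fixv_def)
  show "finite \<dots>" by (intro finite_set_of_finite_funs finite_signed_points) simp
qed

lemma half_3: "2 + 2 = (1 :: 3)"
  by simp

text \<open>Three to the power of the dimension of the fixed space. Counting vectors over a finite ring
  stands in for a theory of dimension.\<close>

definition num_fixv :: "nat \<Rightarrow> (int \<Rightarrow> int) \<Rightarrow> nat" where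
  "num_fixv N \<tau> = card (fixv N \<tau> :: (int \<Rightarrow> 3) set)"

lemma num_fixv_pos: "num_fixv N \<tau> > 0"
proof -
  have "(\<lambda>x. 0) \<in> (fixv N \<tau> :: (int \<Rightarrow> 3) set)" by (simp add: fixv_def)
  then show ?thesis unfolding num_fixv_def using finite_fixv3 by (auto simp: card_gt_0_iff)
qed

lemma num_fixv_le_id: "num_fixv N \<tau> \<le> num_fixv N id"
  unfolding num_fixv_def by (intro card_mono finite_fixv3) (auto simp: fixv_def)

text \<open>The fixed vectors of \<open>\<tau>\<close> are those of \<open>\<tau> \<circ> t\<close> in the hyperplane of \<open>t\<close>, and the witness \<open>w\<close> spans
  a complement.\<close>

lemma num_fixv_comp_signed_swap:
  assumes \<tau>: "\<tau> \<in> hyperoctahedral N" and i: "i \<in> signed_points N" and j: "j \<in> signed_points N"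
    and ij: "i \<noteq> j" and ins: "inseparable \<tau> i j"
  shows "num_fixv N (\<tau> \<circ> signed_swap i j) = 3 * num_fixv N \<tau>"
proof -
  let ?K = "fixv N \<tau> :: (int \<Rightarrow> 3) set" and ?L = "fixv N (\<tau> \<circ> signed_swap i j) :: (int \<Rightarrow> 3) set"
  obtain w :: "int \<Rightarrow> 3" where w: "w \<in> ?L" "w i - w j = 1"
    using fixv_comp_signed_swap_witness[OF \<tau> i j ij ins half_3] by blast
  have K: "v \<in> ?K \<longleftrightarrow> v \<in> ?L \<and> v i = v j" for v
    using fixv_comp_signed_swap[of v N \<tau> i j] fixv_comp_signed_swap[of v N "\<tau> \<circ> signed_swap i j" i j]
      fixv_inseparable[OF _ ins half_3, of v N]
    by (auto simp: signed_swap_comp_comp[OF i j])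
  \<comment> \<open>Since \<open>w i - w j = 1\<close>, the coefficient of \<open>w\<close> in \<open>v\<close> is \<open>v i - v j\<close>.\<close>
  have "bij_betw (\<lambda>(c, v). \<lambda>x. v x + c * w x) (UNIV \<times> ?K) ?L"
  proof (rule bij_betw_byWitness[where f' = "\<lambda>v. (v i - v j, \<lambda>x. v x + (- (v i - v j)) * w x)"])
    have wi: "w i = w j + 1" using w(2) by (simp add: algebra_simps)
    show "\<forall>a\<in>UNIV \<times> ?K. (\<lambda>v. (v i - v j, \<lambda>x. v x + - (v i - v j) * w x)) ((\<lambda>(c, v) x. v x + c * w x) a) = a"
      by (auto simp: K wi algebra_simps)
    show "\<forall>a'\<in>?L. (\<lambda>(c, v) x. v x + c * w x) (a' i - a' j, \<lambda>x. a' x + - (a' i - a' j) * w x) = a'"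
      by (auto simp: algebra_simps)
    show "(\<lambda>(c, v) x. v x + c * w x) ` (UNIV \<times> ?K) \<subseteq> ?L"
      using fixv_combine[OF _ w(1)] by (auto simp: K)
    have "(\<lambda>x. v x + - (v i - v j) * w x) \<in> ?K" if "v \<in> ?L" for v
      unfolding K using fixv_combine[OF that w(1), of "- (v i - v j)"] by (auto simp: wi algebra_simps)
    then show "(\<lambda>v. (v i - v j, \<lambda>x. v x + - (v i - v j) * w x)) ` ?L \<subseteq> UNIV \<times> ?K" by auto
  qed
  from bij_betw_same_card[OF this] show ?thesis by (simp add: num_fixv_def card_cartesian_product)
qed

lemma num_fixv_comp_signed_swap':
  assumes \<tau>: "\<tau> \<in> hyperoctahedral N" and i: "i \<in> signed_points N" and j: "j \<in> signed_points N"
    and "i \<noteq> j" and "\<not> inseparable \<tau> i j"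
  shows "num_fixv N \<tau> = 3 * num_fixv N (\<tau> \<circ> signed_swap i j)"
  using num_fixv_comp_signed_swap[of "\<tau> \<circ> signed_swap i j" N i j] inseparable_comp_signed_swap[of \<tau> N i j] assms
  by (simp add: signed_swap_comp_comp[OF i j] comp_hyperoctahedral signed_swap_hyperoctahedral)

definition word :: "(int \<Rightarrow> int) list \<Rightarrow> int \<Rightarrow> int" where
  "word gs = foldr (\<circ>) gs id"

lemma word_simps [simp]: "word [] = id" "word (g # gs) = g \<circ> word gs"
  by (simp_all add: word_def)

lemma word_append: "word (gs @ hs) = word gs \<circ> word hs"
  by (induction gs) (simp_all add: comp_assoc)

lemma word_hyperoctahedral: "set gs \<subseteq> B_generators N \<Longrightarrow> word gs \<in> hyperoctahedral N"
  using B_generators_hyperoctahedral[of N]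
  by (induction gs) (auto simp: id_hyperoctahedral intro!: comp_hyperoctahedral)

lemma num_fixv_word_bound:
  assumes "set gs \<subseteq> B_generators N" "\<tau> \<in> hyperoctahedral N"
  shows "num_fixv N \<tau> \<le> num_fixv N (\<tau> \<circ> word gs) * 3 ^ length gs"
  using assms
proof (induction gs arbitrary: \<tau>)
  case (Cons g gs)
  then obtain i j where g: "g = signed_swap i j" "i \<in> signed_points N" "j \<in> signed_points N" "i \<noteq> j"
    by (auto simp: B_generators_eq)
  have "num_fixv N \<tau> \<le> 3 * num_fixv N (\<tau> \<circ> g)"
    using num_fixv_comp_signed_swap[OF Cons.prems(2) g(2-4)] num_fixv_comp_signed_swap'[OF Cons.prems(2) g(2-4)] g(1)
    by (cases "inseparable \<tau> i j") auto
  also have "num_fixv N (\<tau> \<circ> g) \<le> num_fixv N ((\<tau> \<circ> g) \<circ> word gs) * 3 ^ length gs"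
    using Cons g by (intro Cons.IH comp_hyperoctahedral) (auto simp: signed_swap_hyperoctahedral)
  finally show ?case by (simp add: comp_def mult_ac)
qed simp

text \<open>As long as \<open>\<tau>\<close> moves a point \<open>i\<close>, the reflection that exchanges \<open>i\<close> and \<open>\<tau> i\<close> increases the fixed space.\<close>

lemma exists_word:
  assumes "\<tau> \<in> hyperoctahedral N"
  shows "\<exists>gs. set gs \<subseteq> B_generators N \<and> word gs = \<tau> \<and> num_fixv N \<tau> * 3 ^ length gs = num_fixv N id"
  using assms
proof (induction "num_fixv N id - num_fixv N \<tau>" arbitrary: \<tau> rule: less_induct)
  case less
  show ?case
  proof (cases "\<tau> = id")
    case True
    then show ?thesis by (intro exI[of _ "[]"]) auto
  next
    case False
    then obtain i where i: "\<tau> i \<noteq> i" by (auto simp: fun_eq_iff)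
    have iS: "i \<in> signed_points N"
      using i permutes_not_in[OF hyperoctahedral_permutes[OF less.prems]] by blast
    then have jS: "\<tau> i \<in> signed_points N" by (simp add: hyperoctahedral_mem_iff[OF less.prems])
    let ?g = "signed_swap i (\<tau> i)" let ?\<sigma> = "\<tau> \<circ> ?g"
    have \<sigma>: "?\<sigma> \<in> hyperoctahedral N" by (intro comp_hyperoctahedral signed_swap_hyperoctahedral less.prems iS jS)
    have "inseparable \<tau> i (\<tau> i)" by (simp add: inseparable_def orbit.base)
    then have n: "num_fixv N ?\<sigma> = 3 * num_fixv N \<tau>"
      using i by (intro num_fixv_comp_signed_swap less.prems iS jS) auto
    then have "num_fixv N id - num_fixv N ?\<sigma> < num_fixv N id - num_fixv N \<tau>"
      using num_fixv_le_id[of N ?\<sigma>] num_fixv_pos[of N \<tau>] by linarith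
    from less.hyps[OF this \<sigma>] obtain gs where gs: "set gs \<subseteq> B_generators N" "word gs = ?\<sigma>"
      "num_fixv N ?\<sigma> * 3 ^ length gs = num_fixv N id" by blast
    have "?g \<in> B_generators N" unfolding B_generators_eq using i[symmetric] iS jS by blast
    then show ?thesis
      using gs n by (intro exI[of _ "gs @ [?g]"]) (auto simp: word_append signed_swap_comp_comp[OF iS jS] mult_ac)
  qed
qed

lemma B_length_word:
  assumes "\<tau> \<in> hyperoctahedral N"
  shows "\<exists>gs. length gs = B_length N \<tau> \<and> set gs \<subseteq> B_generators N \<and> word gs = \<tau>"
  unfolding B_length_def word_def[symmetric] by (rule LeastI_ex) (use exists_word[OF assms] in blast)

lemma B_length_le:
  assumes "set gs \<subseteq> B_generators N" shows "B_length N (word gs) \<le> length gs"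
  unfolding B_length_def word_def[symmetric] by (rule Least_le) (use assms in blast)

text \<open>Reflection length is the codimension of the fixed space: no product of \<open>k\<close> reflections loses more
  than \<open>k\<close> dimensions, and the word of \<open>exists_word\<close> is as short as this allows.\<close>

lemma num_fixv_B_length:
  assumes "\<tau> \<in> hyperoctahedral N"
  shows "num_fixv N \<tau> * 3 ^ B_length N \<tau> = num_fixv N id"
proof -
  obtain gs where gs: "set gs \<subseteq> B_generators N" "word gs = \<tau>" "num_fixv N \<tau> * 3 ^ length gs = num_fixv N id"
    using exists_word[OF assms] by blast
  obtain hs where hs: "length hs = B_length N \<tau>" "set hs \<subseteq> B_generators N" "word hs = \<tau>"
    using B_length_word[OF assms] by blast
  have "num_fixv N \<tau> * 3 ^ B_length N \<tau> \<le> num_fixv N \<tau> * 3 ^ length gs"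
    using B_length_le[OF gs(1)] gs(2) by simp
  moreover have "num_fixv N id \<le> num_fixv N \<tau> * 3 ^ B_length N \<tau>"
    using num_fixv_word_bound[OF hs(2) id_hyperoctahedral] hs by simp
  ultimately show ?thesis using gs(3) by linarith
qed

lemma B_length_comp_signed_swap:
  assumes \<tau>: "\<tau> \<in> hyperoctahedral N" and i: "i \<in> signed_points N" and j: "j \<in> signed_points N" and "i \<noteq> j"
  shows "inseparable \<tau> i j \<Longrightarrow> B_length N \<tau> = Suc (B_length N (\<tau> \<circ> signed_swap i j))"
    and "\<not> inseparable \<tau> i j \<Longrightarrow> B_length N (\<tau> \<circ> signed_swap i j) = Suc (B_length N \<tau>)"
proof -
  let ?\<sigma> = "\<tau> \<circ> signed_swap i j"
  have \<sigma>: "?\<sigma> \<in> hyperoctahedral N" by (intro comp_hyperoctahedral signed_swap_hyperoctahedral \<tau> i j)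
  have eq: "num_fixv N \<tau> * 3 ^ B_length N \<tau> = num_fixv N ?\<sigma> * 3 ^ B_length N ?\<sigma>"
    using num_fixv_B_length[OF \<tau>] num_fixv_B_length[OF \<sigma>] by simp
  show "B_length N \<tau> = Suc (B_length N ?\<sigma>)" if "inseparable \<tau> i j"
  proof -
    have "(3::nat) ^ B_length N \<tau> = 3 ^ Suc (B_length N ?\<sigma>)"
      using eq num_fixv_pos[of N \<tau>] num_fixv_comp_signed_swap[OF assms that] by simp
    then show ?thesis by (subst (asm) power_inject_exp) auto
  qed
  show "B_length N ?\<sigma> = Suc (B_length N \<tau>)" if "\<not> inseparable \<tau> i j"
  proof -
    have "(3::nat) ^ B_length N ?\<sigma> = 3 ^ Suc (B_length N \<tau>)"
      using eq num_fixv_pos[of N ?\<sigma>] num_fixv_comp_signed_swap'[OF assms that] by simp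
    then show ?thesis by (subst (asm) power_inject_exp) auto
  qed
qed

lemma B_length_inv:
  assumes "\<tau> \<in> hyperoctahedral N" shows "B_length N (inv \<tau>) = B_length N \<tau>"
proof -
  have "num_fixv N \<tau> * 3 ^ B_length N (inv \<tau>) = num_fixv N \<tau> * 3 ^ B_length N \<tau>"
    using num_fixv_B_length[OF inv_hyperoctahedral[OF assms]] num_fixv_B_length[OF assms]
    by (simp add: num_fixv_def fixv_inv[OF assms])
  then show ?thesis using num_fixv_pos[of N \<tau>] by simp
qed

lemma inseparable_inv:
  "\<tau> \<in> hyperoctahedral N \<Longrightarrow> inseparable (inv \<tau>) i j \<longleftrightarrow> inseparable \<tau> i j"
  by (simp add: inseparable_def orbit_inv_eq hyperoctahedral_permutation)

lemma B_length_signed_swap_comp: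
  assumes \<tau>: "\<tau> \<in> hyperoctahedral N" and i: "i \<in> signed_points N" and j: "j \<in> signed_points N"
    and "i \<noteq> j" "inseparable \<tau> i j"
  shows "B_length N \<tau> = Suc (B_length N (signed_swap i j \<circ> \<tau>))"
proof -
  let ?s = "signed_swap i j"
  have s: "?s \<in> hyperoctahedral N" by (intro signed_swap_hyperoctahedral i j)
  have "inv (?s \<circ> \<tau>) = inv \<tau> \<circ> inv ?s"
    by (intro o_inv_distrib hyperoctahedral_bij[OF s] hyperoctahedral_bij[OF \<tau>])
  also have "inv ?s = ?s" by (rule inv_unique_comp) (use signed_swap_comp_self[OF i j] in auto)
  finally have "B_length N (?s \<circ> \<tau>) = B_length N (inv \<tau> \<circ> ?s)"
    using B_length_inv[OF comp_hyperoctahedral[OF s \<tau>]] by (simp only:)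
  then show ?thesis
    using B_length_comp_signed_swap(1)[OF inv_hyperoctahedral[OF \<tau>] i j \<open>i \<noteq> j\<close>] assms
    by (simp add: inseparable_inv[OF \<tau>] B_length_inv[OF \<tau>])
qed

lemma B_length_triangle:
  assumes "\<sigma> \<in> hyperoctahedral N" "\<tau> \<in> hyperoctahedral N"
  shows "B_length N (\<sigma> \<circ> \<tau>) \<le> B_length N \<sigma> + B_length N \<tau>"
proof -
  obtain gs hs where gs: "length gs = B_length N \<sigma>" "set gs \<subseteq> B_generators N" "word gs = \<sigma>"
    and hs: "length hs = B_length N \<tau>" "set hs \<subseteq> B_generators N" "word hs = \<tau>"
    using B_length_word[OF assms(1)] B_length_word[OF assms(2)] by blast
  show ?thesis using B_length_le[of "gs @ hs" N] gs hs by (simp add: word_append)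
qed

lemma B_length_id: "B_length N id = 0"
  using B_length_le[of "[]" N] by simp

lemma B_length_eq_0: "\<tau> \<in> hyperoctahedral N \<Longrightarrow> B_length N \<tau> = 0 \<longleftrightarrow> \<tau> = id"
  using B_length_word[of \<tau> N] by (auto simp: B_length_id)

text \<open>In a word of minimal length every letter increases the length, and so every letter takes one
  dimension away from the fixed space without adding new fixed vectors.\<close>

lemma fixv_subset_word:
  assumes "set gs \<subseteq> B_generators N" "\<tau> \<in> hyperoctahedral N"
    and "B_length N (\<tau> \<circ> word gs) = B_length N \<tau> + length gs"
  shows "fixv N (\<tau> \<circ> word gs) \<subseteq> (fixv N \<tau> :: (int \<Rightarrow> real) set)"
  using assms
proof (induction gs arbitrary: \<tau>)
  case (Cons g gs)
  then obtain i j where g: "g = signed_swap i j" "i \<in> signed_points N" "j \<in> signed_points N" "i \<noteq> j"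
    by (auto simp: B_generators_eq)
  let ?\<rho> = "\<tau> \<circ> g"
  have \<rho>: "?\<rho> \<in> hyperoctahedral N" using Cons.prems g by (auto intro: comp_hyperoctahedral signed_swap_hyperoctahedral)
  have gs: "set gs \<subseteq> B_generators N" using Cons.prems by simp
  have eq: "\<tau> \<circ> word (g # gs) = ?\<rho> \<circ> word gs" by (simp add: comp_assoc)
  have "B_length N (?\<rho> \<circ> word gs) \<le> B_length N ?\<rho> + length gs"
    using B_length_triangle[OF \<rho> word_hyperoctahedral[OF gs]] B_length_le[OF gs] by linarith
  then have len: "B_length N ?\<rho> > B_length N \<tau>" using Cons.prems(3) unfolding eq by simp
  note step = B_length_comp_signed_swap[OF Cons.prems(2) g(2-4)]
  from len have ns: "\<not> inseparable \<tau> i j" using step(1) g(1) by auto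
  then have "B_length N ?\<rho> = Suc (B_length N \<tau>)" using step(2) g(1) by simp
  then have "fixv N (?\<rho> \<circ> word gs) \<subseteq> (fixv N ?\<rho> :: (int \<Rightarrow> real) set)"
    using Cons.prems(3) unfolding eq by (intro Cons.IH gs \<rho>) (simp only: list.size add_Suc_right add_Suc add_0_right)
  also have "\<dots> \<subseteq> fixv N \<tau>"
  proof
    fix v :: "int \<Rightarrow> real" assume v: "v \<in> fixv N ?\<rho>"
    have "inseparable ?\<rho> i j" using inseparable_comp_signed_swap[OF Cons.prems(2) g(2-4)] ns g(1) by simp
    then have "v i = v j" by (rule fixv_inseparable[OF v, where h = "1 / 2"]) simp
    from fixv_comp_signed_swap[OF v this] show "v \<in> fixv N \<tau>"
      by (simp add: g(1) signed_swap_comp_comp[OF g(2,3)])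
  qed
  finally show ?case unfolding eq .
qed simp

lemma fixv_subset_additive:
  assumes "\<tau> \<in> hyperoctahedral N" "\<kappa> \<in> hyperoctahedral N"
    and "B_length N (\<tau> \<circ> \<kappa>) = B_length N \<tau> + B_length N \<kappa>"
  shows "fixv N (\<tau> \<circ> \<kappa>) \<subseteq> (fixv N \<tau> :: (int \<Rightarrow> real) set)"
  using fixv_subset_word[of _ N \<tau>] B_length_word[OF assms(2)] assms by metis

lemma B_le_fixv_subset:
  assumes "\<tau> \<in> hyperoctahedral N" "\<sigma> \<in> hyperoctahedral N" "B_le N \<tau> \<sigma>"
  shows "fixv N \<sigma> \<subseteq> (fixv N \<tau> :: (int \<Rightarrow> real) set)"
  using fixv_subset_additive[of \<tau> N "inv \<tau> \<circ> \<sigma>"] assms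
  by (simp add: B_le_def comp_hyperoctahedral inv_hyperoctahedral hyperoctahedral_inv_simps)

text \<open>This limits the values that an element below \<open>\<sigma>\<close> can take at a given point.\<close>

lemma B_le_inseparable:
  assumes "\<tau> \<in> hyperoctahedral N" "\<sigma> \<in> hyperoctahedral N" "B_le N \<tau> \<sigma>" "i \<in> signed_points N"
  shows "inseparable \<sigma> i (\<tau> i)"
proof (rule ccontr)
  assume "\<not> inseparable \<sigma> i (\<tau> i)"
  then obtain v :: "int \<Rightarrow> real" where v: "v \<in> fixv N \<sigma>" "v i \<noteq> v (\<tau> i)"
    using separating_fixv[OF assms(2,4), of "\<tau> i"] assms(4) hyperoctahedral_mem_iff[OF assms(1)] by blast
  then have "v \<in> fixv N \<tau>" using B_le_fixv_subset[OF assms(1-3)] by blast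
  then show False using v(2) by (simp add: fixv_apply)
qed

section \<open>Removing a point from an interval\<close>

definition lower :: "nat \<Rightarrow> (int \<Rightarrow> int) \<Rightarrow> (int \<Rightarrow> int) set" where
  "lower N \<sigma> = {\<tau> \<in> hyperoctahedral N. B_le N \<tau> \<sigma>}"

definition interval_gf :: "'a::comm_ring_1 \<Rightarrow> nat \<Rightarrow> (int \<Rightarrow> int) \<Rightarrow> 'a" where
  "interval_gf x N \<sigma> = (\<Sum>\<tau>\<in>lower N \<sigma>. x ^ B_length N \<tau>)"

text \<open>Two reflections are involved: the left one turns \<open>\<tau> \<le> \<sigma>\<close> with \<open>\<tau> p = j\<close> into an element that fixes \<open>p\<close>, the
  right one then removes \<open>p\<close> from its cycle. For \<open>j = p\<close> the left one is the identity, and for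
  \<open>\<sigma> p = j\<close> the right one is.\<close>

definition splice_out :: "(int \<Rightarrow> int) \<Rightarrow> int \<Rightarrow> int \<Rightarrow> int \<Rightarrow> int" where
  "splice_out \<sigma> p j = signed_swap p j \<circ> \<sigma> \<circ> signed_swap p (inv \<sigma> j)"

lemma finite_lower: "finite (lower N \<sigma>)"
  by (simp add: lower_def finite_hyperoctahedral)

lemma lower_fixes:
  assumes "\<sigma> \<in> hyperoctahedral N" "\<tau> \<in> lower N \<sigma>" "\<sigma> p = p" "p \<in> signed_points N"
  shows "\<tau> p = p"
proof -
  have \<tau>: "\<tau> \<in> hyperoctahedral N" "B_le N \<tau> \<sigma>" using assms by (auto simp: lower_def)
  have p: "unitv p (\<sigma> x) = (unitv p x :: real)" for x
    using hyperoctahedral_eq_iff[OF assms(1), of x p] hyperoctahedral_eq_iff[OF assms(1), of x "- p"]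
    by (simp add: unitv_def assms(3) hyperoctahedral_minus[OF assms(1)])
  have "unitv p \<in> (fixv N \<sigma> :: (int \<Rightarrow> real) set)"
    by (rule fixvI) (use fixv_outside[OF unitv_fixv[OF assms(4)]] in \<open>auto simp: p unitv_minus_right\<close>)
  then have "unitv p \<in> (fixv N \<tau> :: (int \<Rightarrow> real) set)"
    using B_le_fixv_subset[OF \<tau>(1) assms(1) \<tau>(2)] by blast
  from fixv_apply[OF this, of p] show ?thesis
    using assms(4) by (auto simp: unitv_def signed_points_def of_bool_def split: if_splits)
qed

text \<open>If \<open>\<tau> \<le> \<rho>\<close> fixes \<open>p\<close>, the reflection that exchanges \<open>p\<close> and its preimage can be split off from the complement
  \<open>inv \<tau> \<circ> \<rho>\<close>, which agrees with \<open>\<rho>\<close> at that preimage.\<close>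

lemma lower_fixing_point:
  assumes \<rho>: "\<rho> \<in> hyperoctahedral N" and p: "p \<in> signed_points N"
  shows "{\<tau> \<in> lower N \<rho>. \<tau> p = p} = lower N (\<rho> \<circ> signed_swap p (inv \<rho> p))"
proof (cases "inv \<rho> p = p")
  case True
  then have "\<rho> p = p" by (metis \<rho> hyperoctahedral_inv_simps(1))
  then show ?thesis using True lower_fixes[OF \<rho> _ _ p] by auto
next
  case False
  let ?r = "inv \<rho> p"
  let ?s = "signed_swap p ?r"
  let ?\<rho>' = "\<rho> \<circ> ?s"
  have r: "?r \<in> signed_points N"
    using p by (simp add: hyperoctahedral_mem_iff[OF inv_hyperoctahedral[OF \<rho>]])
  have \<rho>r: "\<rho> ?r = p" by (simp add: hyperoctahedral_inv_simps[OF \<rho>])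
  have \<rho>': "?\<rho>' \<in> hyperoctahedral N" by (intro comp_hyperoctahedral signed_swap_hyperoctahedral \<rho> p r)
  have ins: "inseparable \<kappa> p ?r" if "\<kappa> \<in> hyperoctahedral N" "\<kappa> ?r = p" for \<kappa>
  proof -
    have "p \<in> orbit \<kappa> ?r" using orbit.base[of \<kappa> ?r] that(2) by simp
    then show ?thesis using orbit_sym[OF that(1)] by (simp add: inseparable_def)
  qed
  note step = B_length_comp_signed_swap[OF _ p r False[symmetric]]
  have len: "B_length N \<rho> = Suc (B_length N ?\<rho>')" by (rule step(1)[OF \<rho> ins[OF \<rho> \<rho>r]])
  show ?thesis
  proof (intro set_eqI iffI)
    fix \<tau> assume "\<tau> \<in> {\<tau> \<in> lower N \<rho>. \<tau> p = p}"
    then have \<tau>: "\<tau> \<in> hyperoctahedral N" "B_length N \<rho> = B_length N \<tau> + B_length N (inv \<tau> \<circ> \<rho>)" "\<tau> p = p"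
      by (auto simp: lower_def B_le_def)
    have \<kappa>: "inv \<tau> \<circ> \<rho> \<in> hyperoctahedral N" by (intro comp_hyperoctahedral inv_hyperoctahedral \<tau> \<rho>)
    have "inv \<tau> p = p" using \<tau>(3) hyperoctahedral_inv_simps(2)[OF \<tau>(1), of p] by simp
    then have "B_length N (inv \<tau> \<circ> \<rho>) = Suc (B_length N (inv \<tau> \<circ> \<rho> \<circ> ?s))"
      by (intro step(1) ins \<kappa>) (simp add: \<rho>r)
    then show "\<tau> \<in> lower N ?\<rho>'" using \<tau> len by (simp add: lower_def B_le_def comp_assoc)
  next
    fix \<tau> assume l: "\<tau> \<in> lower N ?\<rho>'"
    then have \<tau>: "\<tau> \<in> hyperoctahedral N" "B_length N ?\<rho>' = B_length N \<tau> + B_length N (inv \<tau> \<circ> ?\<rho>')"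
      by (auto simp: lower_def B_le_def)
    have \<kappa>: "inv \<tau> \<circ> ?\<rho>' \<in> hyperoctahedral N" "inv \<tau> \<circ> \<rho> \<in> hyperoctahedral N"
      by (intro comp_hyperoctahedral inv_hyperoctahedral \<tau> \<rho> \<rho>')+
    have "?\<rho>' p = p" by (simp add: \<rho>r)
    with lower_fixes[OF \<rho>' l _ p] have "\<tau> p = p" by blast
    moreover have "B_length N (inv \<tau> \<circ> ?\<rho>' \<circ> ?s) \<le> Suc (B_length N (inv \<tau> \<circ> ?\<rho>'))"
      using step[OF \<kappa>(1)] by (cases "inseparable (inv \<tau> \<circ> ?\<rho>') p ?r") auto
    moreover have "inv \<tau> \<circ> ?\<rho>' \<circ> ?s = inv \<tau> \<circ> \<rho>"
      using signed_swap_comp_comp(1)[OF p r, of "inv \<tau> \<circ> \<rho>"] by (simp only: comp_assoc)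
    moreover have "B_length N \<rho> \<le> B_length N \<tau> + B_length N (inv \<tau> \<circ> \<rho>)"
      using B_length_triangle[OF \<tau>(1) \<kappa>(2)] by (simp add: hyperoctahedral_inv_simps[OF \<tau>(1)])
    ultimately show "\<tau> \<in> {\<tau> \<in> lower N \<rho>. \<tau> p = p}"
      using \<tau> len by (simp add: lower_def B_le_def)
  qed
qed

lemma inv_signed_swap_comp:
  assumes "\<tau> \<in> hyperoctahedral N" "i \<in> signed_points N" "j \<in> signed_points N"
  shows "inv (signed_swap i j \<circ> \<tau>) = inv \<tau> \<circ> signed_swap i j"
proof -
  have "inv (signed_swap i j) = signed_swap i j"
    by (rule inv_unique_comp) (use signed_swap_comp_self[OF assms(2,3)] in auto)
  then show ?thesis
    using o_inv_distrib[OF hyperoctahedral_bij[OF signed_swap_hyperoctahedral[OF assms(2,3)]] hyperoctahedral_bij[OF assms(1)]]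
    by (simp only:)
qed

text \<open>The reflection that exchanges \<open>p\<close> and \<open>j\<close> shortens both \<open>\<sigma>\<close> and every \<open>\<tau>\<close> with \<open>\<tau> p = j\<close> by one, and it
  does not change \<open>inv \<tau> \<circ> \<sigma>\<close>.\<close>

lemma lower_moving_point:
  assumes \<sigma>: "\<sigma> \<in> hyperoctahedral N" and p: "p \<in> signed_points N" and j: "j \<in> signed_points N"
    and pj: "p \<noteq> j" and ins: "inseparable \<sigma> p j"
  defines "s \<equiv> signed_swap p j"
  shows "bij_betw (\<lambda>\<tau>. s \<circ> \<tau>) {\<tau> \<in> lower N (s \<circ> \<sigma>). \<tau> p = p} {\<tau> \<in> lower N \<sigma>. \<tau> p = j}"
    and "\<tau> \<in> {\<tau> \<in> lower N (s \<circ> \<sigma>). \<tau> p = p} \<Longrightarrow> B_length N (s \<circ> \<tau>) = Suc (B_length N \<tau>)"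
proof -
  have s: "s \<in> hyperoctahedral N" unfolding s_def by (intro signed_swap_hyperoctahedral p j)
  have ss: "s \<circ> (s \<circ> \<tau>) = \<tau>" for \<tau> :: "int \<Rightarrow> int" unfolding s_def by (rule signed_swap_comp_comp(2)[OF p j])
  have len: "B_length N \<tau> = Suc (B_length N (s \<circ> \<tau>))" if "\<tau> \<in> hyperoctahedral N" "\<tau> p = j" for \<tau>
    unfolding s_def
    by (rule B_length_signed_swap_comp[OF that(1) p j pj])
      (use orbit.base[of \<tau> p] that(2) in \<open>simp add: inseparable_def\<close>)
  have len\<sigma>: "B_length N \<sigma> = Suc (B_length N (s \<circ> \<sigma>))"
    unfolding s_def by (rule B_length_signed_swap_comp[OF \<sigma> p j pj ins])
  have iff: "s \<circ> \<tau> \<in> lower N (s \<circ> \<sigma>) \<longleftrightarrow> \<tau> \<in> lower N \<sigma>" if "\<tau> \<in> hyperoctahedral N" "\<tau> p = j" for \<tau>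
  proof -
    have "inv (s \<circ> \<tau>) \<circ> (s \<circ> \<sigma>) = inv \<tau> \<circ> (s \<circ> (s \<circ> \<sigma>))"
      unfolding s_def inv_signed_swap_comp[OF that(1) p j] by (simp only: comp_assoc)
    then show ?thesis using len[OF that] len\<sigma> that
      by (simp only: lower_def B_le_def ss mem_Collect_eq comp_hyperoctahedral[OF s that(1)]) simp
  qed
  have sp: "s p = j" "s j = p" by (simp_all add: s_def)
  have 1: "s \<circ> \<tau> \<in> {\<tau> \<in> lower N \<sigma>. \<tau> p = j}" if "\<tau> \<in> {\<tau> \<in> lower N (s \<circ> \<sigma>). \<tau> p = p}" for \<tau>
    using that iff[of "s \<circ> \<tau>"] comp_hyperoctahedral[OF s, of \<tau>] sp by (simp only: ss) (simp add: lower_def)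
  have 2: "s \<circ> \<tau> \<in> {\<tau> \<in> lower N (s \<circ> \<sigma>). \<tau> p = p}" if "\<tau> \<in> {\<tau> \<in> lower N \<sigma>. \<tau> p = j}" for \<tau>
    using that iff[of \<tau>] sp by (auto simp: lower_def)
  show "bij_betw (\<lambda>\<tau>. s \<circ> \<tau>) {\<tau> \<in> lower N (s \<circ> \<sigma>). \<tau> p = p} {\<tau> \<in> lower N \<sigma>. \<tau> p = j}"
    by (rule bij_betw_byWitness[where f' = "\<lambda>\<tau>. s \<circ> \<tau>"]) (use 1 2 ss in blast)+
  show "B_length N (s \<circ> \<tau>) = Suc (B_length N \<tau>)" if "\<tau> \<in> {\<tau> \<in> lower N (s \<circ> \<sigma>). \<tau> p = p}"
    using 1[OF that] len[of "s \<circ> \<tau>"] unfolding ss by (auto simp: lower_def)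
qed

lemma interval_gf_splice_out:
  assumes \<sigma>: "\<sigma> \<in> hyperoctahedral N" and p: "p \<in> signed_points N"
  shows "interval_gf x N \<sigma> =
    (\<Sum>j | j \<in> signed_points N \<and> inseparable \<sigma> p j. (if j = p then 1 else x) * interval_gf x N (splice_out \<sigma> p j))"
proof -
  let ?J = "{j. j \<in> signed_points N \<and> inseparable \<sigma> p j}"
  have fin: "finite ?J" by (simp add: finite_signed_points)
  have "\<tau> p \<in> ?J" if "\<tau> \<in> lower N \<sigma>" for \<tau>
    using that B_le_inseparable[OF _ \<sigma> _ p] p by (auto simp: lower_def hyperoctahedral_mem_iff)
  then have "(\<Sum>j\<in>?J. \<Sum>\<tau> | \<tau> \<in> lower N \<sigma> \<and> \<tau> p = j. x ^ B_length N \<tau>) = interval_gf x N \<sigma>"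
    unfolding interval_gf_def by (intro sum.group finite_lower fin) auto
  moreover have "(\<Sum>\<tau> | \<tau> \<in> lower N \<sigma> \<and> \<tau> p = j. x ^ B_length N \<tau>)
      = (if j = p then 1 else x) * interval_gf x N (splice_out \<sigma> p j)" if "j \<in> ?J" for j
  proof -
    let ?s = "signed_swap p j"
    have j: "j \<in> signed_points N" "inseparable \<sigma> p j" using that by auto
    have s\<sigma>: "?s \<circ> \<sigma> \<in> hyperoctahedral N" by (intro comp_hyperoctahedral signed_swap_hyperoctahedral \<sigma> p j)
    have "inv (?s \<circ> \<sigma>) p = inv \<sigma> j" by (subst inv_signed_swap_comp[OF \<sigma> p j(1)]) simp
    then have fixing: "{\<tau> \<in> lower N (?s \<circ> \<sigma>). \<tau> p = p} = lower N (splice_out \<sigma> p j)"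
      using lower_fixing_point[OF s\<sigma> p] by (simp add: splice_out_def)
    show ?thesis
    proof (cases "j = p")
      case True
      then show ?thesis using fixing by (simp add: interval_gf_def)
    next
      case False
      note mv = lower_moving_point[OF \<sigma> p j(1) False[symmetric] j(2), unfolded fixing]
      have "(\<Sum>\<tau> | \<tau> \<in> lower N \<sigma> \<and> \<tau> p = j. x ^ B_length N \<tau>)
          = (\<Sum>\<tau>\<in>lower N (splice_out \<sigma> p j). x ^ B_length N (?s \<circ> \<tau>))"
        by (rule sum.reindex_bij_betw[OF mv(1), symmetric])
      also have "\<dots> = (\<Sum>\<tau>\<in>lower N (splice_out \<sigma> p j). x * x ^ B_length N \<tau>)"
        by (intro sum.cong refl) (simp add: mv(2))
      finally show ?thesis using False by (simp add: interval_gf_def sum_distrib_left)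
    qed
  qed
  ultimately show ?thesis by (metis (no_types, lifting) sum.cong)
qed

lemma splice_out_hyperoctahedral:
  assumes \<sigma>: "\<sigma> \<in> hyperoctahedral N" and p: "p \<in> signed_points N" and j: "j \<in> signed_points N"
  shows "splice_out \<sigma> p j \<in> hyperoctahedral N"
  unfolding splice_out_def
  by (intro comp_hyperoctahedral signed_swap_hyperoctahedral assms)
    (use j in \<open>simp add: hyperoctahedral_mem_iff[OF inv_hyperoctahedral[OF \<sigma>]]\<close>)

lemma splice_out_self:
  assumes "\<sigma> \<in> hyperoctahedral N" shows "splice_out \<sigma> p j p = p"
  by (simp add: splice_out_def hyperoctahedral_inv_simps[OF assms])

text \<open>The value of \<open>splice_out \<sigma> p j\<close> at \<open>x\<close> depends on \<open>y = \<sigma> x\<close> only, so that lists which describe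
  cycles of \<open>\<sigma>\<close> can be processed elementwise.\<close>

definition reroute :: "(int \<Rightarrow> int) \<Rightarrow> int \<Rightarrow> int \<Rightarrow> int \<Rightarrow> int" where
  "reroute \<sigma> p j y = (if y = j then signed_swap p j (\<sigma> p)
     else if y = - j then - signed_swap p j (\<sigma> p) else signed_swap p j y)"

lemma splice_out_apply:
  assumes \<sigma>: "\<sigma> \<in> hyperoctahedral N" and p: "p \<in> signed_points N" and j: "j \<in> signed_points N"
    and x: "x \<noteq> p" "x \<noteq> - p"
  shows "splice_out \<sigma> p j x = reroute \<sigma> p j (\<sigma> x)"
proof -
  let ?r = "inv \<sigma> j"
  have r: "\<sigma> ?r = j" by (simp add: hyperoctahedral_inv_simps[OF \<sigma>])
  have s: "signed_swap p j (- y) = - signed_swap p j y" for y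
    by (rule hyperoctahedral_minus[OF signed_swap_hyperoctahedral[OF p j]])
  have nz: "j \<noteq> 0" "?r \<noteq> 0" using j hyperoctahedral_mem_iff[OF inv_hyperoctahedral[OF \<sigma>], of j]
    by (auto simp: signed_points_def)
  have iff: "\<sigma> x = j \<longleftrightarrow> x = ?r" "\<sigma> x = - j \<longleftrightarrow> x = - ?r"
    using hyperoctahedral_eq_iff[OF \<sigma>, of x ?r] hyperoctahedral_eq_iff[OF \<sigma>, of x "- ?r"]
    by (simp_all add: r hyperoctahedral_minus[OF \<sigma>])
  have "signed_swap p ?r x = (if x = ?r then p else if x = - ?r then - p else x)"
    using x nz by (auto simp: signed_swap_def)
  then show ?thesis using nz
    by (simp add: splice_out_def reroute_def iff s hyperoctahedral_minus[OF \<sigma>])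
qed

section \<open>Effect of the removal on cycles\<close>

definition negrotate1 :: "int list \<Rightarrow> int list" where
  "negrotate1 xs = (case xs of [] \<Rightarrow> [] | x # xs \<Rightarrow> xs @ [- x])"

lemma negrotate1_simps [simp]: "negrotate1 [] = []" "negrotate1 (x # xs) = xs @ [- x]"
  by (simp_all add: negrotate1_def)

text \<open>The lists in \<open>ps\<close> represent pairs of opposite cycles, \<open>xs\<close> together with its negative. The lists \<open>ys\<close> and
  \<open>zs\<close> each represent half of a cycle that is invariant under negation and continues with the negatives of the
  list; the empty list means that there is no such cycle. Every point not listed up to
  sign is fixed. Empty lists and singletons in \<open>ps\<close> are harmless and make the cases below uniform.\<close>

definition cycle_type :: "nat \<Rightarrow> (int \<Rightarrow> int) \<Rightarrow> int list list \<Rightarrow> int list \<Rightarrow> int list \<Rightarrow> bool" where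
  "cycle_type N \<sigma> ps ys zs \<longleftrightarrow>
     \<sigma> \<in> hyperoctahedral N \<and>
     distinct (map abs (concat ps @ ys @ zs)) \<and>
     set (concat ps @ ys @ zs) \<subseteq> signed_points N \<and>
     (\<forall>xs\<in>set ps. map \<sigma> xs = rotate1 xs) \<and>
     map \<sigma> ys = negrotate1 ys \<and> map \<sigma> zs = negrotate1 zs \<and>
     (\<forall>x. \<bar>x\<bar> \<notin> abs ` set (concat ps @ ys @ zs) \<longrightarrow> \<sigma> x = x)"

lemma signed_points_abs: "\<bar>x\<bar> \<in> signed_points N \<longleftrightarrow> x \<in> signed_points N"
  by (auto simp: signed_points_def)

lemma reroute_other:
  assumes "\<bar>y\<bar> \<noteq> \<bar>p\<bar>" "\<bar>y\<bar> \<noteq> \<bar>j\<bar>" shows "reroute \<sigma> p j y = y"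
proof -
  have "y \<noteq> p" "y \<noteq> - p" "y \<noteq> j" "y \<noteq> - j" using assms by auto
  then show ?thesis by (simp add: reroute_def signed_swap_def)
qed

lemma map_reroute_other:
  assumes "\<bar>p\<bar> \<notin> abs ` set L" "\<bar>j\<bar> \<notin> abs ` set L"
  shows "map (reroute \<sigma> p j) L = L"
proof (rule map_idI)
  fix y assume "y \<in> set L"
  then have "\<bar>y\<bar> \<in> abs ` set L" by (rule imageI)
  then show "reroute \<sigma> p j y = y" using assms by (intro reroute_other) (metis, metis)
qed

lemma map_splice_out:
  assumes "\<sigma> \<in> hyperoctahedral N" "p \<in> signed_points N" "j \<in> signed_points N" "\<bar>p\<bar> \<notin> abs ` set L"
  shows "map (splice_out \<sigma> p j) L = map (reroute \<sigma> p j) (map \<sigma> L)"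
proof -
  have "x \<noteq> p \<and> x \<noteq> - p" if "x \<in> set L" for x
    using imageI[OF that, of abs] assms(4) by auto
  then show ?thesis by (simp add: splice_out_apply[OF assms(1-3)])
qed

text \<open>The bookkeeping common to all ways in which \<open>p\<close> can be removed: only the behaviour on the new lists is left to check.\<close>

lemma cycle_type_splice_out:
  assumes T: "cycle_type N \<sigma> ps ys zs"
    and E: "mset (map abs (concat ps @ ys @ zs)) = add_mset \<bar>p\<bar> (mset (map abs (concat ps' @ ys' @ zs')))"
    and j: "\<bar>j\<bar> \<in> abs ` set (concat ps @ ys @ zs)"
    and maps: "\<forall>xs\<in>set ps'. map (splice_out \<sigma> p j) xs = rotate1 xs"
      "map (splice_out \<sigma> p j) ys' = negrotate1 ys'" "map (splice_out \<sigma> p j) zs' = negrotate1 zs'"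
  shows "cycle_type N (splice_out \<sigma> p j) ps' ys' zs'"
proof -
  let ?E = "concat ps @ ys @ zs" and ?E' = "concat ps' @ ys' @ zs'"
  have \<sigma>: "\<sigma> \<in> hyperoctahedral N" and dist: "distinct (map abs ?E)" and sub: "set ?E \<subseteq> signed_points N"
    and out: "\<And>x. \<bar>x\<bar> \<notin> abs ` set ?E \<Longrightarrow> \<sigma> x = x"
    using T unfolding cycle_type_def by blast+
  have perm: "mset (map abs ?E) = mset (\<bar>p\<bar> # map abs ?E')" using E by (simp only: mset.simps)
  have dist': "distinct (\<bar>p\<bar> # map abs ?E')" using dist mset_eq_imp_distinct_iff[OF perm] by (simp only:)
  have set': "set (map abs ?E) = set (\<bar>p\<bar> # map abs ?E')" by (rule mset_eq_setD[OF perm])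
  have absE: "abs ` set ?E = insert \<bar>p\<bar> (abs ` set ?E')" using set' by (simp only: set_map list.set)
  have in_S: "x \<in> signed_points N" if "\<bar>x\<bar> \<in> abs ` set ?E" for x
  proof -
    from that obtain y where "y \<in> set ?E" "\<bar>x\<bar> = \<bar>y\<bar>" by blast
    moreover from this have "\<bar>y\<bar> \<in> signed_points N" using sub signed_points_abs[of y N] by blast
    ultimately show ?thesis using signed_points_abs[of x N] by simp
  qed
  have p: "p \<in> signed_points N" by (rule in_S, unfold absE) (rule insertI1)
  have jS: "j \<in> signed_points N" by (rule in_S[OF j])
  have H: "splice_out \<sigma> p j \<in> hyperoctahedral N" by (rule splice_out_hyperoctahedral[OF \<sigma> p jS])
  have "splice_out \<sigma> p j x = x" if "\<bar>x\<bar> \<notin> abs ` set ?E'" for x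
  proof (cases "\<bar>x\<bar> = \<bar>p\<bar>")
    case True
    then have "x = p \<or> x = - p" by linarith
    then show ?thesis using splice_out_self[OF \<sigma>, of p j] hyperoctahedral_minus[OF H, of p] by auto
  next
    case False
    then have x: "\<bar>x\<bar> \<notin> abs ` set ?E" using that unfolding absE by blast
    have "x \<noteq> p" "x \<noteq> - p" using False by auto
    then have "splice_out \<sigma> p j x = reroute \<sigma> p j x"
      using splice_out_apply[OF \<sigma> p jS, of x] out[OF x] by simp
    also have "\<bar>x\<bar> \<noteq> \<bar>j\<bar>" using x j by metis
    then have "reroute \<sigma> p j x = x" by (rule reroute_other[OF False])
    finally show ?thesis .
  qed
  moreover have "set ?E' \<subseteq> signed_points N"
  proof
    fix x assume "x \<in> set ?E'"
    then have "\<bar>x\<bar> \<in> abs ` set ?E" unfolding absE by (intro insertI2 imageI)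
    then show "x \<in> signed_points N" by (rule in_S)
  qed
  moreover have "distinct (map abs ?E')" using dist' by (simp only: distinct.simps)
  ultimately show ?thesis using H maps unfolding cycle_type_def by blast
qed

lemma cycle_typeD:
  assumes "cycle_type N \<sigma> ps ys zs"
  shows "\<sigma> \<in> hyperoctahedral N" "distinct (map abs (concat ps @ ys @ zs))"
    "set (concat ps @ ys @ zs) \<subseteq> signed_points N" "\<forall>xs\<in>set ps. map \<sigma> xs = rotate1 xs"
    "map \<sigma> ys = negrotate1 ys" "map \<sigma> zs = negrotate1 zs"
  using assms unfolding cycle_type_def by blast+

text \<open>Rotations are written in this form because removing a point changes just the last image of a list, and because
  the empty list then needs no separate treatment.\<close>

lemma rotate1_conv_tl: "rotate1 L = tl (L @ [hd L])"
  by (cases L) auto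

lemma notin_image_tl: "x \<notin> f ` set L \<Longrightarrow> x \<notin> f ` set (tl L)"
  by (cases L) auto

lemma negrotate1_conv_tl: "negrotate1 L = tl (L @ [- hd L])"
  by (cases L) auto

lemma reroute_left [simp]: "reroute \<sigma> p j j = signed_swap p j (\<sigma> p)"
  by (simp add: reroute_def)

lemma reroute_minus_left [simp]: "j \<noteq> 0 \<Longrightarrow> reroute \<sigma> p j (- j) = - signed_swap p j (\<sigma> p)"
  by (simp add: reroute_def)

lemma signed_swap_minus_left: "\<bar>p\<bar> \<noteq> \<bar>j\<bar> \<Longrightarrow> p \<noteq> 0 \<Longrightarrow> signed_swap p j (- p) = - j"
  by (simp add: signed_swap_def)

lemma reroute_moved:
  assumes "\<bar>p\<bar> \<noteq> \<bar>j\<bar>" "p \<noteq> 0" shows "reroute \<sigma> p j p = j" "reroute \<sigma> p j (- p) = - j"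
proof -
  have "p \<noteq> j" "p \<noteq> - j" "- p \<noteq> j" using assms by auto
  then show "reroute \<sigma> p j p = j" "reroute \<sigma> p j (- p) = - j"
    using signed_swap_minus_left[OF assms] by (simp_all add: reroute_def)
qed

lemma signed_swap_other:
  assumes "\<bar>y\<bar> \<noteq> \<bar>p\<bar>" "\<bar>y\<bar> \<noteq> \<bar>j\<bar>" shows "signed_swap p j y = y"
proof -
  have "y \<noteq> p" "y \<noteq> - p" "y \<noteq> j" "y \<noteq> - j" using assms by auto
  then show ?thesis by (simp add: signed_swap_def)
qed

text \<open>A list that \<open>\<sigma>\<close> shifts by one and ends with \<open>e\<close> is still shifted by one; only its end is redirected.\<close>

lemma map_splice_out_path:
  assumes \<sigma>: "\<sigma> \<in> hyperoctahedral N" "p \<in> signed_points N" "j \<in> signed_points N"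
    and L: "map \<sigma> L = tl (L @ [e])" "\<bar>p\<bar> \<notin> abs ` set L" "\<bar>j\<bar> \<notin> abs ` set (tl L)"
  shows "map (splice_out \<sigma> p j) L = tl (L @ [reroute \<sigma> p j e])"
proof (cases L)
  case (Cons a L')
  have "map (reroute \<sigma> p j) L' = L'" using L(2,3) Cons by (intro map_reroute_other) auto
  then show ?thesis unfolding map_splice_out[OF \<sigma> L(2)] L(1) using Cons by simp
qed simp

lemma map_splice_out_untouched:
  assumes \<sigma>: "\<sigma> \<in> hyperoctahedral N" "p \<in> signed_points N" "j \<in> signed_points N"
  shows "\<forall>xs\<in>set ps. map \<sigma> xs = rotate1 xs \<Longrightarrow> \<bar>p\<bar> \<notin> abs ` set (concat ps) \<Longrightarrow>
      \<bar>j\<bar> \<notin> abs ` set (concat ps) \<Longrightarrow> \<forall>xs\<in>set ps. map (splice_out \<sigma> p j) xs = rotate1 xs"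
    and "map \<sigma> L = negrotate1 L \<Longrightarrow> \<bar>p\<bar> \<notin> abs ` set L \<Longrightarrow> \<bar>j\<bar> \<notin> abs ` set L \<Longrightarrow>
      map (splice_out \<sigma> p j) L = negrotate1 L"
proof -
  note M = map_splice_out[OF \<sigma>]
  show "\<forall>xs\<in>set ps. map (splice_out \<sigma> p j) xs = rotate1 xs"
    if "\<forall>xs\<in>set ps. map \<sigma> xs = rotate1 xs" "\<bar>p\<bar> \<notin> abs ` set (concat ps)" "\<bar>j\<bar> \<notin> abs ` set (concat ps)"
  proof
    fix xs assume xs: "xs \<in> set ps"
    then have n: "\<bar>p\<bar> \<notin> abs ` set xs" "\<bar>j\<bar> \<notin> abs ` set xs" using that(2,3) by auto
    have "map (splice_out \<sigma> p j) xs = map (reroute \<sigma> p j) (rotate1 xs)"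
      unfolding M[OF n(1)] using that(1) xs by simp
    also have "\<dots> = rotate1 xs" by (intro map_reroute_other) (simp_all only: set_rotate1 n not_False_eq_True)
    finally show "map (splice_out \<sigma> p j) xs = rotate1 xs" .
  qed
  show "map (splice_out \<sigma> p j) L = negrotate1 L" if "map \<sigma> L = negrotate1 L" "\<bar>p\<bar> \<notin> abs ` set L" "\<bar>j\<bar> \<notin> abs ` set L"
  proof -
    have "abs ` set (negrotate1 L) = abs ` set L" by (cases L) auto
    then show ?thesis unfolding M[OF that(2)] that(1)
      by (intro map_reroute_other) (simp_all only: that not_False_eq_True)
  qed
qed

lemma map_split_path:
  assumes "map f (A @ B) = tl (A @ B) @ [e]" "B \<noteq> []"
  shows "map f A = tl (A @ [hd B])" "map f B = tl B @ [e]"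
proof -
  obtain b B' where B: "B = b # B'" using assms(2) by (cases B) auto
  have "map f A @ map f B = tl (A @ [b]) @ (B' @ [e])"
    using assms(1) unfolding B by (cases A) auto
  then show "map f A = tl (A @ [hd B])" "map f B = tl B @ [e]"
    unfolding B by (subst (asm) append_eq_append_conv; simp)+
qed

text \<open>The predecessor of \<open>p\<close> is sent to \<open>j\<close> and the predecessor of \<open>j\<close> to the successor of \<open>p\<close>.\<close>

lemma cycle_type_pos_split:
  assumes T: "cycle_type N \<sigma> ((p # A @ j # B) # ps) ys zs"
  shows "cycle_type N (splice_out \<sigma> p j) (A # (j # B) # ps) ys zs"
proof -
  note c = cycle_typeD[OF T]
  have S: "p \<in> signed_points N" "j \<in> signed_points N" using c(3) by simp_all
  note path = map_splice_out_path[OF c(1) S] and untouched = map_splice_out_untouched[OF c(1) S]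
  have d: "\<bar>p\<bar> \<noteq> \<bar>j\<bar>" "\<bar>p\<bar> \<notin> abs ` set A" "\<bar>p\<bar> \<notin> abs ` set B" "\<bar>j\<bar> \<notin> abs ` set A" "\<bar>j\<bar> \<notin> abs ` set B"
    and u: "\<bar>p\<bar> \<notin> abs ` set (concat ps)" "\<bar>j\<bar> \<notin> abs ` set (concat ps)"
      "\<bar>p\<bar> \<notin> abs ` set ys" "\<bar>j\<bar> \<notin> abs ` set ys" "\<bar>p\<bar> \<notin> abs ` set zs" "\<bar>j\<bar> \<notin> abs ` set zs"
    using c(2) by (simp_all del: set_concat)
  have m: "map \<sigma> (A @ j # B) = tl (A @ j # B) @ [p]" "\<sigma> p = hd (A @ [j])"
    using c(4) by (cases A; simp)+
  note P = map_split_path[OF m(1), simplified]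
  have "reroute \<sigma> p j j = hd A" if "A \<noteq> []"
    using that d m(2) by (cases A) (auto simp: signed_swap_other)
  then have "map (splice_out \<sigma> p j) A = rotate1 A"
    using path[OF P(1) d(2) notin_image_tl[OF d(4)]] by (cases "A = []") (simp_all add: rotate1_conv_tl)
  moreover have "map (splice_out \<sigma> p j) (j # B) = rotate1 (j # B)"
    using path[of "j # B" p] P(2) d S reroute_moved[OF d(1)] by (simp add: signed_points_def)
  ultimately have "\<forall>xs\<in>set (A # (j # B) # ps). map (splice_out \<sigma> p j) xs = rotate1 xs"
    using untouched(1)[OF _ u(1,2)] c(4) by (simp del: list.map)
  then show ?thesis
    using c(5,6) u by (intro cycle_type_splice_out[OF T] untouched(2)) simp_all
qed

lemma cycle_type_pos_remove:
  assumes T: "cycle_type N \<sigma> ((p # A) # ps) ys zs"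
  shows "cycle_type N (splice_out \<sigma> p p) (A # ps) ys zs"
proof -
  note c = cycle_typeD[OF T]
  have S: "p \<in> signed_points N" using c(3) by simp
  note path = map_splice_out_path[OF c(1) S S] and untouched = map_splice_out_untouched[OF c(1) S S]
  have u: "\<bar>p\<bar> \<notin> abs ` set A" "\<bar>p\<bar> \<notin> abs ` set (concat ps)" "\<bar>p\<bar> \<notin> abs ` set ys" "\<bar>p\<bar> \<notin> abs ` set zs"
    using c(2) by (simp_all del: set_concat)
  have m: "map \<sigma> A = tl (A @ [p])" "\<sigma> p = hd (A @ [p])"
    using c(4) by (cases A; simp)+
  have "map (splice_out \<sigma> p p) A = rotate1 A"
    using path[OF m(1) u(1) notin_image_tl[OF u(1)]] m(2) by (cases "A = []") (simp_all add: rotate1_conv_tl)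
  then have "\<forall>xs\<in>set (A # ps). map (splice_out \<sigma> p p) xs = rotate1 xs"
    using untouched(1)[OF _ u(2,2)] c(4) by (simp del: list.map)
  then show ?thesis
    using c(5,6) u by (intro cycle_type_splice_out[OF T] untouched(2)) simp_all
qed

lemma cycle_type_neg_remove:
  assumes T: "cycle_type N \<sigma> ps (p # A) zs"
  shows "cycle_type N (splice_out \<sigma> p p) ps A zs"
    and "cycle_type N (splice_out \<sigma> p (- p)) (A # ps) [] zs"
proof -
  note c = cycle_typeD[OF T]
  have S: "p \<in> signed_points N" "- p \<in> signed_points N" "p \<noteq> 0"
    using c(3) by (simp_all add: signed_points_minus) (auto simp: signed_points_def)
  have u: "\<bar>p\<bar> \<notin> abs ` set A" "\<bar>p\<bar> \<notin> abs ` set (concat ps)" "\<bar>p\<bar> \<notin> abs ` set zs"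
    using c(2) by (simp_all del: set_concat)
  have m: "map \<sigma> A = tl (A @ [- p])" "\<sigma> p = hd (A @ [- p])"
    using c(5) by (cases A; simp)+
  have hd: "\<sigma> p = hd A" "signed_swap p (- p) (\<sigma> p) = hd A" if "A \<noteq> []"
    using that m(2) u(1) by (cases A; auto intro!: signed_swap_other)+
  show "cycle_type N (splice_out \<sigma> p p) ps A zs"
  proof -
    note path = map_splice_out_path[OF c(1) S(1,1)] and untouched = map_splice_out_untouched[OF c(1) S(1,1)]
    have 1: "map (splice_out \<sigma> p p) A = negrotate1 A"
      using path[OF m(1) u(1) notin_image_tl[OF u(1)]] hd S(3) by (cases "A = []") (simp_all add: negrotate1_conv_tl)
    show ?thesis
      by (rule cycle_type_splice_out[OF T _ _ untouched(1)[OF c(4) u(2,2)] 1 untouched(2)[OF c(6) u(3,3)]]) simp_all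
  qed
  show "cycle_type N (splice_out \<sigma> p (- p)) (A # ps) [] zs"
  proof -
    note path = map_splice_out_path[OF c(1) S(1,2), unfolded abs_minus_cancel]
      and untouched = map_splice_out_untouched[OF c(1) S(1,2), unfolded abs_minus_cancel]
    have "map (splice_out \<sigma> p (- p)) A = rotate1 A"
      using path[OF m(1) u(1) notin_image_tl[OF u(1)]] hd S(3) by (cases "A = []") (simp_all add: rotate1_conv_tl)
    then have "\<forall>xs\<in>set (A # ps). map (splice_out \<sigma> p (- p)) xs = rotate1 xs"
      using untouched(1)[OF _ u(2,2)] c(4) by (simp del: list.map)
    then show ?thesis
      using c(5,6) u by (intro cycle_type_splice_out[OF T] untouched(2)) simp_all
  qed
qed

text \<open>An invariant cycle splits into an invariant cycle and a pair of opposite ones. Which part of the list is which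
  depends on the sign of the target.\<close>

lemma cycle_type_neg_split:
  assumes T: "cycle_type N \<sigma> ps (p # A @ j # B) zs"
  shows "cycle_type N (splice_out \<sigma> p j) (A # ps) (j # B) zs"
    and "cycle_type N (splice_out \<sigma> p (- j)) ((j # B) # ps) A zs"
proof -
  note c = cycle_typeD[OF T]
  have S: "p \<in> signed_points N" "j \<in> signed_points N" "- j \<in> signed_points N" "p \<noteq> 0" "j \<noteq> 0"
    using c(3) by (simp_all add: signed_points_minus) (auto simp: signed_points_def)
  have d: "\<bar>p\<bar> \<noteq> \<bar>j\<bar>" "\<bar>p\<bar> \<notin> abs ` set A" "\<bar>p\<bar> \<notin> abs ` set B" "\<bar>j\<bar> \<notin> abs ` set A" "\<bar>j\<bar> \<notin> abs ` set B"
    and u: "\<bar>p\<bar> \<notin> abs ` set (concat ps)" "\<bar>j\<bar> \<notin> abs ` set (concat ps)"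
      "\<bar>p\<bar> \<notin> abs ` set zs" "\<bar>j\<bar> \<notin> abs ` set zs"
    using c(2) by (simp_all del: set_concat)
  have m: "map \<sigma> (A @ j # B) = tl (A @ j # B) @ [- p]" "\<sigma> p = hd (A @ [j])"
    using c(5) by (cases A; simp)+
  note P = map_split_path[OF m(1), simplified]
  have B: "map \<sigma> (j # B) = tl ((j # B) @ [- p])" "\<bar>p\<bar> \<notin> abs ` set (j # B)" "\<bar>j\<bar> \<notin> abs ` set (tl (j # B))"
    using P(2) d by simp_all
  have hd: "signed_swap p j (\<sigma> p) = hd A" "signed_swap p (- j) (\<sigma> p) = hd A" if "A \<noteq> []"
    using that d m(2) by (cases A; auto intro!: signed_swap_other)+
  show "cycle_type N (splice_out \<sigma> p j) (A # ps) (j # B) zs"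
  proof -
    note path = map_splice_out_path[OF c(1) S(1,2)] and untouched = map_splice_out_untouched[OF c(1) S(1,2)]
    have "map (splice_out \<sigma> p j) A = rotate1 A"
      using path[OF P(1) d(2) notin_image_tl[OF d(4)]] hd by (cases "A = []") (simp_all add: rotate1_conv_tl)
    then have 1: "\<forall>xs\<in>set (A # ps). map (splice_out \<sigma> p j) xs = rotate1 xs"
      using untouched(1)[OF _ u(1,2)] c(4) by (simp del: list.map)
    have 2: "map (splice_out \<sigma> p j) (j # B) = negrotate1 (j # B)"
      using path[OF B] by (simp add: reroute_moved[OF d(1) S(4)])
    show ?thesis
      by (rule cycle_type_splice_out[OF T _ _ 1 2 untouched(2)[OF c(6) u(3,4)]]) simp_all
  qed
  show "cycle_type N (splice_out \<sigma> p (- j)) ((j # B) # ps) A zs"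
  proof -
    note path = map_splice_out_path[OF c(1) S(1,3), unfolded abs_minus_cancel]
      and untouched = map_splice_out_untouched[OF c(1) S(1,3), unfolded abs_minus_cancel]
    have mj: "- j \<noteq> 0" "\<bar>p\<bar> \<noteq> \<bar>- j\<bar>" using S(5) d(1) by simp_all
    have 1: "map (splice_out \<sigma> p (- j)) A = negrotate1 A"
      using path[OF P(1) d(2) notin_image_tl[OF d(4)]] hd reroute_minus_left[OF mj(1), of \<sigma> p]
      by (cases "A = []") (simp_all add: negrotate1_conv_tl)
    have "map (splice_out \<sigma> p (- j)) (j # B) = rotate1 (j # B)"
      using path[OF B] by (simp add: reroute_moved[OF mj(2) S(4)])
    then have 2: "\<forall>xs\<in>set ((j # B) # ps). map (splice_out \<sigma> p (- j)) xs = rotate1 xs"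
      using untouched(1)[OF _ u(1,2)] c(4) by (simp del: list.map)
    show ?thesis
      by (rule cycle_type_splice_out[OF T _ _ 2 1 untouched(2)[OF c(6) u(3,4)]]) simp_all
  qed
qed

text \<open>The two invariant cycles are opened at \<open>p\<close> and at \<open>j\<close> and joined crosswise. Running once through the
  result passes half of each cycle, so it does not contain a point together with its negative.\<close>

lemma cycle_type_neg_join:
  assumes T: "cycle_type N \<sigma> ps (p # A) (C @ j # B)"
  shows "cycle_type N (splice_out \<sigma> p j) ((A @ map uminus (j # B) @ C) # ps) [] []"
proof -
  note c = cycle_typeD[OF T]
  have S: "p \<in> signed_points N" "j \<in> signed_points N" "p \<noteq> 0" "j \<noteq> 0"
    using c(3) by simp_all (auto simp: signed_points_def)
  note path = map_splice_out_path[OF c(1) S(1,2)] and untouched = map_splice_out_untouched[OF c(1) S(1,2)]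
  have d: "\<bar>p\<bar> \<noteq> \<bar>j\<bar>" "\<bar>p\<bar> \<notin> abs ` set A" "\<bar>p\<bar> \<notin> abs ` set B" "\<bar>p\<bar> \<notin> abs ` set C"
      "\<bar>j\<bar> \<notin> abs ` set A" "\<bar>j\<bar> \<notin> abs ` set B" "\<bar>j\<bar> \<notin> abs ` set C"
    and u: "\<bar>p\<bar> \<notin> abs ` set (concat ps)" "\<bar>j\<bar> \<notin> abs ` set (concat ps)"
    using c(2) by (simp_all del: set_concat)
  have img: "abs ` set (map uminus L) = abs ` set L" for L :: "int list" by (simp add: image_image)
  have mA: "map \<sigma> A = tl (A @ [- p])" "\<sigma> p = hd (A @ [- p])"
    using c(5) by (cases A; simp)+
  have "map \<sigma> (C @ j # B) = tl (C @ j # B) @ [- hd (C @ [j])]"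
    using c(6) by (cases C) auto
  note P = map_split_path[OF this, simplified]
  let ?e = "hd (C @ [j])" and ?B = "map uminus (j # B)" and ?r = "reroute \<sigma> p j"
  have "map \<sigma> ?B = map uminus (map \<sigma> (j # B))" using hyperoctahedral_minus[OF c(1)] by simp
  then have mB: "map \<sigma> ?B = tl (?B @ [?e])" using P(2) by simp
  have rj: "?r j = hd (A @ [- j])"
    using mA(2) d signed_swap_minus_left[OF d(1) S(3)] by (cases A) (auto intro!: signed_swap_other)
  have re: "?r ?e = hd (C @ A @ [- j])"
    using rj d by (cases C) (auto intro!: reroute_other)
  have "map (splice_out \<sigma> p j) A = tl (A @ [- j])"
    using path[OF mA(1) d(2) notin_image_tl[OF d(5)]] by (simp add: reroute_moved[OF d(1) S(3)])
  moreover have "map (splice_out \<sigma> p j) ?B = map uminus B @ [hd (C @ A @ [- j])]"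
    by (subst path[OF mB], unfold re, unfold list.map list.sel img) (use d in \<open>simp_all add: image_image\<close>)
  moreover have "map (splice_out \<sigma> p j) C = tl (C @ [hd (A @ [- j])])"
    using path[OF P(1) d(4) notin_image_tl[OF d(7)]] unfolding rj .
  ultimately have "map (splice_out \<sigma> p j) (A @ ?B @ C)
      = tl (A @ [- j]) @ (map uminus B @ [hd (C @ A @ [- j])]) @ tl (C @ [hd (A @ [- j])])"
    by (simp only: map_append)
  also have "\<dots> = rotate1 (A @ ?B @ C)" by (cases A; cases C) auto
  finally have "\<forall>xs\<in>set ((A @ ?B @ C) # ps). map (splice_out \<sigma> p j) xs = rotate1 xs"
    using untouched(1)[OF _ u] c(4) by (simp del: list.map map_append)
  then show ?thesis
    by (intro cycle_type_splice_out[OF T]) (simp_all add: multiset.map_comp comp_def del: list.map(2) map_append)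
qed

text \<open>Half of an invariant cycle can be replaced by the other half; this covers the targets \<open>- j\<close>
  on the second cycle.\<close>

lemma cycle_type_uminus:
  assumes T: "cycle_type N \<sigma> ps ys zs" shows "cycle_type N \<sigma> ps ys (map uminus zs)"
proof -
  have \<sigma>: "\<sigma> \<in> hyperoctahedral N" and z: "map \<sigma> zs = negrotate1 zs" using T by (auto simp: cycle_type_def)
  have "map \<sigma> (map uminus zs) = map uminus (map \<sigma> zs)" using hyperoctahedral_minus[OF \<sigma>] by simp
  also have "\<dots> = negrotate1 (map uminus zs)" unfolding z by (cases zs) auto
  finally show ?thesis using T unfolding cycle_type_def
    by (auto simp: comp_def image_Un image_image signed_points_minus)
qed

lemma cycle_type_swap: "cycle_type N \<sigma> ps ys zs \<Longrightarrow> cycle_type N \<sigma> ps zs ys"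
  by (auto simp: cycle_type_def image_Un Int_commute Un_commute)

lemma orbit_of_cycle:
  assumes "map f xs = rotate1 xs" "x \<in> set xs"
  shows "orbit f x = set xs"
proof
  have f: "f (xs ! i) = xs ! (Suc i mod length xs)" if "i < length xs" for i
    using arg_cong[OF assms(1), of "\<lambda>l. l ! i"] that nth_rotate1[OF that] by simp
  show "orbit f x \<subseteq> set xs"
  proof
    have closed: "f y \<in> set xs" if "y \<in> set xs" for y
      using that assms(1) by (metis image_eqI list.set_map set_rotate1)
    fix y assume "y \<in> orbit f x"
    then show "y \<in> set xs" by induct (use assms(2) closed in auto)
  qed
  obtain m where m: "m < length xs" "x = xs ! m" using assms(2) by (metis in_set_conv_nth)
  have pow: "(f ^^ k) x = xs ! ((m + k) mod length xs)" for k
  proof (induction k)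
    case (Suc k)
    have "length xs > 0" using m by auto
    then show ?case using Suc f[of "(m + k) mod length xs"] by (simp add: mod_Suc_eq)
  qed (use m in simp)
  show "set xs \<subseteq> orbit f x"
  proof
    fix y assume "y \<in> set xs"
    then obtain n where n: "n < length xs" "y = xs ! n" by (metis in_set_conv_nth)
    define k where "k = n + length xs - m"
    have "(m + k) mod length xs = n" using m n by (simp add: k_def)
    then have "y = (f ^^ k) x" using pow[of k] n by simp
    moreover have "k > 0" using m by (simp add: k_def)
    ultimately show "y \<in> orbit f x" by (auto simp: orbit_altdef)
  qed
qed

lemma orbit_of_negative_cycle:
  assumes \<sigma>: "\<sigma> \<in> hyperoctahedral N" and m: "map \<sigma> ys = negrotate1 ys" and x: "\<bar>x\<bar> \<in> abs ` set ys"
  shows "orbit \<sigma> x = set ys \<union> uminus ` set ys"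
proof -
  have "map \<sigma> (map uminus ys) = map uminus (map \<sigma> ys)" using hyperoctahedral_minus[OF \<sigma>] by simp
  then have "map \<sigma> (ys @ map uminus ys) = negrotate1 ys @ map uminus (negrotate1 ys)"
    by (simp only: map_append m)
  also have "\<dots> = rotate1 (ys @ map uminus ys)" by (cases ys) auto
  finally have "map \<sigma> (ys @ map uminus ys) = rotate1 (ys @ map uminus ys)" .
  moreover have "x \<in> set (ys @ map uminus ys)"
  proof -
    from x obtain y where "y \<in> set ys" "\<bar>x\<bar> = \<bar>y\<bar>" by blast
    then have "x = y \<or> x = - y" by (simp add: abs_eq_iff)
    then show ?thesis using \<open>y \<in> set ys\<close> by auto
  qed
  ultimately show ?thesis by (simp only: orbit_of_cycle set_append set_map)
qed

lemma inseparable_positive_cycle: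
  assumes T: "cycle_type N \<sigma> (xs # ps) ys zs" and p: "p \<in> set xs"
  shows "{j. j \<in> signed_points N \<and> inseparable \<sigma> p j} = set xs"
proof -
  note c = cycle_typeD[OF T]
  have orb: "orbit \<sigma> p = set xs" using c(4) p by (intro orbit_of_cycle) simp_all
  have "inj_on abs (set xs)" using c(2) by (simp add: distinct_map)
  then have "- p \<notin> set xs" if "p \<noteq> 0" using p that inj_onD[of abs "set xs" p "- p"] by auto
  moreover have "p \<noteq> 0" using c(3) p by (auto simp: signed_points_def)
  ultimately show ?thesis using c(3) by (auto simp: inseparable_def orb)
qed

lemma inseparable_negative_cycle:
  assumes T: "cycle_type N \<sigma> ps ys zs" and p: "p \<in> set ys"
  shows "{j. j \<in> signed_points N \<and> inseparable \<sigma> p j} = set (ys @ map uminus ys @ zs @ map uminus zs)" (is "?L = ?R")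
proof -
  note c = cycle_typeD[OF T]
  have orbp: "orbit \<sigma> p = set ys \<union> uminus ` set ys" using p by (intro orbit_of_negative_cycle[OF c(1,5)]) auto
  have split: "j \<in> set L \<union> uminus ` set L \<longleftrightarrow> \<bar>j\<bar> \<in> abs ` set L" for j :: int and L
    by (auto simp: image_iff abs_eq_iff)
  have R: "j \<in> ?R \<longleftrightarrow> \<bar>j\<bar> \<in> abs ` set ys \<or> \<bar>j\<bar> \<in> abs ` set zs" for j
    using split[of j ys] split[of j zs] by auto
  show ?thesis
  proof (intro set_eqI iffI)
    fix j assume "j \<in> ?R"
    then have j: "\<bar>j\<bar> \<in> abs ` set ys \<or> \<bar>j\<bar> \<in> abs ` set zs" by (simp only: R)
    then obtain y where y: "y \<in> set ys \<union> set zs" "\<bar>j\<bar> = \<bar>y\<bar>" by blast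
    then have "\<bar>y\<bar> \<in> signed_points N" using c(3) signed_points_abs by auto
    then have "j \<in> signed_points N" using y(2) signed_points_abs[of j N] by simp
    moreover have "- j \<in> orbit \<sigma> j"
      using j orbit_of_negative_cycle[OF c(1,5), of j] orbit_of_negative_cycle[OF c(1,6), of j]
        split[of "- j" ys] split[of "- j" zs] by auto
    moreover have "- p \<in> orbit \<sigma> p" using orbp p by auto
    ultimately show "j \<in> ?L" by (auto simp: inseparable_def)
  next
    fix j assume "j \<in> ?L"
    then have j: "j \<in> signed_points N" "inseparable \<sigma> p j" by auto
    show "j \<in> ?R"
    proof (rule ccontr)
      assume n: "j \<notin> ?R"
      then have "j \<notin> orbit \<sigma> p" using orbp by auto
      then have neg: "- j \<in> orbit \<sigma> j" using j(2) by (simp add: inseparable_def)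
      have nys: "\<bar>j\<bar> \<notin> abs ` set ys" "\<bar>j\<bar> \<notin> abs ` set zs" using n by (simp_all only: R) blast+
      have j0: "j \<noteq> 0" using j by (simp add: signed_points_def)
      show False
      proof (cases "\<bar>j\<bar> \<in> abs ` set (concat ps)")
        case True
        then obtain L y where L: "L \<in> set ps" "y \<in> set L" "\<bar>j\<bar> = \<bar>y\<bar>" by auto
        have orb: "orbit \<sigma> y = set L" using c(4) L by (intro orbit_of_cycle) simp_all
        have "- y \<in> orbit \<sigma> y"
          using neg L(3) orbit_uminus[OF c(1), of "- j" j] by (auto simp: abs_eq_iff)
        moreover have "distinct (map abs (concat ps))" using c(2) by simp
        then have "inj_on abs (set L)" using L(1) by (auto simp: distinct_map inj_on_def)
        ultimately have "- y = y" using L(2) inj_onD[of abs "set L" "- y" y] unfolding orb by auto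
        then show False using L(3) j0 by simp
      next
        case False
        then have "\<bar>j\<bar> \<notin> abs ` set (concat ps @ ys @ zs)" using nys by (auto simp del: set_concat)
        then have "\<sigma> j = j" using T unfolding cycle_type_def by blast
        then have "map \<sigma> [j] = rotate1 [j]" by simp
        then have "orbit \<sigma> j = {j}" using orbit_of_cycle[of \<sigma> "[j]" j] by simp
        then show False using neg j0 by simp
      qed
    qed
  qed
qed

section \<open>The generating function of an interval in terms of cycle lengths\<close>

lemma sum_list_map_conv_nth: "sum_list (map f xs) = (\<Sum>k<length xs. f (xs ! k))"
  by (simp add: sum_list_sum_nth atLeast0LessThan)

lemma nth_splitE:
  assumes "k < length xs"
  obtains A j B where "xs = A @ j # B" "length A = k" "xs ! k = j"
  using that[of "take k xs" "xs ! k" "drop (Suc k) xs"] id_take_nth_drop[OF assms] assms by simp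

lemma interval_gf_id: "interval_gf x N id = 1"
proof -
  have "lower N id = {id}"
  proof
    show "lower N id \<subseteq> {id}"
      using B_length_eq_0[of _ N] by (auto simp: lower_def B_le_def B_length_id)
    show "{id} \<subseteq> lower N id" by (simp add: lower_def B_le_def B_length_id id_hyperoctahedral)
  qed
  then show ?thesis by (simp add: interval_gf_def B_length_id)
qed

text \<open>The target \<open>j = p\<close> gives the first summand of \<open>narayana_Suc\<close>, and the other points of the cycle give the
  convolution. All other cycles enter through the common factor \<open>G\<close>.\<close>

lemma interval_gf_positive_cycle:
  assumes T: "cycle_type N \<sigma> ((p # xs) # ps) ys zs"
    and IH: "\<And>\<rho> ps' . cycle_type N \<rho> ps' ys zs \<Longrightarrow> 2 * length (concat ps') + length ps' < 2 * length (concat ((p # xs) # ps)) + Suc (length ps) \<Longrightarrow>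
      interval_gf x N \<rho> = prod_list (map (\<lambda>xs. narayana x (length xs)) ps') * G"
  shows "interval_gf x N \<sigma> = prod_list (map (\<lambda>xs. narayana x (length xs)) ((p # xs) # ps)) * G"
proof -
  note c = cycle_typeD[OF T]
  let ?n = "length xs" and ?R = "prod_list (map (\<lambda>xs. narayana x (length xs)) ps) * G"
  let ?P = "\<lambda>j. interval_gf x N (splice_out \<sigma> p j)"
  have p: "p \<in> signed_points N" using c(3) by simp
  have "distinct (map abs (p # xs))" using c(2) by simp
  then have d: "distinct (p # xs)" by (simp only: distinct_map)
  have np: "xs ! k \<noteq> p" if "k < ?n" for k using d nth_mem[OF that] by auto
  have "interval_gf x N \<sigma> = (\<Sum>j\<in>set (p # xs). (if j = p then 1 else x) * ?P j)"
    unfolding interval_gf_splice_out[OF c(1) p] by (simp only: inseparable_positive_cycle[OF T, of p] list.set_intros)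
  also have "\<dots> = sum_list (map (\<lambda>j. (if j = p then 1 else x) * ?P j) (p # xs))"
    using d by (rule sum_list_distinct_conv_sum_set[symmetric])
  also have "\<dots> = ?P p + (\<Sum>k<?n. x * ?P (xs ! k))"
    using np by (simp add: sum_list_map_conv_nth del: sum_list_map_eq_sum_count)
  also have "(\<Sum>k<?n. x * ?P (xs ! k)) = (\<Sum>k<?n. x * (narayana x k * narayana x (?n - k) * ?R))"
  proof (intro sum.cong refl)
    fix k assume "k \<in> {..<?n}"
    then have "k < ?n" by simp
    then obtain A j B where xs: "xs = A @ j # B" "length A = k" "xs ! k = j"
      by (rule nth_splitE)
    have "cycle_type N (splice_out \<sigma> p j) (A # (j # B) # ps) ys zs"
      using T unfolding xs(1) by (rule cycle_type_pos_split)
    from IH[OF this] show "x * ?P (xs ! k) = x * (narayana x k * narayana x (?n - k) * ?R)"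
      unfolding xs(3) using xs(1,2) by (simp add: mult_ac)
  qed
  also have "?P p = narayana x ?n * ?R"
    using IH[OF cycle_type_pos_remove[OF T]] by (simp add: mult_ac)
  finally show ?thesis
    by (simp add: narayana_Suc algebra_simps sum_distrib_left sum_distrib_right)
qed

text \<open>The five kinds of targets \<open>p\<close>, \<open>- p\<close>, points of \<open>xs\<close>, their negatives, and points of the other cycle with either
  sign correspond to the summands of \<open>annular_Suc\<close>.\<close>

lemma interval_gf_negative_cycle:
  assumes T: "cycle_type N \<sigma> [] (p # xs) zs"
    and IH: "\<And>\<rho> ps ys' zs'. cycle_type N \<rho> ps ys' zs' \<Longrightarrow>
      2 * length (concat ps @ ys' @ zs') + length ps < 2 * length (p # xs @ zs) \<Longrightarrow>
      interval_gf x N \<rho> = prod_list (map (\<lambda>xs. narayana x (length xs)) ps) * annular x (length ys') (length zs')"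
  shows "interval_gf x N \<sigma> = annular x (length (p # xs)) (length zs)"
proof -
  note c = cycle_typeD[OF T]
  let ?n = "length xs" and ?m = "length zs"
  let ?P = "\<lambda>j. interval_gf x N (splice_out \<sigma> p j)"
  have p: "p \<in> signed_points N" "p \<noteq> 0" using c(3) by (simp_all add: signed_points_def)
  have d0: "distinct (map abs (p # xs @ zs))" using c(2) by simp
  then have inj: "inj_on abs (set (p # xs @ zs))" by (simp only: distinct_map)
  have d: "distinct (p # xs @ zs)" using d0 by (simp only: distinct_map)
  have nz: "y \<noteq> 0" if "y \<in> set (p # xs @ zs)" for y
    using c(3) that by (auto simp: signed_points_def)
  have opp: "- y \<notin> set (p # xs @ zs)" if "y \<in> set (p # xs @ zs)" for y
  proof
    assume "- y \<in> set (p # xs @ zs)"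
    then have "y = - y" using that by (intro inj_onD[OF inj, OF abs_minus_cancel[symmetric]])
    then show False using nz[OF that] by simp
  qed
  let ?E = "p # xs @ zs"
  have "distinct (map uminus ?E)" unfolding distinct_map using d by (intro conjI) (simp_all only: inj_uminus)
  moreover have "set ?E \<inter> set (map uminus ?E) = {}" unfolding set_map using opp by blast
  ultimately have dE: "distinct (?E @ map uminus ?E)" using d by (simp only: distinct_append simp_thms)
  have "set ((p # xs) @ map uminus (p # xs) @ zs @ map uminus zs) = set (?E @ map uminus ?E)" by auto
  then have J: "{j. j \<in> signed_points N \<and> inseparable \<sigma> p j} = set (?E @ map uminus ?E)"
    unfolding inseparable_negative_cycle[OF T, of p, simplified] by simp
  define f where "f = (\<lambda>j. (if j = p then 1 else x) * ?P j)"
  have fp: "f p = ?P p" "f (- p) = x * ?P (- p)" using p(2) by (simp_all add: f_def)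
  have f: "f y = x * ?P y" if "y \<noteq> p" for y using that by (simp add: f_def)
  have np: "y \<noteq> p" "- y \<noteq> p" if "y \<in> set xs \<union> set zs" for y
    using d that opp[of p] by auto
  have "interval_gf x N \<sigma> = sum f (set (?E @ map uminus ?E))"
    unfolding interval_gf_splice_out[OF c(1) p(1)] J f_def ..
  also have "\<dots> = sum_list (map f (?E @ map uminus ?E))"
    using dE by (rule sum_list_distinct_conv_sum_set[symmetric])
  also have "\<dots> = ?P p + x * ?P (- p) + (\<Sum>k<?n. f (xs ! k)) + (\<Sum>k<?n. f (- (xs ! k)))
      + (\<Sum>k<?m. f (zs ! k)) + (\<Sum>k<?m. f (- (zs ! k)))"
    unfolding fp[symmetric] by (simp add: sum_list_map_conv_nth add_ac comp_def)
  also have "(\<Sum>k<?n. f (xs ! k)) = (\<Sum>k<?n. x * (narayana x k * annular x (?n - k) ?m))"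
  proof (intro sum.cong refl)
    fix k assume "k \<in> {..<?n}"
    then have "k < ?n" by simp
    then obtain A j B where xs: "xs = A @ j # B" "length A = k" "xs ! k = j"
      by (rule nth_splitE)
    have "cycle_type N (splice_out \<sigma> p j) [A] (j # B) zs"
      using T unfolding xs(1) by (rule cycle_type_neg_split(1))
    from IH[OF this] show "f (xs ! k) = x * (narayana x k * annular x (?n - k) ?m)"
      unfolding xs(3) using xs(1,2) f[OF np(1)[of j]] by simp
  qed
  also have "(\<Sum>k<?n. f (- (xs ! k))) = (\<Sum>k<?n. x * (annular x k ?m * narayana x (?n - k)))"
  proof (intro sum.cong refl)
    fix k assume "k \<in> {..<?n}"
    then have "k < ?n" by simp
    then obtain A j B where xs: "xs = A @ j # B" "length A = k" "xs ! k = j"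
      by (rule nth_splitE)
    have "cycle_type N (splice_out \<sigma> p (- j)) [j # B] A zs"
      using T unfolding xs(1) by (rule cycle_type_neg_split(2))
    from IH[OF this] show "f (- (xs ! k)) = x * (annular x k ?m * narayana x (?n - k))"
      unfolding xs(3) using xs(1,2) f[OF np(2)[of j]] by (simp add: mult_ac)
  qed
  also have "(\<Sum>k<?m. f (zs ! k)) = (\<Sum>k<?m. x * narayana x (?n + ?m))"
  proof (intro sum.cong refl)
    fix k assume "k \<in> {..<?m}"
    then have "k < ?m" by simp
    then obtain A j B where zs: "zs = A @ j # B" "length A = k" "zs ! k = j"
      by (rule nth_splitE)
    have "cycle_type N (splice_out \<sigma> p j) [xs @ map uminus (j # B) @ A] [] []"
      using T unfolding zs(1) by (rule cycle_type_neg_join)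
    from IH[OF this] show "f (zs ! k) = x * narayana x (?n + ?m)"
      unfolding zs(3) using zs(1,2) f[OF np(1)[of j]] by (simp add: annular_0_0 add_ac)
  qed
  also have "(\<Sum>k<?m. f (- (zs ! k))) = (\<Sum>k<?m. x * narayana x (?n + ?m))"
  proof (intro sum.cong refl)
    fix k assume "k \<in> {..<?m}"
    then have "k < ?m" by simp
    then obtain A j B where zs: "zs = A @ j # B" "length A = k" "zs ! k = j"
      by (rule nth_splitE)
    have "map uminus zs = map uminus A @ - j # map uminus B" by (simp add: zs(1))
    then have "cycle_type N (splice_out \<sigma> p (- j)) [xs @ map uminus (- j # map uminus B) @ map uminus A] [] []"
      using cycle_type_uminus[OF T] by (intro cycle_type_neg_join) (simp only:)
    from IH[OF this] show "f (- (zs ! k)) = x * narayana x (?n + ?m)"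
      unfolding zs(3) using zs(1,2) f[OF np(2)[of j]] by (simp add: annular_0_0 add_ac)
  qed
  also have "?P p = annular x ?n ?m"
    using IH[OF cycle_type_neg_remove(1)[OF T]] by simp
  also have "?P (- p) = narayana x ?n * annular x 0 ?m"
    using IH[OF cycle_type_neg_remove(2)[OF T]] by simp
  finally show ?thesis
    by (simp add: annular_Suc algebra_simps sum_distrib_left)
qed

text \<open>Each removal decreases the number of listed points by one and adds at most one list to \<open>ps\<close>, hence the
  weight 2 in the induction measure.\<close>

theorem interval_gf_cycle_type:
  assumes "cycle_type N \<sigma> ps ys zs"
  shows "interval_gf x N \<sigma> = prod_list (map (\<lambda>xs. narayana x (length xs)) ps) * annular x (length ys) (length zs)"
  using assms
proof (induction "2 * length (concat ps @ ys @ zs) + length ps" arbitrary: \<sigma> ps ys zs rule: less_induct)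
  case less
  consider (nil) ps' where "ps = [] # ps'" | (pos) p xs ps' where "ps = (p # xs) # ps'"
    | (ys) p xs where "ps = []" "ys = p # xs" | (zs) p xs where "ps = []" "ys = []" "zs = p # xs"
    | (empty) "ps = []" "ys = []" "zs = []"
    by (cases ps; cases "hd ps"; cases ys; cases zs) auto
  then show ?case
  proof cases
    case nil
    then have "cycle_type N \<sigma> ps' ys zs" using less.prems by (auto simp: cycle_type_def)
    from less.hyps[OF _ this] show ?thesis by (simp add: nil narayana_0)
  next
    case pos
    show ?thesis unfolding pos
    proof (rule interval_gf_positive_cycle)
      show "cycle_type N \<sigma> ((p # xs) # ps') ys zs" using less.prems by (simp only: pos)
      show "interval_gf x N \<rho> = prod_list (map (\<lambda>xs. narayana x (length xs)) ps'') * annular x (length ys) (length zs)"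
        if "cycle_type N \<rho> ps'' ys zs"
          "2 * length (concat ps'') + length ps'' < 2 * length (concat ((p # xs) # ps')) + Suc (length ps')" for \<rho> ps''
        using that(2) by (intro less.hyps[OF _ that(1)]) (simp add: pos)
    qed
  next
    case ys
    have "interval_gf x N \<sigma> = annular x (length (p # xs)) (length zs)"
    proof (rule interval_gf_negative_cycle)
      show "cycle_type N \<sigma> [] (p # xs) zs" using less.prems by (simp only: ys)
    qed (rule less.hyps; simp add: ys)
    then show ?thesis by (simp add: ys)
  next
    case zs
    have "interval_gf x N \<sigma> = annular x (length (p # xs)) (length ([] :: int list))"
    proof (rule interval_gf_negative_cycle)
      show "cycle_type N \<sigma> [] (p # xs) []" using cycle_type_swap[OF less.prems] by (simp only: zs)
    qed (rule less.hyps; simp add: zs)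
    then show ?thesis using annular_commute[of x 0 "length (p # xs)"] by (simp add: zs)
  next
    case empty
    then have "\<sigma> = id" using less.prems by (auto simp: cycle_type_def fun_eq_iff)
    then show ?thesis by (simp add: empty interval_gf_id annular_0_0)
  qed
qed

section \<open>The cycle type of gamma\<close>

lemma negative_cycle_of_list:
  assumes "distinct (map abs L)" "0 \<notin> set L"
  defines "f \<equiv> cycle_of_list (L @ map uminus L)"
  shows "map f L = negrotate1 L" "f (- x) = - f x"
proof -
  have inj: "inj_on abs (set L)" and dL: "distinct L" using assms(1) by (auto simp: distinct_map)
  have "- y \<notin> set L" if "y \<in> set L" for y
  proof
    assume "- y \<in> set L"
    then have "y = - y" using that by (intro inj_onD[OF inj, OF abs_minus_cancel[symmetric]])
    then show False using that assms(2) by auto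
  qed
  then have "set L \<inter> set (map uminus L) = {}" by auto
  then have "distinct (L @ map uminus L)" using dL by (simp add: distinct_map)
  then have "map f (L @ map uminus L) = rotate1 (L @ map uminus L)"
    using cyclic_rotation[of "L @ map uminus L" 1] unfolding f_def by simp
  also have "\<dots> = negrotate1 L @ map uminus (negrotate1 L)" by (cases L) auto
  finally have eq: "map f L @ map f (map uminus L) = negrotate1 L @ map uminus (negrotate1 L)" by simp
  have len: "length (map f L) = length (negrotate1 L)" by (cases L) auto
  note m = iffD1[OF append_eq_append_conv[OF disjI1[OF len]] eq]
  show "map f L = negrotate1 L" using m ..
  have "map (\<lambda>y. f (- y)) L = map (\<lambda>y. - f y) L"
    using m by (simp add: comp_def flip: map_map[of uminus f L, unfolded comp_def])
  then have odd: "f (- y) = - f y" if "y \<in> set L" for y using that by simp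
  consider "x \<in> set L" | "- x \<in> set L" | "x \<notin> set L" "- x \<notin> set L" by blast
  then show "f (- x) = - f x"
  proof cases
    case 2
    then show ?thesis using odd[of "- x"] by simp
  next
    case 3
    then have x: "x \<notin> set (L @ map uminus L)" "- x \<notin> set (L @ map uminus L)" by auto
    show ?thesis unfolding f_def id_outside_supp[OF x(1)] id_outside_supp[OF x(2)] by (rule HOL.refl)
  qed (rule odd)
qed

lemma cycle_type_gamma_B:
  "cycle_type (p + q) (gamma_B p q) [] [1..int p] [int p + 1..int (p + q)]"
proof -
  let ?L = "[1..int p]" and ?M = "[int p + 1..int (p + q)]"
  let ?f = "cycle_of_list (?L @ map uminus ?L)" and ?g = "cycle_of_list (?M @ map uminus ?M)"
  have "map abs ?L = ?L" "map abs ?M = ?M" by (auto intro!: map_idI)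
  then have dist: "distinct (map abs ?L)" "distinct (map abs ?M)" by simp_all
  have "0 \<notin> set ?L" "0 \<notin> set ?M" by auto
  note f = negative_cycle_of_list[OF dist(1) this(1)] and g = negative_cycle_of_list[OF dist(2) this(2)]
  have fid: "?f x = x" if "x \<notin> set ?L" "- x \<notin> set ?L" for x
    by (rule id_outside_supp) (use that in force)
  have gid: "?g x = x" if "x \<notin> set ?M" "- x \<notin> set ?M" for x
    by (rule id_outside_supp) (use that in force)
  have perm: "permutation ?f" "permutation ?g" by (rule permutation_of_cycle)+
  have gam: "gamma_B p q = ?f \<circ> ?g" by (simp add: gamma_B_def)
  have bij: "bij (gamma_B p q)" unfolding gam using perm by (intro bij_comp permutation_bijective)
  have odd: "gamma_B p q (- x) = - gamma_B p q x" for x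
    using f(2)[of "?g x"] g(2)[of x] by (simp add: gam)
  have out: "gamma_B p q x = x" if "\<bar>x\<bar> \<notin> abs ` set (?L @ ?M)" for x
  proof -
    have "y \<notin> set (?L @ ?M)" if "\<bar>y\<bar> = \<bar>x\<bar>" for y
      using \<open>\<bar>x\<bar> \<notin> abs ` set (?L @ ?M)\<close> that by (metis imageI)
    from this[of x] this[of "- x"]
    have n: "x \<notin> set ?L" "- x \<notin> set ?L" "x \<notin> set ?M" "- x \<notin> set ?M" by simp_all
    show ?thesis unfolding gam o_apply gid[OF n(3,4)] fid[OF n(1,2)] by (rule HOL.refl)
  qed
  have "gamma_B p q x = x" if "int (p + q) < \<bar>x\<bar>" for x
    using that by (intro out) auto
  then have H: "gamma_B p q \<in> hyperoctahedral (p + q)"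
    unfolding hyperoctahedral_iff using bij odd by blast
  have m1: "map (gamma_B p q) ?L = map ?f ?L"
  proof (rule map_cong)
    fix x assume "x \<in> set ?L"
    then have n: "x \<notin> set ?M" "- x \<notin> set ?M" by auto
    show "gamma_B p q x = ?f x" unfolding gam o_apply gid[OF n] by (rule HOL.refl)
  qed simp
  have m2: "map (gamma_B p q) ?M = map ?g ?M"
  proof (rule map_cong)
    fix x assume "x \<in> set ?M"
    then have "?g x \<in> set (map ?g ?M)" unfolding set_map by (rule imageI)
    moreover have "\<bar>y\<bar> \<in> set (map abs K)" if "y \<in> set (negrotate1 K)" for y K
      using that by (cases K) auto
    ultimately have "\<bar>?g x\<bar> \<in> set ?M" unfolding g(1) using \<open>map abs ?M = ?M\<close> by fastforce
    then have n: "?g x \<notin> set ?L" "- ?g x \<notin> set ?L" by auto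
    show "gamma_B p q x = ?g x" unfolding gam o_apply fid[OF n] by (rule HOL.refl)
  qed simp
  have d: "distinct (map abs (?L @ ?M))"
  proof -
    have "map abs (?L @ ?M) = ?L @ ?M" by (auto intro!: map_idI)
    then show ?thesis by auto
  qed
  have sub: "set (?L @ ?M) \<subseteq> signed_points (p + q)" by (auto simp: signed_points_def)
  have "\<forall>xs\<in>set ([] :: int list list). map (gamma_B p q) xs = rotate1 xs" by simp
  then show ?thesis
    unfolding cycle_type_def concat.simps append_Nil using H d sub m1[unfolded f(1)] m2[unfolded g(1)] out by blast
qed

section \<open>Rank equals reflection length\<close>

text \<open>One orbit from each pair of opposite orbits that differ: the one with the larger maximum. An orbit with
  \<open>Max A = - Min A\<close> contains a point and its negative, and so it is invariant.\<close>

definition positive_orbits :: "nat \<Rightarrow> (int \<Rightarrow> int) \<Rightarrow> int set set" where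
  "positive_orbits N \<tau> = {A \<in> Omega N \<tau>. Max A > - Min A}"

lemma orbit_eq_iff:
  assumes "\<tau> \<in> hyperoctahedral N" shows "orbit \<tau> x = orbit \<tau> y \<longleftrightarrow> x \<in> orbit \<tau> y"
proof
  show "x \<in> orbit \<tau> y" if "orbit \<tau> x = orbit \<tau> y" using orbit_self[OF assms, of x] that by simp
  assume x: "x \<in> orbit \<tau> y"
  have "orbit \<tau> a \<subseteq> orbit \<tau> b" if "a \<in> orbit \<tau> b" for a b
    using orbit_trans[OF _ that] by blast
  then show "orbit \<tau> x = orbit \<tau> y" using x orbit_sym[OF assms x] by blast
qed

lemma uminus_orbit:
  assumes "\<tau> \<in> hyperoctahedral N" shows "uminus ` orbit \<tau> x = orbit \<tau> (- x)"
proof (intro set_eqI iffI)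
  fix y assume "y \<in> orbit \<tau> (- x)"
  then have "- y \<in> orbit \<tau> x" using orbit_uminus[OF assms, of y "- x"] by simp
  then show "y \<in> uminus ` orbit \<tau> x" by force
qed (use orbit_uminus[OF assms] in auto)

lemma finite_orbit_hyperoctahedral: "\<tau> \<in> hyperoctahedral N \<Longrightarrow> finite (orbit \<tau> x)"
  by (intro finite_orbit orbit_self)

lemma Max_uminus_orbit:
  assumes "\<tau> \<in> hyperoctahedral N"
  shows "Max (orbit \<tau> (- x)) = - Min (orbit \<tau> x)" "Min (orbit \<tau> (- x)) = - Max (orbit \<tau> x)"
proof -
  have f: "finite (orbit \<tau> x)" "orbit \<tau> x \<noteq> {}"
    using finite_orbit_hyperoctahedral[OF assms] orbit_self[OF assms, of x] by auto
  show "Max (orbit \<tau> (- x)) = - Min (orbit \<tau> x)"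
    unfolding uminus_orbit[OF assms, symmetric] using f by (intro Max_eqI) auto
  show "Min (orbit \<tau> (- x)) = - Max (orbit \<tau> x)"
    unfolding uminus_orbit[OF assms, symmetric] using f by (intro Min_eqI) auto
qed

lemma orbit_trichotomy:
  assumes \<tau>: "\<tau> \<in> hyperoctahedral N" and x: "x \<in> signed_points N"
  shows "orbit \<tau> x \<in> positive_orbits N \<tau> \<longleftrightarrow> orbit \<tau> (- x) \<notin> positive_orbits N \<tau> \<and> - x \<notin> orbit \<tau> x"
    "inversion_invariant (orbit \<tau> x) \<longleftrightarrow> - x \<in> orbit \<tau> x"
proof -
  let ?A = "orbit \<tau> x"
  have f: "finite ?A" "?A \<noteq> {}"
    using finite_orbit_hyperoctahedral[OF \<tau>] orbit_self[OF \<tau>, of x] by auto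
  have mem: "orbit \<tau> x \<in> Omega N \<tau>" "orbit \<tau> (- x) \<in> Omega N \<tau>"
    using x by (auto simp: Omega_def signed_points_minus)
  have inv: "- x \<in> ?A \<longleftrightarrow> orbit \<tau> (- x) = ?A" by (rule orbit_eq_iff[OF \<tau>, symmetric])
  have "- x \<in> ?A" if "Max ?A = - Min ?A"
  proof -
    have M: "Min ?A \<in> ?A" "- Min ?A \<in> ?A" using f Min_in Max_in[OF f] that by auto
    have "- Min ?A \<in> orbit \<tau> (- x)" by (rule orbit_uminus[OF \<tau> M(1)])
    then show ?thesis using M(2) orbit_eq_iff[OF \<tau>] inv by metis
  qed
  moreover have "Max ?A = - Min ?A" if "- x \<in> ?A"
    using Max_uminus_orbit(1)[OF \<tau>, of x] that inv by simp
  ultimately have "- x \<in> ?A \<longleftrightarrow> Max ?A = - Min ?A" by blast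
  then show "orbit \<tau> x \<in> positive_orbits N \<tau> \<longleftrightarrow> orbit \<tau> (- x) \<notin> positive_orbits N \<tau> \<and> - x \<notin> orbit \<tau> x"
    using mem by (auto simp: positive_orbits_def Max_uminus_orbit[OF \<tau>])
  show "inversion_invariant ?A \<longleftrightarrow> - x \<in> ?A"
    by (auto simp: inversion_invariant_def uminus_orbit[OF \<tau>] inv)
qed

lemma finite_Omega: "finite (Omega N \<tau>)"
  by (simp add: Omega_def finite_signed_points)

lemma card_noninvariant:
  assumes \<tau>: "\<tau> \<in> hyperoctahedral N"
  shows "card {A \<in> Omega N \<tau>. \<not> inversion_invariant A} = 2 * card (positive_orbits N \<tau>)"
proof -
  let ?R = "positive_orbits N \<tau>"
  have fin: "finite ?R" using finite_Omega[of N \<tau>] by (simp add: positive_orbits_def)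
  have R: "A \<in> ?R \<Longrightarrow> \<exists>x. x \<in> signed_points N \<and> A = orbit \<tau> x" for A
    by (auto simp: positive_orbits_def Omega_def)
  have eq: "{A \<in> Omega N \<tau>. \<not> inversion_invariant A} = ?R \<union> (`) uminus ` ?R" (is "?L = _")
  proof (intro set_eqI iffI)
    fix A assume "A \<in> ?L"
    then obtain x where x: "x \<in> signed_points N" "A = orbit \<tau> x" "- x \<notin> orbit \<tau> x"
      using orbit_trichotomy(2)[OF \<tau>] by (auto simp: Omega_def)
    then have "A \<in> ?R \<or> orbit \<tau> (- x) \<in> ?R" using orbit_trichotomy(1)[OF \<tau> x(1)] by auto
    moreover have "A = uminus ` orbit \<tau> (- x)" by (simp add: uminus_orbit[OF \<tau>] x(2))
    ultimately show "A \<in> ?R \<union> (`) uminus ` ?R" by blast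
  next
    fix A assume "A \<in> ?R \<union> (`) uminus ` ?R"
    then obtain x where x: "x \<in> signed_points N" "orbit \<tau> x \<in> ?R" "A = orbit \<tau> x \<or> A = uminus ` orbit \<tau> x"
      using R by blast
    have nx: "- x \<notin> orbit \<tau> x" using orbit_trichotomy(1)[OF \<tau> x(1)] x(2) by blast
    then have "- (- x) \<notin> orbit \<tau> (- x)" using orbit_sym[OF \<tau>, of x "- x"] by auto
    then show "A \<in> ?L"
      using x nx orbit_trichotomy(2)[OF \<tau>, of x] orbit_trichotomy(2)[OF \<tau>, of "- x"]
      by (auto simp: Omega_def uminus_orbit[OF \<tau>] signed_points_minus)
  qed
  have "?R \<inter> (`) uminus ` ?R = {}"
  proof -
    have "uminus ` A \<notin> ?R" if A: "A \<in> ?R" for A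
    proof -
      obtain x where "x \<in> signed_points N" "A = orbit \<tau> x" using R[OF A] by blast
      then show ?thesis using A orbit_trichotomy(1)[OF \<tau>, of x] by (simp add: uminus_orbit[OF \<tau>])
    qed
    then show ?thesis by auto
  qed
  moreover have "card ((`) uminus ` ?R) = card ?R"
    by (rule card_image) (auto intro!: inj_on_inverseI[where g = "(`) uminus"] simp: image_image)
  ultimately show ?thesis unfolding eq using fin by (simp add: card_Un_disjoint)
qed

text \<open>A fixed vector can take arbitrary values on the chosen orbits, the opposite values on their negatives, and it
  vanishes on the invariant orbits.\<close>

lemma num_fixv_eq:
  assumes \<tau>: "\<tau> \<in> hyperoctahedral N"
  shows "num_fixv N \<tau> = 3 ^ card (positive_orbits N \<tau>)"
proof -
  let ?R = "positive_orbits N \<tau>" and ?F = "fixv N \<tau> :: (int \<Rightarrow> 3) set"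
  define to where "to = (\<lambda>v :: int \<Rightarrow> 3. restrict (\<lambda>A. v (Max A)) ?R)"
  define extend where "extend = (\<lambda>(g :: int set \<Rightarrow> 3) x. if orbit \<tau> x \<in> ?R then g (orbit \<tau> x)
      else if orbit \<tau> (- x) \<in> ?R then - g (orbit \<tau> (- x)) else 0)"
  have fin: "finite ?R" using finite_Omega[of N \<tau>] by (simp add: positive_orbits_def)
  have Max_in_orbit: "Max (orbit \<tau> x) \<in> orbit \<tau> x" for x
    using finite_orbit_hyperoctahedral[OF \<tau>] orbit_self[OF \<tau>, of x] by (intro Max_in) auto
  have S: "x \<in> signed_points N" if "orbit \<tau> x \<in> ?R" for x
  proof -
    from that obtain y where "y \<in> signed_points N" "orbit \<tau> x = orbit \<tau> y"
      by (auto simp: positive_orbits_def Omega_def)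
    then show ?thesis using orbit_self[OF \<tau>, of x] orbit_signed_points[OF \<tau>, of x y] by simp
  qed
  have excl: "\<not> (orbit \<tau> x \<in> ?R \<and> orbit \<tau> (- x) \<in> ?R)" for x
    using S[of x] orbit_trichotomy(1)[OF \<tau>, of x] by blast
  have "bij_betw to ?F (?R \<rightarrow>\<^sub>E UNIV)"
  proof (rule bij_betw_byWitness[where f' = extend])
    show "\<forall>v\<in>?F. extend (to v) = v"
    proof (intro ballI ext)
      fix v x assume v: "v \<in> ?F"
      have val: "v (Max (orbit \<tau> y)) = v y" for y by (rule fixv_orbit[OF v Max_in_orbit])
      consider "orbit \<tau> x \<in> ?R" | "orbit \<tau> x \<notin> ?R" "orbit \<tau> (- x) \<in> ?R"
        | "orbit \<tau> x \<notin> ?R" "orbit \<tau> (- x) \<notin> ?R" "x \<in> signed_points N"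
        | "orbit \<tau> x \<notin> ?R" "orbit \<tau> (- x) \<notin> ?R" "x \<notin> signed_points N" by blast
      then show "extend (to v) x = v x"
      proof cases
        case 3
        then have "inseparable \<tau> x (- x)"
          using orbit_trichotomy(1)[OF \<tau> 3(3)] by (simp add: inseparable_def)
        from fixv_inseparable[OF v this half_3] have "v x + v x = 0"
          by (simp add: fixv_minus[OF v] eq_neg_iff_add_eq_0)
        then have "2 * v x + 2 * v x = 0" by (simp flip: mult_2)
        then have "(2 + 2) * v x = 0" by (simp only: distrib_right)
        then have "v x = 0" unfolding half_3 by simp
        then show ?thesis using 3 by (simp add: extend_def)
      qed (auto simp: extend_def to_def val fixv_minus[OF v] fixv_outside[OF v])
    qed
    show "\<forall>g\<in>?R \<rightarrow>\<^sub>E UNIV. to (extend g) = g"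
    proof (intro ballI ext)
      fix g A assume g: "g \<in> ?R \<rightarrow>\<^sub>E (UNIV :: 3 set)"
      show "to (extend g) A = g A"
      proof (cases "A \<in> ?R")
        case True
        then obtain x where "A = orbit \<tau> x" by (auto simp: positive_orbits_def Omega_def)
        moreover have "orbit \<tau> (Max (orbit \<tau> x)) = orbit \<tau> x"
          unfolding orbit_eq_iff[OF \<tau>] by (rule Max_in_orbit)
        ultimately show ?thesis using True by (simp add: to_def extend_def)
      next
        case False
        then show ?thesis using PiE_arb[OF g] by (simp add: to_def)
      qed
    qed
    show "to ` ?F \<subseteq> ?R \<rightarrow>\<^sub>E UNIV" by (auto simp: to_def)
    show "extend ` (?R \<rightarrow>\<^sub>E UNIV) \<subseteq> ?F"
    proof safe
      fix g :: "int set \<Rightarrow> 3"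
      show "extend g \<in> ?F"
      proof (rule fixvI)
        show "extend g (- x) = - extend g x" for x using excl[of x] by (auto simp: extend_def)
        show "extend g x = 0" if "x \<notin> signed_points N" for x
          using that S[of x] S[of "- x"] by (auto simp: extend_def signed_points_minus)
        show "extend g (\<tau> x) = extend g x" for x
          using permutation_orbit_step[OF hyperoctahedral_permutation[OF \<tau>]]
          by (simp add: extend_def flip: hyperoctahedral_minus[OF \<tau>])
      qed
    qed
  qed
  from bij_betw_same_card[OF this] show ?thesis
    by (simp add: num_fixv_def card_PiE[OF fin])
qed

lemma B_length_eq:
  assumes \<tau>: "\<tau> \<in> hyperoctahedral N"
  shows "card (positive_orbits N \<tau>) + B_length N \<tau> = N"
proof -
  \<comment> \<open>The value of \<open>num_fixv\<close> at the identity fixes the constant \<open>N\<close>.\<close>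
  have orb: "orbit id x = {x}" for x :: int
    using orbit_of_cycle[of id "[x]" x] by simp
  have "positive_orbits N id = (\<lambda>x. {x}) ` {1..int N}"
    unfolding positive_orbits_def Omega_def orb by (auto simp: signed_points_def)
  then have "card (positive_orbits N id) = N" by (simp add: card_image)
  then have "(3::nat) ^ (card (positive_orbits N \<tau>) + B_length N \<tau>) = 3 ^ N"
    using num_fixv_B_length[OF \<tau>] by (simp add: num_fixv_eq \<tau> id_hyperoctahedral power_add)
  then show ?thesis by (subst (asm) power_inject_exp) auto
qed

text \<open>Merging the invariant blocks produces an invariant block.\<close>

lemma noninvariant_Omega_tilde:
  "{A \<in> Omega_tilde N \<tau>. \<not> inversion_invariant A} = {A \<in> Omega N \<tau>. \<not> inversion_invariant A}"
proof -
  have "inversion_invariant (\<Union> {A \<in> P. inversion_invariant A})" for P :: "int set set"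
  proof -
    have *: "- x \<in> A" if "x \<in> A" "inversion_invariant A" for x A
    proof -
      have "- x \<in> uminus ` A" using that(1) by (rule imageI)
      then show ?thesis using that(2) by (simp add: inversion_invariant_def)
    qed
    show ?thesis unfolding inversion_invariant_def[of "\<Union> _"]
    proof (intro set_eqI iffI)
      fix x assume "x \<in> \<Union> {A \<in> P. inversion_invariant A}"
      then have "- x \<in> \<Union> {A \<in> P. inversion_invariant A}" using *[of x] by blast
      then have "- (- x) \<in> uminus ` \<Union> {A \<in> P. inversion_invariant A}" by (rule imageI)
      then show "x \<in> uminus ` \<Union> {A \<in> P. inversion_invariant A}" by simp
    next
      fix x assume "x \<in> uminus ` \<Union> {A \<in> P. inversion_invariant A}"
      then show "x \<in> \<Union> {A \<in> P. inversion_invariant A}" using * by blast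
    qed
  qed
  then show ?thesis by (auto simp: Omega_tilde_def merge_invariant_def Let_def)
qed

lemma rank_B_Omega_tilde:
  assumes "\<tau> \<in> hyperoctahedral (p + q)"
  shows "rank_B p q (Omega_tilde (p + q) \<tau>) = B_length (p + q) \<tau>"
  using B_length_eq[OF assms]
  by (simp add: rank_B_def noninvariant_Omega_tilde card_noninvariant[OF assms])

section \<open>Intervals are determined by fixed spaces\<close>

text \<open>The fixed spaces of two factors with additive lengths together span everything. Shorten the
  right factor by a reflection \<open>t\<close>. The product then gains a fixed vector \<open>u\<close> outside the
  hyperplane of \<open>t\<close>, which is fixed by both factors; shifting a multiple of \<open>u\<close> from one summand to the other
  moves the second summand into the hyperplane.\<close>

lemma fixv_decomposition:
  fixes v :: "int \<Rightarrow> real"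
  assumes "\<tau> \<in> hyperoctahedral N" "\<kappa> \<in> hyperoctahedral N"
    and "B_length N (\<tau> \<circ> \<kappa>) = B_length N \<tau> + B_length N \<kappa>" and "v \<in> fixv N id"
  shows "\<exists>a\<in>fixv N \<tau>. \<exists>b\<in>fixv N \<kappa>. \<forall>x. v x = a x + b x"
  using assms
proof (induction "B_length N \<kappa>" arbitrary: \<kappa> v rule: less_induct)
  case less
  note \<tau> = less.prems(1) and \<kappa> = less.prems(2)
  show ?case
  proof (cases "\<kappa> = id")
    case True
    have "(\<lambda>x. 0) \<in> fixv N \<tau>" by (simp add: fixv_def)
    then show ?thesis using less.prems(4) True by (intro bexI[of _ "\<lambda>x. 0"] bexI[of _ v]) auto
  next
    case False
    then obtain i where i: "\<kappa> i \<noteq> i" by (auto simp: fun_eq_iff)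
    define j where "j = \<kappa> i"
    have iS: "i \<in> signed_points N"
      using i permutes_not_in[OF hyperoctahedral_permutes[OF \<kappa>]] by blast
    then have jS: "j \<in> signed_points N" by (simp add: j_def hyperoctahedral_mem_iff[OF \<kappa>])
    have ij: "i \<noteq> j" using i j_def by simp
    let ?s = "signed_swap i j"
    let ?\<kappa>' = "\<kappa> \<circ> ?s" and ?\<sigma> = "\<tau> \<circ> \<kappa>"
    have \<sigma>: "?\<sigma> \<in> hyperoctahedral N" by (rule comp_hyperoctahedral[OF \<tau> \<kappa>])
    have s: "?s \<in> hyperoctahedral N" by (rule signed_swap_hyperoctahedral[OF iS jS])
    have \<kappa>': "?\<kappa>' \<in> hyperoctahedral N" by (rule comp_hyperoctahedral[OF \<kappa> s])
    have \<sigma>': "?\<sigma> \<circ> ?s \<in> hyperoctahedral N" by (rule comp_hyperoctahedral[OF \<sigma> s])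
    have "inseparable \<kappa> i j" by (simp add: inseparable_def j_def orbit.base)
    then have len\<kappa>: "B_length N \<kappa> = Suc (B_length N ?\<kappa>')" by (rule B_length_comp_signed_swap(1)[OF \<kappa> iS jS ij])
    have le: "B_length N (?\<sigma> \<circ> ?s) \<le> B_length N \<tau> + B_length N ?\<kappa>'"
      using B_length_triangle[OF \<tau> \<kappa>'] by (simp only: comp_assoc)
    note step = B_length_comp_signed_swap[OF \<sigma> iS jS ij]
    have ins: "inseparable ?\<sigma> i j"
      using step(2) le less.prems(3) len\<kappa> by linarith
    then have len\<sigma>: "B_length N (?\<sigma> \<circ> ?s) = B_length N \<tau> + B_length N ?\<kappa>'"
      using step(1) less.prems(3) len\<kappa> by linarith
    have "\<not> inseparable (?\<sigma> \<circ> ?s) i j" using inseparable_comp_signed_swap[OF \<sigma> iS jS ij] ins by blast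
    then obtain u :: "int \<Rightarrow> real" where u: "u \<in> fixv N (?\<sigma> \<circ> ?s)" "u i \<noteq> u j"
      using separating_fixv[OF \<sigma>' iS jS] by blast
    have len': "B_length N (\<tau> \<circ> ?\<kappa>') = B_length N \<tau> + B_length N ?\<kappa>'"
      using len\<sigma> by (simp only: comp_assoc)
    have u\<tau>: "u \<in> fixv N \<tau>"
      using fixv_subset_additive[OF \<tau> \<kappa>' len'] u(1) by (auto simp only: comp_assoc)
    have u\<kappa>: "u \<in> fixv N ?\<kappa>'"
    proof (rule fixvI)
      show "u (?\<kappa>' x) = u x" for x
        using fixv_apply[OF u(1), of x] fixv_apply[OF u\<tau>, of "?\<kappa>' x"] by simp
    qed (simp_all add: fixv_minus[OF u\<tau>] fixv_outside[OF u\<tau>])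
    obtain a b where ab: "a \<in> fixv N \<tau>" "b \<in> fixv N ?\<kappa>'" "\<And>x. v x = a x + b x"
      using less.hyps[OF _ \<tau> \<kappa>' len' less.prems(4)] len\<kappa> by auto
    \<comment> \<open>The multiple of \<open>u\<close> that moves \<open>b\<close> into the hyperplane of the reflection.\<close>
    define c where "c = (b i - b j) / (u i - u j)"
    define b' where "b' = (\<lambda>x. b x + (- c) * u x)"
    have "b' \<in> fixv N ?\<kappa>'" unfolding b'_def by (rule fixv_combine[OF ab(2) u\<kappa>])
    moreover have "c * (u i - u j) = b i - b j" using u(2) by (simp add: c_def)
    then have "b' i = b' j" by (simp add: b'_def algebra_simps)
    ultimately have "b' \<in> fixv N (?\<kappa>' \<circ> ?s)" by (rule fixv_comp_signed_swap)
    then have "b' \<in> fixv N \<kappa>" by (simp only: signed_swap_comp_comp[OF iS jS])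
    moreover have "(\<lambda>x. a x + c * u x) \<in> fixv N \<tau>" by (rule fixv_combine[OF ab(1) u\<tau>])
    ultimately show ?thesis
      by (intro bexI[of _ "\<lambda>x. a x + c * u x"] bexI[of _ b']) (auto simp: ab(3) b'_def)
  qed
qed

text \<open>The image of \<open>1 - \<tau>\<close> is orthogonal to the fixed space of \<open>\<tau>\<close>.\<close>

lemma sum_fixv_comp:
  fixes f w :: "int \<Rightarrow> real"
  assumes \<tau>: "\<tau> \<in> hyperoctahedral N" and f: "f \<in> fixv N \<tau>"
  shows "(\<Sum>x\<in>signed_points N. (w x - w (\<tau> x)) * f x) = 0"
proof -
  have "(\<Sum>x\<in>signed_points N. w (\<tau> x) * f x) = (\<Sum>x\<in>signed_points N. w x * f x)"
    using sum_apply_hyperoctahedral[OF \<tau>, of "\<lambda>x. w x * f x"] by (simp add: fixv_apply[OF f])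
  then show ?thesis by (simp add: left_diff_distrib sum_subtractf)
qed

text \<open>Every vector is the sum of one fixed by \<open>\<tau>\<close> and one on which \<open>\<tau>\<close> and \<open>\<sigma>\<close> agree. For \<open>w\<close> of the second kind write
  \<open>w = f + w'\<close>, where \<open>f\<close> is fixed by \<open>\<tau>'\<close> and \<open>\<tau>'\<close> agrees with \<open>\<sigma>\<close> on \<open>w'\<close>. Then \<open>f - f \<circ> \<sigma>\<close> is orthogonal to the
  common fixed space, and in particular to \<open>f\<close>. As \<open>f\<close> and \<open>f \<circ> \<sigma>\<close> have the same norm, \<open>f = f \<circ> \<sigma>\<close>, and
  so \<open>\<tau>'\<close> agrees with \<open>\<sigma>\<close>, and hence with \<open>\<tau>\<close>, on \<open>w\<close>.\<close>

lemma lower_eqI: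
  assumes \<sigma>: "\<sigma> \<in> hyperoctahedral N" and "\<tau> \<in> lower N \<sigma>" "\<tau>' \<in> lower N \<sigma>"
    and eq: "fixv N \<tau> = (fixv N \<tau>' :: (int \<Rightarrow> real) set)"
  shows "\<tau> = \<tau>'"
proof -
  let ?S = "signed_points N"
  have decomp: "\<exists>f\<in>fixv N \<rho>. \<exists>w. w \<in> fixv N id \<and> (\<forall>x. w (\<rho> x) = w (\<sigma> x)) \<and> (\<forall>x. v x = f x + w x)"
    if \<rho>: "\<rho> \<in> lower N \<sigma>" and v: "v \<in> fixv N id" for \<rho> and v :: "int \<Rightarrow> real"
  proof -
    let ?\<kappa> = "inv \<rho> \<circ> \<sigma>"
    have H: "\<rho> \<in> hyperoctahedral N" "B_length N \<sigma> = B_length N \<rho> + B_length N ?\<kappa>"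
      using \<rho> by (auto simp: lower_def B_le_def)
    have \<kappa>: "?\<kappa> \<in> hyperoctahedral N" by (intro comp_hyperoctahedral inv_hyperoctahedral H \<sigma>)
    have iH: "inv \<rho> \<in> hyperoctahedral N" by (rule inv_hyperoctahedral[OF H(1)])
    \<comment> \<open>Vectors act on the right: if \<open>b\<close> is fixed by \<open>inv \<rho> \<circ> \<sigma>\<close>, it is \<open>b \<circ> inv \<rho>\<close> on which \<open>\<rho>\<close> and \<open>\<sigma>\<close> agree.
      So \<open>v \<circ> \<rho>\<close> is decomposed in place of \<open>v\<close>.\<close>
    have "(\<lambda>x. v (\<rho> x)) \<in> fixv N id"
      by (rule fixvI) (auto simp: hyperoctahedral_minus[OF H(1)] fixv_minus[OF v] fixv_outside[OF v] hyperoctahedral_mem_iff[OF H(1)])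
    then obtain a b where ab: "a \<in> fixv N \<rho>" "b \<in> fixv N ?\<kappa>" "\<And>x. v (\<rho> x) = a x + b x"
      using fixv_decomposition[OF H(1) \<kappa>, of "\<lambda>x. v (\<rho> x)"] H(2) by (auto simp: hyperoctahedral_inv_simps[OF H(1)])
    define w where "w = (\<lambda>x. b (inv \<rho> x))"
    have "w \<in> fixv N id"
      by (rule fixvI) (auto simp: w_def hyperoctahedral_minus[OF iH] fixv_minus[OF ab(2)] fixv_outside[OF ab(2)] hyperoctahedral_mem_iff[OF iH])
    moreover have "w (\<rho> x) = w (\<sigma> x)" for x
      using fixv_apply[OF ab(2), of x] by (simp add: w_def hyperoctahedral_inv_simps[OF H(1)])
    moreover have "v x = a x + w x" for x
      using ab(3)[of "inv \<rho> x"] fixv_apply[OF ab(1), of "inv \<rho> x"]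
      by (simp add: w_def hyperoctahedral_inv_simps[OF H(1)])
    ultimately show ?thesis using ab(1) by blast
  qed
  have H: "\<tau> \<in> hyperoctahedral N" "\<tau>' \<in> hyperoctahedral N" using assms by (auto simp: lower_def)
  have agree: "w (\<tau> x) = w (\<tau>' x)"
    if w: "w \<in> fixv N id" "\<And>x. w (\<tau> x) = w (\<sigma> x)" for w :: "int \<Rightarrow> real" and x
  proof -
    obtain f w' where fw: "f \<in> fixv N \<tau>'" "\<And>x. w' (\<tau>' x) = w' (\<sigma> x)" "\<And>x. w x = f x + w' x"
      using decomp[OF assms(3) w(1)] by blast
    have f: "f \<in> fixv N \<tau>" using fw(1) eq by simp
    have fd: "f x - f (\<sigma> x) = (w x - w (\<tau> x)) - (w' x - w' (\<tau>' x))" for x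
      using fw(3)[of x] fw(3)[of "\<sigma> x"] w(2)[of x] fw(2)[of x] by linarith
    have "(f x - f (\<sigma> x)) * f x = (w x - w (\<tau> x)) * f x - (w' x - w' (\<tau>' x)) * f x" for x
      unfolding fd by (rule left_diff_distrib)
    then have "(\<Sum>x\<in>?S. (f x - f (\<sigma> x)) * f x) = 0"
      by (simp only: sum_subtractf sum_fixv_comp[OF H(1) f] sum_fixv_comp[OF H(2) fw(1)] diff_0_right)
    moreover have "(\<Sum>x\<in>?S. (f x - f (\<sigma> x))\<^sup>2) = 2 * (\<Sum>x\<in>?S. (f x - f (\<sigma> x)) * f x)"
    proof -
      have sq: "(f x - f (\<sigma> x))\<^sup>2 = 2 * ((f x - f (\<sigma> x)) * f x) + ((f (\<sigma> x))\<^sup>2 - (f x)\<^sup>2)" for x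
        by (simp add: power2_eq_square algebra_simps)
      have "(\<Sum>x\<in>?S. (f x - f (\<sigma> x))\<^sup>2) = (\<Sum>x\<in>?S. 2 * ((f x - f (\<sigma> x)) * f x))
          + ((\<Sum>x\<in>?S. (f (\<sigma> x))\<^sup>2) - (\<Sum>x\<in>?S. (f x)\<^sup>2))"
        unfolding sq sum.distrib sum_subtractf ..
      also have "(\<Sum>x\<in>?S. (f (\<sigma> x))\<^sup>2) = (\<Sum>x\<in>?S. (f x)\<^sup>2)"
        by (rule sum_apply_hyperoctahedral[OF \<sigma>])
      finally show ?thesis unfolding sum_distrib_left by simp
    qed
    ultimately have "(\<Sum>x\<in>?S. (f x - f (\<sigma> x))\<^sup>2) = 0" by simp
    then have "\<forall>x\<in>?S. (f x - f (\<sigma> x))\<^sup>2 = 0"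
      by (subst (asm) sum_nonneg_eq_0_iff) (simp_all add: finite_signed_points)
    then have f\<sigma>: "f (\<sigma> x) = f x" for x
    proof (cases "x \<in> ?S")
      case True
      then have "(f x - f (\<sigma> x))\<^sup>2 = 0" using \<open>\<forall>x\<in>?S. _ = 0\<close> by blast
      then have "f x - f (\<sigma> x) = 0" by (rule zero_eq_power2[THEN iffD1])
      then show ?thesis by linarith
    qed (simp add: fixv_outside[OF f] hyperoctahedral_mem_iff[OF \<sigma>])
    have "w (\<tau>' x) = f x + w' (\<sigma> x)" using fw(3)[of "\<tau>' x"] fw(2)[of x] fixv_apply[OF fw(1), of x] by simp
    also have "\<dots> = w (\<sigma> x)" using fw(3)[of "\<sigma> x"] f\<sigma> by simp
    finally show ?thesis using w(2)[of x] by simp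
  qed
  have all: "v (\<tau> x) = v (\<tau>' x)" if v: "v \<in> fixv N id" for v :: "int \<Rightarrow> real" and x
  proof -
    obtain f w where fw: "f \<in> fixv N \<tau>" "w \<in> fixv N id" "\<And>x. w (\<tau> x) = w (\<sigma> x)" "\<And>x. v x = f x + w x"
      using decomp[OF assms(2) v] by blast
    have "f \<in> fixv N \<tau>'" using fw(1) eq by simp
    then show ?thesis
      using agree[OF fw(2,3), of x] fixv_apply[OF fw(1), of x] fixv_apply[of f N \<tau>' x] by (simp add: fw(4))
  qed
  show ?thesis
  proof
    fix x show "\<tau> x = \<tau>' x"
    proof (cases "x \<in> ?S")
      case True
      then have S: "\<tau> x \<in> ?S" by (simp add: hyperoctahedral_mem_iff[OF H(1)])
      then have "unitv (\<tau> x) (\<tau>' x) = (unitv (\<tau> x) (\<tau> x) :: real)"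
        using all[OF unitv_fixv[OF S]] by simp
      then show ?thesis using S by (auto simp: unitv_def signed_points_def of_bool_def split: if_splits)
    next
      case False
      then show ?thesis
        using permutes_not_in[OF hyperoctahedral_permutes[OF H(1)]] permutes_not_in[OF hyperoctahedral_permutes[OF H(2)]]
        by simp
    qed
  qed
qed

lemma Omega_tilde_eq:
  "Omega_tilde N \<tau> = (let Z = {A \<in> Omega N \<tau>. inversion_invariant A} in
     if Z = {} then Omega N \<tau> else insert (\<Union>Z) (Omega N \<tau> - Z))"
  unfolding Omega_tilde_def merge_invariant_def ..

text \<open>Merging the invariant blocks loses no information about fixed vectors, since these vanish on all of them.\<close>

lemma fixv_eq_Omega_tilde:
  assumes \<tau>: "\<tau> \<in> hyperoctahedral N"
  shows "(fixv N \<tau> :: (int \<Rightarrow> real) set) =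
    {v \<in> fixv N id. \<forall>A\<in>Omega_tilde N \<tau>. \<forall>x\<in>A. \<forall>y\<in>A. v x = v y}"
proof (intro set_eqI iffI)
  let ?Z = "{A \<in> Omega N \<tau>. inversion_invariant A}"
  fix v :: "int \<Rightarrow> real" assume v: "v \<in> fixv N \<tau>"
  have const: "v x = v y" if "A \<in> Omega N \<tau>" "x \<in> A" "y \<in> A" for A x y
  proof -
    from that(1) obtain z where "A = orbit \<tau> z" by (auto simp: Omega_def)
    then show ?thesis using fixv_orbit[OF v, of x z] fixv_orbit[OF v, of y z] that(2,3) by simp
  qed
  have zero: "v x = 0" if x: "x \<in> \<Union> ?Z" for x
  proof -
    obtain A where A: "A \<in> Omega N \<tau>" "A = uminus ` A" "x \<in> A"
      using x unfolding inversion_invariant_def by blast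
    have "- x \<in> uminus ` A" using A(3) by (rule imageI)
    then have "- x \<in> A" unfolding A(2)[symmetric] .
    then have "v (- x) = v x" using A(3) by (rule const[OF A(1)])
    then show ?thesis using fixv_minus[OF v, of x] by simp
  qed
  have "v x = v y" if "A \<in> Omega_tilde N \<tau>" "x \<in> A" "y \<in> A" for A x y
  proof (cases "A \<in> Omega N \<tau>")
    case True
    then show ?thesis using const that(2,3) by blast
  next
    case False
    then have "A = \<Union> ?Z" using that(1) unfolding Omega_tilde_eq Let_def by (metis (lifting) Diff_iff insert_iff)
    then show ?thesis using that zero by simp
  qed
  moreover have "v \<in> fixv N id" using v by (simp add: fixv_def)
  ultimately show "v \<in> {v \<in> fixv N id. \<forall>A\<in>Omega_tilde N \<tau>. \<forall>x\<in>A. \<forall>y\<in>A. v x = v y}" by blast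
next
  let ?Z = "{A \<in> Omega N \<tau>. inversion_invariant A}"
  fix v :: "int \<Rightarrow> real"
  assume "v \<in> {v \<in> fixv N id. \<forall>A\<in>Omega_tilde N \<tau>. \<forall>x\<in>A. \<forall>y\<in>A. v x = v y}"
  note mem = CollectD[OF this]
  note v = mem[THEN conjunct1] and const = mem[THEN conjunct2, THEN bspec, THEN bspec, THEN bspec]
  have "v (\<tau> x) = v x" for x
  proof (cases "x \<in> signed_points N")
    case True
    then have O: "orbit \<tau> x \<in> Omega N \<tau>" by (simp add: Omega_def)
    have "\<exists>A\<in>Omega_tilde N \<tau>. orbit \<tau> x \<subseteq> A"
    proof (cases "orbit \<tau> x \<in> ?Z")
      case True
      then have "?Z \<noteq> {}" by blast
      then have "\<Union> ?Z \<in> Omega_tilde N \<tau>" unfolding Omega_tilde_eq Let_def by (simp only: if_False insertI1)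
      moreover have "orbit \<tau> x \<subseteq> \<Union> ?Z" using True by (rule Union_upper)
      ultimately show ?thesis by (rule bexI[rotated])
    next
      case False
      then have "orbit \<tau> x \<in> Omega_tilde N \<tau>" using O unfolding Omega_tilde_eq Let_def by (cases "?Z = {}") (simp_all only: if_True if_False insert_iff Diff_iff simp_thms)
      then show ?thesis by (rule bexI[of "\<lambda>A. orbit \<tau> x \<subseteq> A", OF subset_refl])
    qed
    then obtain A where A: "A \<in> Omega_tilde N \<tau>" "orbit \<tau> x \<subseteq> A" by (rule bexE)
    show ?thesis by (rule const[OF A(1) subsetD[OF A(2) orbit.base] subsetD[OF A(2) orbit_self[OF \<tau>]]])
  next
    case False
    then show ?thesis by (simp add: fixv_outside[OF v] hyperoctahedral_mem_iff[OF \<tau>])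
  qed
  then show "v \<in> fixv N \<tau>" using v by (simp add: fixv_def)
qed

lemma inj_on_Omega_tilde:
  assumes "\<sigma> \<in> hyperoctahedral N" shows "inj_on (Omega_tilde N) (lower N \<sigma>)"
proof (rule inj_onI)
  fix \<tau> \<tau>' assume "\<tau> \<in> lower N \<sigma>" "\<tau>' \<in> lower N \<sigma>" "Omega_tilde N \<tau> = Omega_tilde N \<tau>'"
  moreover from this have "fixv N \<tau> = (fixv N \<tau>' :: (int \<Rightarrow> real) set)"
    by (simp add: fixv_eq_Omega_tilde lower_def)
  ultimately show "\<tau> = \<tau>'" by (intro lower_eqI[OF assms])
qed

section \<open>The rank generating function\<close>

text \<open>The symmetry \<open>k \<mapsto> n - c - k\<close>; the exponents of the theorem are \<open>(p - e - c) + (q - i - c) + c\<close>.\<close>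

lemma binom_conv_reverse:
  "(\<Sum>k\<le>n. of_nat ((n choose k) * (n choose (k + c))) * x ^ (n - k - c)) = binom_conv x c n"
proof (cases "c \<le> n")
  case True
  have "(\<Sum>k\<le>n. of_nat ((n choose k) * (n choose (k + c))) * x ^ (n - k - c))
      = (\<Sum>k\<le>n - c. of_nat ((n choose k) * (n choose (k + c))) * x ^ (n - k - c))"
  proof (rule sum.mono_neutral_right)
    show "\<forall>k\<in>{..n} - {..n - c}. of_nat ((n choose k) * (n choose (k + c))) * x ^ (n - k - c) = 0"
    proof
      fix k assume "k \<in> {..n} - {..n - c}"
      then have "n < k + c" by auto
      then show "of_nat ((n choose k) * (n choose (k + c))) * x ^ (n - k - c) = 0" by (simp add: binomial_eq_0)
    qed
  qed auto
  also have "\<dots> = (\<Sum>k\<le>n - c. of_nat ((n choose k) * (n choose (k + c))) * x ^ k)"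
  proof (rule sum.reindex_bij_witness[where i = "\<lambda>k. n - c - k" and j = "\<lambda>k. n - c - k"])
    fix k assume "k \<in> {..n - c}"
    then have k: "k + c \<le> n" using True by auto
    have "n choose (n - c - k) = n choose (k + c)"
      using binomial_symmetric[OF k] by (simp add: add.commute diff_diff_eq)
    moreover have "n choose (n - c - k + c) = n choose k"
      using binomial_symmetric[of k n] k by simp
    ultimately show "of_nat ((n choose (n - c - k)) * (n choose (n - c - k + c))) * x ^ (n - c - k) =
        of_nat ((n choose k) * (n choose (k + c))) * x ^ (n - k - c)"
      by (simp add: mult.commute diff_diff_eq add.commute)
  qed auto
  also have "\<dots> = binom_conv x c n"
    unfolding binom_conv_def
  proof (rule sum.mono_neutral_left)
    show "\<forall>k\<in>{..n} - {..n - c}. of_nat ((n choose k) * (n choose (k + c))) * x ^ k = 0"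
    proof
      fix k assume "k \<in> {..n} - {..n - c}"
      then have "n < k + c" by auto
      then show "of_nat ((n choose k) * (n choose (k + c))) * x ^ k = 0" by (simp add: binomial_eq_0)
    qed
  qed auto
  finally show ?thesis .
next
  case False
  then show ?thesis by (simp add: binom_conv_eq_0 binomial_eq_0)
qed

lemma monom_conv_power: "monom (int m) k = of_nat m * monom 1 1 ^ k"
  by (simp add: monom_power of_nat_monom mult_monom)

lemma Sum_any_disconnected:
  "Sum_any (\<lambda>(i, j). monom (int ((p choose i)\<^sup>2 * (q choose j)\<^sup>2)) (i + j))
     = binom_conv (monom 1 1) 0 p * binom_conv (monom 1 1 :: int poly) 0 q"
proof -
  let ?x = "monom 1 1 :: int poly"
  have "Sum_any (\<lambda>(i, j). monom (int ((p choose i)\<^sup>2 * (q choose j)\<^sup>2)) (i + j))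
      = (\<Sum>(i, j)\<in>{..p} \<times> {..q}. monom (int ((p choose i)\<^sup>2 * (q choose j)\<^sup>2)) (i + j))"
    by (rule Sum_any.expand_superset) (auto simp: binomial_eq_0_iff not_less split: prod.splits)
  also have "\<dots> = (\<Sum>i\<le>p. \<Sum>j\<le>q. (of_nat ((p choose i) * (p choose i)) * ?x ^ i) * (of_nat ((q choose j) * (q choose j)) * ?x ^ j))"
    unfolding sum.cartesian_product[symmetric] monom_conv_power
    by (simp add: power_add power2_eq_square mult_ac)
  also have "\<dots> = binom_conv ?x 0 p * binom_conv ?x 0 q"
    by (simp add: binom_conv_def sum_product)
  finally show ?thesis .
qed

lemma Sum_any_connecting:
  "Sum_any (\<lambda>(e, i). monom (int (2 * c * (p choose e) * (p choose (e + c)) * (q choose i) * (q choose (i + c)))) (p + q - e - i - c))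
     = 2 * of_nat c * monom 1 1 ^ c * binom_conv (monom 1 1) c p * binom_conv (monom 1 1 :: int poly) c q"
proof -
  let ?x = "monom 1 1 :: int poly"
  let ?f = "\<lambda>e i. monom (int (2 * c * (p choose e) * (p choose (e + c)) * (q choose i) * (q choose (i + c)))) (p + q - e - i - c)"
  have f: "?f e i = (2 * of_nat c * ?x ^ c) * ((of_nat ((p choose e) * (p choose (e + c))) * ?x ^ (p - e - c))
      * (of_nat ((q choose i) * (q choose (i + c))) * ?x ^ (q - i - c)))" for e i
  proof (cases "e + c \<le> p \<and> i + c \<le> q")
    case True
    then have "p + q - e - i - c = c + (p - e - c) + (q - i - c)" by linarith
    then show ?thesis unfolding monom_conv_power by (simp add: power_add mult_ac)
  next
    case False
    then consider "p < e + c" | "q < i + c" by linarith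
    then show ?thesis by cases (simp_all add: binomial_eq_0)
  qed
  have "Sum_any (\<lambda>(e, i). ?f e i) = (\<Sum>(e, i)\<in>{..p} \<times> {..q}. ?f e i)"
    by (rule Sum_any.expand_superset) (auto simp: binomial_eq_0_iff not_less split: prod.splits)
  also have "\<dots> = (2 * of_nat c * ?x ^ c) * (binom_conv ?x c p * binom_conv ?x c q)"
    unfolding sum.cartesian_product[symmetric] f sum_distrib_left[symmetric] sum_product[symmetric] binom_conv_reverse
      sum_distrib_right[symmetric] binom_conv_reverse ..
  finally show ?thesis by (simp only: mult.assoc)
qed

lemma annular_eq_Sum_any:
  "annular (monom 1 1 :: int poly) p q =
    Sum_any (\<lambda>(i, j). monom (int ((p choose i)\<^sup>2 * (q choose j)\<^sup>2)) (i + j)) +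
    Sum_any (\<lambda>c. if c \<ge> 1 then
      Sum_any (\<lambda>(e, i).
        monom (int (2 * c * (p choose e) * (p choose (e + c)) * (q choose i) * (q choose (i + c))))
          (p + q - e - i - c))
      else 0)"
proof -
  let ?x = "monom 1 1 :: int poly"
  let ?g = "\<lambda>c. if c \<ge> 1 then 2 * of_nat c * ?x ^ c * binom_conv ?x c p * binom_conv ?x c q else 0"
  have "Sum_any ?g = sum ?g {1..p + q}"
    by (rule Sum_any.expand_superset) (auto split: if_splits, metis binom_conv_eq_0 linorder_not_le mult_zero_left mult_zero_right trans_le_add1)
  also have "\<dots> = (\<Sum>c<p + q. ?g (Suc c))"
    by (rule sum.reindex_bij_witness[where i = Suc and j = "\<lambda>c. c - 1"]) auto
  also have "\<dots> = 2 * (\<Sum>c<p + q. of_nat (Suc c) * ?x ^ Suc c * binom_conv ?x (Suc c) p * binom_conv ?x (Suc c) q)"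
    unfolding sum_distrib_left by (intro sum.cong refl) (simp add: mult.assoc)
  finally show ?thesis
    unfolding Sum_any_disconnected Sum_any_connecting annular_def by simp
qed

theorem theorem4p6:
  fixes p q :: nat
  assumes "p \<ge> 1" and "q \<ge> 1"
  shows "rank_gen_fun p q =
    Sum_any (\<lambda>(i, j). monom (int ((p choose i)\<^sup>2 * (q choose j)\<^sup>2)) (i + j)) +
    Sum_any (\<lambda>c. if c \<ge> 1 then
      Sum_any (\<lambda>(e, i).
        monom (int (2 * c * (p choose e) * (p choose (e + c)) * (q choose i) * (q choose (i + c))))
          (p + q - e - i - c))
      else 0)"
proof -
  let ?N = "p + q" and ?\<gamma> = "gamma_B p q" and ?x = "monom 1 1 :: int poly"
  note T = cycle_type_gamma_B[of p q]
  note \<gamma> = cycle_typeD(1)[OF T]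
  have "rank_gen_fun p q = (\<Sum>\<pi>\<in>Omega_tilde ?N ` lower ?N ?\<gamma>. monom 1 (rank_B p q \<pi>))"
    by (simp add: rank_gen_fun_def NC_B_def S_nc_B_def lower_def)
  also have "\<dots> = (\<Sum>\<tau>\<in>lower ?N ?\<gamma>. monom 1 (rank_B p q (Omega_tilde ?N \<tau>)))"
    using sum.reindex[OF inj_on_Omega_tilde[OF \<gamma>]] by (simp add: comp_def)
  also have "\<dots> = interval_gf ?x ?N ?\<gamma>"
    unfolding interval_gf_def
    by (intro sum.cong refl) (auto simp: lower_def rank_B_Omega_tilde monom_power)
  also have "\<dots> = annular ?x p q"
    using interval_gf_cycle_type[OF T, of ?x] by simp
  finally show ?thesis unfolding annular_eq_Sum_any .
qed

end
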